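(* Let $F$ be a non-discrete locally compact non-archimedean field of characteristic $\neq 2$, with residue field of characteristic $p$ and cardinality $q$. Let $R$ be an integral domain with $p\in R^\times$ and with a fixed square root $q^{1/2}$ of $q$ in $R$, and let $\chi:F\to R^\times$ be a non-trivial smooth character. Let $A$ be the quaternion division algebra over $F$ (unique up to isomorphism) and let $n:A\to F$ be its reduced norm, viewed as a non-degenerate quadratic form on the $4$-dimensional $F$-vector space $A$. Then the Weil factor of $n$ is $\gamma(n)=-1$ (in $R^\times$).
   Context: A smooth character of $F$ is a group homomorphism $F\to R^\times$ with open kernel. For a finite-dimensional $F$-vector space $X$ let $X^*=\mathrm{Hom}_F(X,F)$, $\langle x,x^*\rangle=\chi(x^*(x))$, and identify $X^{**}=X$. $\mathcal S(X)$ is the $R$-module of locally constant compactly supported functions $X\to R$. An $R$-valued Haar measure on $X$ is a non-zero translation-invariant $R$-linear functional $\Phi\mapsto\int_X\Phi(x)dx$ on $\mathcal S(X)$; the volume of a compact open set is the integral of its characteristic function. Normalization: fix an $\mathcal O_F$-lattice $L\subset X$ and put $L_*=\{x^*\in X^*:\langle x,x^*\rangle=1\ \forall x\in L\}$, an $\mathcal O_F$-lattice of $X^*$. Let $dx$, $dx^*$ be the $R$-valued Haar measures on $X$, $X^*$ giving $L$, $L_*$ volume $1$. For an $F$-linear isomorphism $\nu:G\to H$ with $G,H\in\{X,X^*\}$ and corresponding lattices $L_G,L_H\in\{L,L_*\}$, let $a\in\mathbb Z$ be given by $q^a=[\nu(L_G):\nu(L_G)\cap L_H]/[L_H:\nu(L_G)\cap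 L_H]$, and put $|\nu|=q^a\in R$, $|\nu|^{1/2}=(q^{1/2})^a$; thus $\int_H\Phi(y)dy=|\nu|\int_G\Phi(\nu(x))dx$. Fourier transform: $\mathscr F\Phi(x^* )=\int_X\Phi(x)\langle x,x^*\rangle dx$ for $\Phi\in\mathcal S(X)$. For an isomorphism $\beta:X^*\to X$, $\mathbf d_0'(\beta)\in\mathrm{Aut}(\mathcal S(X))$ is $\mathbf d_0'(\beta)\Phi=|\beta|^{-1/2}(\mathscr F\Phi\circ\beta^{-1})$. For a quadratic form $f$ on $X$, $\mathbf t_0(f)\Phi=(\chi\circ f)\cdot\Phi$. To a quadratic form $f$ on $X$ is associated the symmetric homomorphism $\rho:X\to X^*$, $\rho(x)(y)=f(x+y)-f(x)-f(y)$; $f$ is non-degenerate if $\rho$ is an isomorphism. For non-degenerate $f$, the Weil factor $\gamma(f)\in R^\times$ is the unique element such that $$\mathbf d_0'(\rho^{-1})\mathbf t_0(f)\mathbf d_0'(-\rho^{-1})\mathbf t_0(f)=\gamma(f)\,\mathbf t_0(-f)\mathbf d_0'(\rho^{-1})$$ in $\mathrm{Aut}(\mathcal S(X))$; it does not depend on the choice of $L$. *)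

theory Defs
  imports "HOL-Analysis.Analysis" "HOL-Library.Function_Algebras"
begin

section \<open>Non-archimedean local fields\<close>

definition field_topology :: "('f::field \<Rightarrow> real) \<Rightarrow> 'f topology" where
  "field_topology absv = Metric_space.mtopology UNIV (\<lambda>x y. absv (x - y))"

text \<open>The topology of the field is presented by an arbitrary ultrametric absolute value inducing
  it; no normalization of the absolute value is assumed, and nothing below depends on it beyond the
  topology and the valuation ring.\<close>

locale nonarch_local_field =
  fixes absv :: "'f::field \<Rightarrow> real"
  assumes absv_nonneg: "0 \<le> absv x"
    and absv_eq_0_iff: "absv x = 0 \<longleftrightarrow> x = 0"
    and absv_mult: "absv (x * y) = absv x * absv y"
    and absv_ultrametric: "absv (x + y) \<le> max (absv x) (absv y)"
    and locally_compact: "locally_compact_space (field_topology absv)"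
    and non_discrete: "field_topology absv \<noteq> discrete_topology UNIV"

definition valuation_ring :: "('f::field \<Rightarrow> real) \<Rightarrow> 'f set" where
  "valuation_ring absv = {x. absv x \<le> 1}"

definition maximal_ideal :: "('f::field \<Rightarrow> real) \<Rightarrow> 'f set" where
  "maximal_ideal absv = {x. absv x < 1}"

text \<open>For additive subgroups: the index \<open>[L : K]\<close> as the number of cosets \<open>x + K\<close>, \<open>x \<in> L\<close>
  (and \<open>0\<close> if there are infinitely many).\<close>

definition subgroup_index :: "'x::ab_group_add set \<Rightarrow> 'x set \<Rightarrow> nat" where
  "subgroup_index L K = card ((\<lambda>x. (+) x ` K) ` L)"

definition residue_card :: "('f::field \<Rightarrow> real) \<Rightarrow> nat" where
  "residue_card absv = subgroup_index (valuation_ring absv) (maximal_ideal absv)"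

definition residue_char :: "('f::field \<Rightarrow> real) \<Rightarrow> nat" where
  "residue_char absv = (LEAST n. 0 < n \<and> (of_nat n :: 'f) \<in> maximal_ideal absv)"

definition smooth_character :: "('f::field \<Rightarrow> real) \<Rightarrow> ('f \<Rightarrow> 'r::idom) \<Rightarrow> bool" where
  "smooth_character absv \<psi> \<longleftrightarrow>
     (\<forall>x. \<psi> x dvd 1) \<and> (\<forall>x y. \<psi> (x + y) = \<psi> x * \<psi> y) \<and>
     openin (field_topology absv) {x. \<psi> x = 1}"


section \<open>Vector spaces, lattices, Haar measure\<close>

text \<open>The space \<open>X\<close> is the whole type \<open>'x\<close> with scalar multiplication \<open>s\<close>; its dual \<open>X\<^sup>*\<close> is a
  set of functions, with the pointwise group structure of \<open>Function_Algebras\<close>.\<close>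

definition dual_space :: "('f::field \<Rightarrow> 'x::ab_group_add \<Rightarrow> 'x) \<Rightarrow> ('x \<Rightarrow> 'f) set" where
  "dual_space s = {l. Vector_Spaces.linear s (*) l}"

text \<open>The coarsest topology making all linear functionals continuous. For finite-dimensional \<open>X\<close>
  this is the usual vector space topology, i.e. the product topology in any coordinates.\<close>

definition canonical_topology ::
    "('f::field \<Rightarrow> real) \<Rightarrow> ('f \<Rightarrow> 'x::ab_group_add \<Rightarrow> 'x) \<Rightarrow> 'x topology" where
  "canonical_topology absv s =
     topology_generated_by {l -` U | l U. l \<in> dual_space s \<and> openin (field_topology absv) U}"

text \<open>Finitely generated \<open>\<O>\<close>-submodules that span \<open>X\<close>; a lattice exists only if \<open>X\<close> is
  finite-dimensional.\<close>

definition lattice ::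
    "('f::field \<Rightarrow> real) \<Rightarrow> ('f \<Rightarrow> 'x::ab_group_add \<Rightarrow> 'x) \<Rightarrow> 'x set \<Rightarrow> bool" where
  "lattice absv s L \<longleftrightarrow>
     (\<exists>B. finite B \<and> module.span s B = UNIV \<and>
          L = {\<Sum>b\<in>B. s (c b) b | c. c ` B \<subseteq> valuation_ring absv})"

definition dual_lattice ::
    "('f::field \<Rightarrow> 'x::ab_group_add \<Rightarrow> 'x) \<Rightarrow> ('f \<Rightarrow> 'r::idom) \<Rightarrow> 'x set \<Rightarrow> ('x \<Rightarrow> 'f) set" where
  "dual_lattice s \<psi> L = {l \<in> dual_space s. \<forall>x\<in>L. \<psi> (l x) = 1}"

definition schwartz_space ::
    "('f::field \<Rightarrow> real) \<Rightarrow> ('f \<Rightarrow> 'x::ab_group_add \<Rightarrow> 'x) \<Rightarrow> ('x \<Rightarrow> 'r::idom) set" where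
  "schwartz_space absv s =
     {\<Phi>. (\<forall>x. \<exists>U. openin (canonical_topology absv s) U \<and> x \<in> U \<and> (\<forall>y\<in>U. \<Phi> y = \<Phi> x)) \<and>
         compactin (canonical_topology absv s)
           (canonical_topology absv s closure_of {x. \<Phi> x \<noteq> 0})}"

text \<open>Functionals on \<open>\<S>(X)\<close> are represented by \<open>extensional\<close> functions, so that
  equality of functionals on \<open>\<S>(X)\<close> is equality in HOL and the definite description in
  \<open>haar_integral\<close> makes sense.\<close>

definition haar_measure ::
    "('f::field \<Rightarrow> real) \<Rightarrow> ('f \<Rightarrow> 'x::ab_group_add \<Rightarrow> 'x) \<Rightarrow> (('x \<Rightarrow> 'r::idom) \<Rightarrow> 'r) \<Rightarrow> bool" where
  "haar_measure absv s \<mu> \<longleftrightarrow>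
     \<mu> \<in> extensional (schwartz_space absv s) \<and>
     (\<forall>\<Phi>\<in>schwartz_space absv s. \<forall>\<Psi>\<in>schwartz_space absv s.
        \<mu> (\<lambda>x. \<Phi> x + \<Psi> x) = \<mu> \<Phi> + \<mu> \<Psi>) \<and>
     (\<forall>c. \<forall>\<Phi>\<in>schwartz_space absv s. \<mu> (\<lambda>x. c * \<Phi> x) = c * \<mu> \<Phi>) \<and>
     (\<forall>a. \<forall>\<Phi>\<in>schwartz_space absv s. \<mu> (\<lambda>x. \<Phi> (x + a)) = \<mu> \<Phi>) \<and>
     (\<exists>\<Phi>\<in>schwartz_space absv s. \<mu> \<Phi> \<noteq> 0)"

definition haar_integral ::
    "('f::field \<Rightarrow> real) \<Rightarrow> ('f \<Rightarrow> 'x::ab_group_add \<Rightarrow> 'x) \<Rightarrow> 'x set \<Rightarrow> ('x \<Rightarrow> 'r::idom) \<Rightarrow> 'r" where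
  "haar_integral absv s L = (THE \<mu>. haar_measure absv s \<mu> \<and> \<mu> (indicator L) = 1)"

definition fourier ::
    "('f::field \<Rightarrow> real) \<Rightarrow> ('f \<Rightarrow> 'x::ab_group_add \<Rightarrow> 'x) \<Rightarrow> ('f \<Rightarrow> 'r::idom) \<Rightarrow> 'x set \<Rightarrow>
     ('x \<Rightarrow> 'r) \<Rightarrow> ('x \<Rightarrow> 'f) \<Rightarrow> 'r" where
  "fourier absv s \<psi> L \<Phi> l = haar_integral absv s L (\<lambda>x. \<Phi> x * \<psi> (l x))"

text \<open>The integer \<open>a\<close> with \<open>|\<nu>| = q\<^sup>a\<close>, for \<open>\<nu>\<close> between spaces with lattices \<open>LG\<close>, \<open>LH\<close>.\<close>

definition modulus_exponent ::
    "nat \<Rightarrow> ('g::ab_group_add \<Rightarrow> 'h::ab_group_add) \<Rightarrow> 'g set \<Rightarrow> 'h set \<Rightarrow> int" where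
  "modulus_exponent q \<nu> LG LH =
     (THE a. real q powi a =
        real (subgroup_index (\<nu> ` LG) (\<nu> ` LG \<inter> LH)) / real (subgroup_index LH (\<nu> ` LG \<inter> LH)))"

text \<open>Integer powers of a unit; \<open>power_int\<close> would require a division ring.\<close>

definition unit_powi :: "'r::idom \<Rightarrow> int \<Rightarrow> 'r" where
  "unit_powi u k = (if k \<ge> 0 then u ^ nat k else (THE v. u * v = 1) ^ nat (- k))"


section \<open>Quadratic forms and the Weil factor\<close>

definition polar_form :: "('x::ab_group_add \<Rightarrow> 'f::field) \<Rightarrow> 'x \<Rightarrow> 'x \<Rightarrow> 'f" where
  "polar_form f x = (\<lambda>y. f (x + y) - f x - f y)"

definition quadratic_form ::
    "('f::field \<Rightarrow> 'x::ab_group_add \<Rightarrow> 'x) \<Rightarrow> ('x \<Rightarrow> 'f) \<Rightarrow> bool" where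
  "quadratic_form s f \<longleftrightarrow>
     (\<forall>c x. f (s c x) = c\<^sup>2 * f x) \<and>
     (\<forall>x. polar_form f x \<in> dual_space s) \<and>
     (\<forall>y. (\<lambda>x. polar_form f x y) \<in> dual_space s)"

definition nondegenerate_quadratic_form ::
    "('f::field \<Rightarrow> 'x::ab_group_add \<Rightarrow> 'x) \<Rightarrow> ('x \<Rightarrow> 'f) \<Rightarrow> bool" where
  "nondegenerate_quadratic_form s f \<longleftrightarrow>
     quadratic_form s f \<and> bij_betw (polar_form f) UNIV (dual_space s)"

text \<open>The operator \<open>d\<^sub>0'(\<beta>)\<close> for an isomorphism \<open>\<beta> : X\<^sup>* \<rightarrow> X\<close>; only the values of \<open>\<beta>\<close> on
  \<open>dual_space s\<close> matter. The argument \<open>r\<close> is the chosen square root of \<open>q\<close>.\<close>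

definition weil_d ::
    "('f::field \<Rightarrow> real) \<Rightarrow> ('f \<Rightarrow> 'x::ab_group_add \<Rightarrow> 'x) \<Rightarrow> ('f \<Rightarrow> 'r::idom) \<Rightarrow> 'r \<Rightarrow> 'x set \<Rightarrow>
     (('x \<Rightarrow> 'f) \<Rightarrow> 'x) \<Rightarrow> ('x \<Rightarrow> 'r) \<Rightarrow> 'x \<Rightarrow> 'r" where
  "weil_d absv s \<psi> r L \<beta> \<Phi> =
     (\<lambda>x. unit_powi r (- modulus_exponent (residue_card absv) \<beta> (dual_lattice s \<psi> L) L) *
          fourier absv s \<psi> L \<Phi> (inv_into (dual_space s) \<beta> x))"

definition weil_t :: "('f::field \<Rightarrow> 'r::idom) \<Rightarrow> ('x \<Rightarrow> 'f) \<Rightarrow> ('x \<Rightarrow> 'r) \<Rightarrow> 'x \<Rightarrow> 'r" where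
  "weil_t \<psi> f \<Phi> = (\<lambda>x. \<psi> (f x) * \<Phi> x)"

definition weil_factor ::
    "('f::field \<Rightarrow> real) \<Rightarrow> ('f \<Rightarrow> 'x::ab_group_add \<Rightarrow> 'x) \<Rightarrow> ('f \<Rightarrow> 'r::idom) \<Rightarrow> 'r \<Rightarrow> 'x set \<Rightarrow>
     ('x \<Rightarrow> 'f) \<Rightarrow> 'r" where
  "weil_factor absv s \<psi> r L f =
     (let \<beta> = inv (polar_form f); d = weil_d absv s \<psi> r L; t = weil_t \<psi> in
       THE \<gamma>. \<gamma> dvd 1 \<and>
         (\<forall>\<Phi>\<in>schwartz_space absv s.
            d \<beta> (t f (d (\<lambda>l. - \<beta> l) (t f \<Phi>))) = (\<lambda>x. \<gamma> * t (\<lambda>y. - f y) (d \<beta> \<Phi>) x)))"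


section \<open>Quaternion algebras\<close>

text \<open>Quaternion algebras in characteristic different from \<open>2\<close>, i.e. algebras of the form
  \<open>(a, b / F)\<close>.\<close>

definition quaternion_algebra :: "('f::field \<Rightarrow> 'a::ring_1 \<Rightarrow> 'a) \<Rightarrow> bool" where
  "quaternion_algebra s \<longleftrightarrow>
     vector_space s \<and>
     (\<forall>c x y. s c (x * y) = s c x * y \<and> s c (x * y) = x * s c y) \<and>
     (\<exists>a b i j. a \<noteq> 0 \<and> b \<noteq> 0 \<and>
        i * i = s a 1 \<and> j * j = s b 1 \<and> j * i = - (i * j) \<and>
        distinct [1, i, j, i * j] \<and>
        \<not> module.dependent s {1, i, j, i * j} \<and> module.span s {1, i, j, i * j} = UNIV)"

definition standard_involution ::
    "('f::field \<Rightarrow> 'a::ring_1 \<Rightarrow> 'a) \<Rightarrow> ('a \<Rightarrow> 'a) \<Rightarrow> bool" where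
  "standard_involution s \<sigma> \<longleftrightarrow>
     Vector_Spaces.linear s s \<sigma> \<and> \<sigma> 1 = 1 \<and> (\<forall>x. \<sigma> (\<sigma> x) = x) \<and>
     (\<forall>x y. \<sigma> (x * y) = \<sigma> y * \<sigma> x) \<and> (\<forall>x. x * \<sigma> x \<in> range (\<lambda>c. s c 1))"

text \<open>A quaternion algebra has exactly one standard involution, namely
  \<open>t + u i + v j + w i j \<mapsto> t - u i - v j - w i j\<close>; the reduced norm is
  \<open>n(x) = x \<sigma>(x) \<in> F 1 = F\<close>.\<close>

definition reduced_norm :: "('f::field \<Rightarrow> 'a::ring_1 \<Rightarrow> 'a) \<Rightarrow> 'a \<Rightarrow> 'f" where
  "reduced_norm s x = (THE c. s c 1 = x * (THE \<sigma>. standard_involution s \<sigma>) x)"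

end

theory Submission
  imports Defs
begin

text \<open>Completing the square expresses the Weil factor as \<open>|\<beta>|\<^sup>-\<^sup>1\<^sup>/\<^sup>2\<close> times the Gauss integral of
  \<open>\<psi> \<circ> n\<close> over a large ball. Let \<open>K k\<close> be the set of all \<open>x\<close> with \<open>v(n(x)) \<ge> k\<close>, and let \<open>\<psi>\<close> have conductor
  exponent \<open>m\<close>. The bilinear form puts \<open>K m\<close> in duality with \<open>K (m - 1)\<close>, so that the Gauss integral
  vanishes outside \<open>K (m - 1)\<close>; what remains is \<open>vol (K m)\<close> times the sum of a nontrivial
  character of the residue field over the norms of the elements of the residue algebra. The norm form
  is anisotropic there. Counting the solutions of \<open>n(u) = 1\<close> by means of \<open>u = 1 - w\<^sup>-\<^sup>1\<close>, \<open>tr w = 1\<close>,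
  shows that the residue algebra has \<open>q\<^sup>2\<close> elements and that every nonzero norm is taken \<open>q + 1\<close> times.
  Hence the sum is \<open>1 - (q + 1) = - q\<close>. Finally \<open>vol M * vol (M\<^sup>\<bottom>)\<close> is the same for all lattices \<open>M\<close>, and
  comparing \<open>L\<close> with \<open>K m\<close> gives \<open>|\<beta>|\<^sup>1\<^sup>/\<^sup>2 = q * vol (K m)\<close>.\<close>

section \<open>Sums over cosets\<close>

text \<open>\<open>R\<close> is an arbitrary domain in which \<open>p\<close> is invertible,
  possibly of positive characteristic. So every integral is a finite sum over cosets, and division
  is replaced by cancelling powers of \<open>q^(1/2)\<close>. A second obstacle is residue
  characteristic 2: one cannot divide by 2 in the residue field, and \<open>1, i, j, i * j\<close>
  may span a lattice far from the maximal order. For this reason the balls \<open>K k\<close> are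
  defined by the norm alone, and the basis only serves to compare indices and topologies up to a
  bounded shift. No structure theory of division algebras over local fields or of finite fields is
  invoked. \<open>K 2\<close> has index \<open>q ^ 4\<close> in \<open>K 0\<close>, which leaves
  \<open>q\<^sup>2\<close> or \<open>q ^ 4\<close> elements for the residue algebra, and counting
  norms excludes the latter. The same count yields an element of unit trace, which makes
  \<open>K (2 * m - 1 - k)\<close> the exact dual of \<open>K k\<close>, and a norm of valuation 1,
  which lets every \<open>K k\<close> be moved to \<open>K 0\<close> by a multiplication.\<close>

definition subgrp :: "'x::ab_group_add set \<Rightarrow> bool" where
  "subgrp K \<longleftrightarrow> 0 \<in> K \<and> (\<forall>x\<in>K. \<forall>y\<in>K. x - y \<in> K)"

definition cosets :: "'x::ab_group_add set \<Rightarrow> 'x set \<Rightarrow> 'x set set" where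
  "cosets K S = (\<lambda>x. (+) x ` K) ` S"

text \<open>For \<open>K\<close>-invariant \<open>\<Phi>\<close> this is the integral over
  \<open>S\<close> for the measure giving \<open>K\<close> volume 1. \<open>S\<close> need not be a
  subgroup, since fibres of norm and trace are summed over as well. Without \<open>invar\<close> the
  value depends on the chosen representatives.\<close>

definition csum :: "'x::ab_group_add set \<Rightarrow> 'x set \<Rightarrow> ('x \<Rightarrow> 'b::comm_monoid_add) \<Rightarrow> 'b" where
  "csum K S \<Phi> = (\<Sum>C\<in>cosets K S. \<Phi> (SOME x. x \<in> C))"

definition stable :: "'x::ab_group_add set \<Rightarrow> 'x set \<Rightarrow> bool" where
  "stable K S \<longleftrightarrow> (\<forall>x\<in>S. \<forall>k\<in>K. x + k \<in> S)"

definition invar :: "'x::ab_group_add set \<Rightarrow> 'x set \<Rightarrow> ('x \<Rightarrow> 'b) \<Rightarrow> bool" where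
  "invar K S \<Phi> \<longleftrightarrow> (\<forall>x\<in>S. \<forall>y\<in>S. x - y \<in> K \<longrightarrow> \<Phi> x = \<Phi> y)"

lemma subgroup_index_cosets: "subgroup_index L K = card (cosets K L)"
  by (simp add: subgroup_index_def cosets_def)

lemma subgrpD:
  assumes "subgrp K"
  shows subgrp_zero: "0 \<in> K" and subgrp_diff: "x \<in> K \<Longrightarrow> y \<in> K \<Longrightarrow> x - y \<in> K"
  using assms by (auto simp: subgrp_def)

lemma subgrp_minus: "subgrp K \<Longrightarrow> x \<in> K \<Longrightarrow> - x \<in> K"
  using subgrp_diff[of K 0 x] subgrp_zero[of K] by simp

lemma subgrp_add: "subgrp K \<Longrightarrow> x \<in> K \<Longrightarrow> y \<in> K \<Longrightarrow> x + y \<in> K"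
  using subgrp_diff[of K x "- y"] subgrp_minus[of K y] by simp

lemma subgrp_diff_commute: "subgrp K \<Longrightarrow> x - y \<in> K \<longleftrightarrow> y - x \<in> K"
  by (metis minus_diff_eq subgrp_minus)

lemma subgrp_diff_trans: "subgrp K \<Longrightarrow> x - y \<in> K \<Longrightarrow> y - z \<in> K \<Longrightarrow> x - z \<in> K"
  using subgrp_add[of K "x - y" "y - z"] by simp

lemma subgrp_Int: "subgrp K \<Longrightarrow> subgrp M \<Longrightarrow> subgrp (K \<inter> M)"
  by (auto simp: subgrp_def)

lemma mem_coset_iff: "z \<in> (+) x ` K \<longleftrightarrow> z - (x::'x::ab_group_add) \<in> K"
  by (metis (no_types, lifting) add_diff_cancel_left' diff_add_cancel add.commute image_iff)

lemma coset_eq_iff: "subgrp K \<Longrightarrow> (+) x ` K = (+) y ` K \<longleftrightarrow> x - y \<in> K"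
  unfolding set_eq_iff mem_coset_iff
  by (metis diff_self subgrp_zero subgrp_diff_commute subgrp_diff_trans)

lemma some_coset: "subgrp K \<Longrightarrow> (SOME z. z \<in> (+) x ` K) - x \<in> K"
  using someI[of "\<lambda>z. z \<in> (+) x ` K" x] by (auto simp: mem_coset_iff subgrp_zero)

lemma stable_diff: "stable K S \<Longrightarrow> x \<in> S \<Longrightarrow> y - x \<in> K \<Longrightarrow> y \<in> S"
  unfolding stable_def by (metis add.commute diff_add_cancel)

lemma some_coset_mem: "subgrp K \<Longrightarrow> stable K S \<Longrightarrow> x \<in> S \<Longrightarrow> (SOME z. z \<in> (+) x ` K) \<in> S"
  using some_coset stable_diff by blast

lemma some_coset_invar:
  "subgrp K \<Longrightarrow> stable K S \<Longrightarrow> invar K S \<Phi> \<Longrightarrow> x \<in> S \<Longrightarrow> \<Phi> (SOME z. z \<in> (+) x ` K) = \<Phi> x"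
  using some_coset[of K x] some_coset_mem[of K S x] by (auto simp: invar_def)

lemma stable_mono: "K \<subseteq> M \<Longrightarrow> stable M S \<Longrightarrow> stable K S"
  by (auto simp: stable_def)

lemma stable_subgrp: "subgrp M \<Longrightarrow> K \<subseteq> M \<Longrightarrow> stable K M"
  by (auto simp: stable_def intro: subgrp_add)

lemma stable_coset: "subgrp M \<Longrightarrow> K \<subseteq> M \<Longrightarrow> stable K ((+) x ` M)"
  unfolding stable_def mem_coset_iff by (auto simp: diff_add_eq[symmetric] intro: subgrp_add)

lemma stable_Diff: "subgrp K \<Longrightarrow> stable K S \<Longrightarrow> stable K T \<Longrightarrow> stable K (S - T)"
  unfolding stable_def
  by (metis DiffD1 DiffD2 DiffI add_diff_cancel_right' diff_conv_add_uminus subgrp_minus)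

lemma cosets_mono: "S \<subseteq> T \<Longrightarrow> cosets K S \<subseteq> cosets K T"
  by (auto simp: cosets_def)

lemma csum_cong:
  assumes "subgrp K" "stable K S" "\<And>x. x \<in> S \<Longrightarrow> \<Phi> x = \<Psi> x"
  shows "csum K S \<Phi> = csum K S \<Psi>"
  unfolding csum_def
  by (rule sum.cong) (auto simp: cosets_def assms some_coset_mem)

text \<open>Change of variables. The map \<open>g\<close> need not be additive; it only has to
  induce a bijection of cosets, which admits the inversion \<open>w \<mapsto> 1 - inverse w\<close>
  used to count norms.\<close>

lemma csum_bij:
  assumes K: "subgrp K" "stable K S" "invar K S \<Phi>"
    and K': "subgrp K'" "stable K' S'" "invar K' S' \<Psi>"
    and iff: "\<And>x y. x \<in> S \<Longrightarrow> y \<in> S \<Longrightarrow> g x - g y \<in> K' \<longleftrightarrow> x - y \<in> K"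
    and maps: "\<And>x. x \<in> S \<Longrightarrow> g x \<in> S'"
    and onto: "\<And>y. y \<in> S' \<Longrightarrow> \<exists>x\<in>S. y - g x \<in> K'"
    and eq: "\<And>x. x \<in> S \<Longrightarrow> \<Phi> x = \<Psi> (g x)"
  shows "csum K S \<Phi> = csum K' S' \<Psi>"
proof -
  define G where "G C = (+) (g (SOME x. x \<in> C)) ` K'" for C
  have G: "G ((+) x ` K) = (+) (g x) ` K'" if "x \<in> S" for x
    unfolding G_def coset_eq_iff[OF K'(1)]
    using iff[OF some_coset_mem[OF K(1,2) that] that] some_coset[OF K(1)] by simp
  have "inj_on G (cosets K S)"
    unfolding inj_on_def cosets_def
    by (auto simp: G coset_eq_iff K'(1) K(1) iff)
  moreover have "G ` cosets K S = cosets K' S'"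
  proof (intro equalityI subsetI)
    fix C assume "C \<in> G ` cosets K S"
    then show "C \<in> cosets K' S'" unfolding cosets_def using G maps by auto
  next
    fix C assume "C \<in> cosets K' S'"
    then obtain y where y: "y \<in> S'" "C = (+) y ` K'" by (auto simp: cosets_def)
    then obtain x where "x \<in> S" "y - g x \<in> K'" using onto by blast
    then have "C = G ((+) x ` K)" using y by (simp add: G coset_eq_iff K'(1))
    then show "C \<in> G ` cosets K S" using \<open>x \<in> S\<close> by (auto simp: cosets_def)
  qed
  ultimately have "bij_betw G (cosets K S) (cosets K' S')" by (simp add: bij_betw_def)
  then have "(\<Sum>C\<in>cosets K S. \<Psi> (SOME x. x \<in> G C)) = csum K' S' \<Psi>"
    unfolding csum_def by (rule sum.reindex_bij_betw)
  moreover have "csum K S \<Phi> = (\<Sum>C\<in>cosets K S. \<Psi> (SOME x. x \<in> G C))"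
    unfolding csum_def
  proof (rule sum.cong[OF refl])
    fix C assume "C \<in> cosets K S"
    then obtain x where x: "x \<in> S" "C = (+) x ` K" by (auto simp: cosets_def)
    show "\<Phi> (SOME x. x \<in> C) = \<Psi> (SOME x. x \<in> G C)"
      using x by (simp add: G some_coset_invar[OF K] some_coset_invar[OF K'] maps eq)
  qed
  ultimately show ?thesis by simp
qed

lemma csum_const: "csum K S (\<lambda>_. c::'b::semiring_1) = of_nat (card (cosets K S)) * c"
  by (simp add: csum_def)

lemma card_cosets: "card (cosets K S) = csum K S (\<lambda>_. 1::nat)"
  by (simp add: csum_const)

lemma invar_const [simp]: "invar K S (\<lambda>_. c)"
  by (simp add: invar_def)

lemma card_cosets_bij:
  assumes K: "subgrp K" "stable K S" and K': "subgrp K'" "stable K' S'"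
    and iff: "\<And>x y. x \<in> S \<Longrightarrow> y \<in> S \<Longrightarrow> g x - g y \<in> K' \<longleftrightarrow> x - y \<in> K"
    and maps: "\<And>x. x \<in> S \<Longrightarrow> g x \<in> S'"
    and onto: "\<And>y. y \<in> S' \<Longrightarrow> \<exists>x\<in>S. y - g x \<in> K'"
  shows "card (cosets K S) = card (cosets K' S')"
  unfolding card_cosets by (rule csum_bij[where g = g]) (use assms in auto)

lemma cosets_self:
  assumes "subgrp K" shows "cosets K K = {K}"
proof -
  have "(+) x ` K = K" if "x \<in> K" for x
    using coset_eq_iff[OF assms, of x 0] that by simp
  then show ?thesis unfolding cosets_def using subgrp_zero[OF assms] by (auto intro!: image_eqI[of _ _ 0])
qed

text \<open>Finiteness is part of the conclusion because quotients of dual modules are bounded in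
  this way before they are known to be finite.\<close>

lemma card_cosets_inj:
  assumes K: "subgrp K" "stable K S" and K': "subgrp K'" "finite (cosets K' S')"
    and iff: "\<And>x y. x \<in> S \<Longrightarrow> y \<in> S \<Longrightarrow> g x - g y \<in> K' \<longleftrightarrow> x - y \<in> K"
    and maps: "\<And>x. x \<in> S \<Longrightarrow> g x \<in> S'"
  shows "finite (cosets K S) \<and> card (cosets K S) \<le> card (cosets K' S')"
proof -
  define G where "G C = (+) (g (SOME x. x \<in> C)) ` K'" for C
  have G: "G ((+) x ` K) = (+) (g x) ` K'" if "x \<in> S" for x
    unfolding G_def coset_eq_iff[OF K'(1)]
    using iff[OF some_coset_mem[OF K that] that] some_coset[OF K(1)] by simp
  have "inj_on G (cosets K S)"
    unfolding inj_on_def cosets_def by (auto simp: G coset_eq_iff K'(1) K(1) iff)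
  moreover have "G ` cosets K S \<subseteq> cosets K' S'" unfolding cosets_def using G maps by auto
  ultimately show ?thesis using inj_on_finite card_inj_on_le K'(2) by metis
qed

lemma csum_mult_left: "csum K S (\<lambda>x. c * \<Phi> x) = (c::'b::semiring_0) * csum K S \<Phi>"
  by (simp add: csum_def sum_distrib_left)

lemma csum_mult_right: "csum K S (\<lambda>x. \<Phi> x * c) = csum K S \<Phi> * (c::'b::semiring_0)"
  by (simp add: csum_def sum_distrib_right)

lemma csum_add: "csum K S (\<lambda>x. \<Phi> x + \<Psi> x) = csum K S \<Phi> + csum K S \<Psi>"
  by (simp add: csum_def sum.distrib)

lemma csum_swap: "csum K S (\<lambda>x. csum K' S' (\<lambda>y. f x y)) = csum K' S' (\<lambda>y. csum K S (\<lambda>x. f x y))"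
  unfolding csum_def by (rule sum.swap)

lemma csum_zero: "subgrp K \<Longrightarrow> stable K S \<Longrightarrow> (\<And>x. x \<in> S \<Longrightarrow> \<Phi> x = 0) \<Longrightarrow> csum K S \<Phi> = 0"
  by (subst csum_cong[where \<Psi> = "\<lambda>_. 0"]) (auto simp: csum_def)

lemma csum_union:
  assumes "subgrp K" "stable K S" "T \<subseteq> S" "stable K T" "finite (cosets K S)"
  shows "csum K S \<Phi> = csum K T \<Phi> + csum K (S - T) \<Phi>"
proof -
  have "cosets K S = cosets K T \<union> cosets K (S - T)" using assms(3) by (auto simp: cosets_def)
  moreover have "cosets K T \<inter> cosets K (S - T) = {}"
    using stable_diff[OF assms(4)] coset_eq_iff[OF assms(1)]
    by (auto simp: cosets_def) (metis subgrp_diff_commute assms(1))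
  ultimately show ?thesis unfolding csum_def using assms(5)
    by (simp add: sum.union_disjoint)
qed

text \<open>Summation along the fibres of a map that only has to be well defined modulo
  \<open>K'\<close>. It is applied to trace and norm with values in the residue field; the latter is
  not additive.\<close>

lemma csum_fibre:
  assumes K: "subgrp K" "stable K S" "finite (cosets K S)"
    and K': "subgrp K'" "stable K' S'" "finite (cosets K' S')"
    and maps: "\<And>x. x \<in> S \<Longrightarrow> h x \<in> S'"
    and compat: "\<And>x y. x \<in> S \<Longrightarrow> y \<in> S \<Longrightarrow> x - y \<in> K \<Longrightarrow> h x - h y \<in> K'"
  shows "csum K S \<Phi> = csum K' S' (\<lambda>y. csum K {x \<in> S. h x - y \<in> K'} \<Phi>)"
proof -
  define G where "G C = (+) (h (SOME x. x \<in> C)) ` K'" for C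
  have G: "G ((+) x ` K) = (+) (h x) ` K'" if "x \<in> S" for x
    unfolding G_def coset_eq_iff[OF K'(1)]
    using compat[OF some_coset_mem[OF K(1,2) that] that] some_coset[OF K(1)] by simp
  have sub: "G ` cosets K S \<subseteq> cosets K' S'"
    using G maps by (auto simp: cosets_def)
  have fib: "{C \<in> cosets K S. G C = D} = cosets K {x \<in> S. h x - (SOME y. y \<in> D) \<in> K'}"
    if D: "D \<in> cosets K' S'" for D
  proof -
    obtain y where y: "y \<in> S'" "D = (+) y ` K'" using D by (auto simp: cosets_def)
    have "h x - (SOME y. y \<in> D) \<in> K' \<longleftrightarrow> (+) (h x) ` K' = D" for x
      unfolding y coset_eq_iff[OF K'(1)] using some_coset[OF K'(1), of y]
      by (metis K'(1) subgrp_diff_commute subgrp_diff_trans)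
    then show ?thesis using G by (auto simp: cosets_def)
  qed
  have "csum K S \<Phi> = (\<Sum>D\<in>cosets K' S'. \<Sum>C\<in>{C \<in> cosets K S. G C = D}. \<Phi> (SOME x. x \<in> C))"
    unfolding csum_def by (rule sum.group[symmetric, OF K(3) K'(3) sub])
  also have "\<dots> = csum K' S' (\<lambda>y. csum K {x \<in> S. h x - y \<in> K'} \<Phi>)"
    unfolding csum_def by (rule sum.cong[OF refl]) (simp add: fib)
  finally show ?thesis .
qed

lemma finite_cosets_coarse:
  assumes "subgrp K" "subgrp M" "K \<subseteq> M" "finite (cosets K S)"
  shows "finite (cosets M S)"
proof -
  have "cosets M S \<subseteq> (\<lambda>C. (+) (SOME x. x \<in> C) ` M) ` cosets K S"
  proof
    fix C assume "C \<in> cosets M S"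
    then obtain x where x: "x \<in> S" "C = (+) x ` M" by (auto simp: cosets_def)
    have "(+) (SOME z. z \<in> (+) x ` K) ` M = C"
      using some_coset[OF assms(1), of x] assms(3) by (auto simp: x coset_eq_iff assms(2))
    then show "C \<in> (\<lambda>C. (+) (SOME x. x \<in> C) ` M) ` cosets K S"
      using x(1) by (auto simp: cosets_def)
  qed
  then show ?thesis using assms(4) finite_surj by blast
qed

text \<open>The fibres of the identity, with values taken modulo the coarser \<open>M\<close>, are
  the cosets of \<open>M\<close>.\<close>

lemma csum_refine:
  assumes K: "subgrp K" and M: "subgrp M" and sub: "K \<subseteq> M" and S: "stable M S"
    and fin: "finite (cosets K S)"
  shows "csum K S \<Phi> = csum M S (\<lambda>x. csum K ((+) x ` M) \<Phi>)"
proof -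
  have "csum K S \<Phi> = csum M S (\<lambda>y. csum K {x \<in> S. x - y \<in> M} \<Phi>)"
    using csum_fibre[OF K stable_mono[OF sub S] fin M S finite_cosets_coarse[OF K M sub fin], of "\<lambda>x. x"] sub
    by blast
  also have "\<dots> = csum M S (\<lambda>x. csum K ((+) x ` M) \<Phi>)"
  proof (rule csum_cong[OF M S])
    fix x assume "x \<in> S"
    then have "{z \<in> S. z - x \<in> M} = (+) x ` M"
      using stable_diff[OF S] by (auto simp: mem_coset_iff)
    then show "csum K {z \<in> S. z - x \<in> M} \<Phi> = csum K ((+) x ` M) \<Phi>" by simp
  qed
  finally show ?thesis .
qed

lemma csum_translate:
  assumes K: "subgrp K" "stable K S" "invar K ((+) a ` S) \<Phi>"
  shows "csum K ((+) a ` S) \<Phi> = csum K S (\<lambda>x. \<Phi> (a + x))"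
proof (rule csum_bij[symmetric, where g = "\<lambda>x. a + x"])
  show "stable K ((+) a ` S)" using K(2) by (auto simp: stable_def mem_coset_iff algebra_simps)
  show "invar K S (\<lambda>x. \<Phi> (a + x))" using K(3) by (auto simp: invar_def)
  show "\<exists>x\<in>S. y - (a + x) \<in> K" if "y \<in> (+) a ` S" for y
    using that subgrp_zero[OF K(1)] by (metis diff_self image_iff)
qed (use K in auto)

lemma card_cosets_coset:
  assumes "subgrp K" "subgrp M" "K \<subseteq> M"
  shows "card (cosets K ((+) x ` M)) = card (cosets K M)"
  unfolding card_cosets
  by (rule csum_translate) (auto simp: assms stable_subgrp)

lemma csum_refine_invar:
  assumes K: "subgrp K" and M: "subgrp M" and sub: "K \<subseteq> M" and S: "stable M S"
    and fin: "finite (cosets K S)" and inv: "invar M S \<Phi>"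
  shows "csum K S \<Phi> = of_nat (card (cosets K M)) * (csum M S \<Phi> :: 'b::semiring_1)"
proof -
  have "csum K S \<Phi> = csum M S (\<lambda>x. csum K ((+) x ` M) \<Phi>)"
    by (rule csum_refine) fact+
  also have "\<dots> = csum M S (\<lambda>x. of_nat (card (cosets K M)) * \<Phi> x)"
  proof (rule csum_cong[OF M S])
    fix x assume x: "x \<in> S"
    have "csum K ((+) x ` M) \<Phi> = csum K ((+) x ` M) (\<lambda>_. \<Phi> x)"
    proof (rule csum_cong[OF K stable_coset[OF M sub]])
      fix y assume "y \<in> (+) x ` M"
      then have "y - x \<in> M" by (simp add: mem_coset_iff)
      then show "\<Phi> y = \<Phi> x" using inv x stable_diff[OF S x] by (auto simp: invar_def)
    qed
    then show "csum K ((+) x ` M) \<Phi> = of_nat (card (cosets K M)) * \<Phi> x"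
      by (simp add: csum_const card_cosets_coset[OF K M sub])
  qed
  finally show ?thesis by (simp add: csum_mult_left)
qed

lemma card_cosets_mult:
  assumes "subgrp K" "subgrp M" "K \<subseteq> M" "stable M S" "finite (cosets K S)"
  shows "card (cosets K S) = card (cosets K M) * card (cosets M S)"
  using csum_refine_invar[OF assms, of "\<lambda>_. 1::nat"] by (simp add: card_cosets)

lemma finite_cosets_trans:
  assumes "subgrp K" "subgrp M" "K \<subseteq> M" "finite (cosets K M)" "finite (cosets M S)"
  shows "finite (cosets K S)"
proof -
  have "cosets K S \<subseteq> (\<lambda>(C, D). (+) (SOME x. x \<in> C) ` D) ` (cosets M S \<times> cosets K M)"
  proof
    fix C assume "C \<in> cosets K S"
    then obtain x where x: "x \<in> S" "C = (+) x ` K" by (auto simp: cosets_def)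
    define z where "z = (SOME z. z \<in> (+) x ` M)"
    have "x - z \<in> M" unfolding z_def using some_coset[OF assms(2), of x] subgrp_diff_commute[OF assms(2)] by blast
    moreover have "(+) z ` ((+) (x - z) ` K) = C" unfolding x image_image by simp
    ultimately show "C \<in> (\<lambda>(C, D). (+) (SOME x. x \<in> C) ` D) ` (cosets M S \<times> cosets K M)"
      using x(1) by (intro image_eqI[of _ _ "((+) x ` M, (+) (x - z) ` K)"])
        (auto simp: cosets_def z_def)
  qed
  then show ?thesis using assms(4,5) finite_surj finite_cartesian_product by metis
qed

lemma card_cosets_pos: "finite (cosets K S) \<Longrightarrow> x \<in> S \<Longrightarrow> card (cosets K S) > 0"
  by (auto simp: card_gt_0_iff cosets_def)

text \<open>Translation by \<open>a\<close> multiplies the sum by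
  \<open>\<phi> a \<noteq> 1\<close>, and a domain has no zero divisors.\<close>

lemma csum_character:
  fixes \<phi> :: "'x::ab_group_add \<Rightarrow> 'r::idom"
  assumes K: "subgrp K" and M: "subgrp M" and sub: "K \<subseteq> M"
    and hom: "\<And>x y. x \<in> M \<Longrightarrow> y \<in> M \<Longrightarrow> \<phi> (x + y) = \<phi> x * \<phi> y"
    and inv: "invar K M \<phi>" and a: "a \<in> M" "\<phi> a \<noteq> 1"
  shows "csum K M \<phi> = 0"
proof -
  have "(+) a ` M = M"
    using a(1) M by (auto simp: mem_coset_iff intro: subgrp_add subgrp_diff)
  then have "csum K M \<phi> = csum K M (\<lambda>x. \<phi> (a + x))"
    using csum_translate[OF K stable_subgrp[OF M sub], of a \<phi>] inv by simp
  also have "\<dots> = csum K M (\<lambda>x. \<phi> a * \<phi> x)"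
    by (rule csum_cong[OF K stable_subgrp[OF M sub]]) (simp add: hom a)
  finally show ?thesis using a(2) by (simp add: csum_mult_left)
qed

section \<open>Local fields\<close>

context nonarch_local_field
begin

declare absv_eq_0_iff [simp]

lemma absv_0 [simp]: "absv 0 = 0"
  by (simp add: absv_eq_0_iff)

lemma absv_pos_iff [simp]: "0 < absv x \<longleftrightarrow> x \<noteq> 0"
  using absv_nonneg[of x] absv_eq_0_iff[of x] by linarith

lemma absv_1 [simp]: "absv 1 = 1"
  using absv_mult[of 1 1] absv_eq_0_iff[of 1] by simp

lemma absv_minus [simp]: "absv (- x) = absv x"
proof -
  have "absv (- 1) * absv (- 1) = 1" using absv_mult[of "- 1" "- 1"] by simp
  then have "absv (- 1) = 1" using absv_nonneg[of "- 1"] square_eq_1_iff[of "absv (- 1)"] by auto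
  then show ?thesis using absv_mult[of "- 1" x] by simp
qed

lemma absv_diff_le: "absv (x - y) \<le> max (absv x) (absv y)"
  using absv_ultrametric[of x "- y"] by simp

lemma absv_diff_commute: "absv (x - y) = absv (y - x)"
  using absv_minus[of "x - y"] by simp

lemma absv_inverse: "absv (inverse x) = inverse (absv x)"
proof (cases "x = 0")
  case False
  then have "absv x * absv (inverse x) = 1" using absv_mult[of x "inverse x"] by simp
  then show ?thesis by (simp add: inverse_unique)
qed simp

lemma absv_divide: "absv (x / y) = absv x / absv y"
  by (simp add: divide_inverse absv_mult absv_inverse)

lemma absv_power: "absv (x ^ n) = absv x ^ n"
  by (induction n) (auto simp: absv_mult)

lemma absv_power_int: "absv (x powi k) = absv x powi k"
  by (simp add: power_int_def absv_power absv_inverse)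

lemma absv_of_nat_le: "absv (of_nat n) \<le> 1"
proof (induction n)
  case (Suc n)
  then show ?case using absv_ultrametric[of 1 "of_nat n"] by simp
qed simp

lemma absv_sum_eq: "absv x < absv y \<Longrightarrow> absv (x + y) = absv y"
  using absv_ultrametric[of x y] absv_diff_le[of "x + y" x] by auto

section \<open>Topology of the field: balls, compactness, uniformizer\<close>

sublocale F: Metric_space UNIV "\<lambda>x y. absv (x - y)"
proof
  fix x y z
  show "absv (x - z) \<le> absv (x - y) + absv (y - z)"
    using absv_ultrametric[of "x - y" "y - z"] absv_nonneg[of "x - y"] absv_nonneg[of "y - z"] by simp
qed (auto simp: absv_nonneg absv_eq_0_iff absv_diff_commute)

lemma openin_field:
  "openin (field_topology absv) U \<longleftrightarrow> (\<forall>x\<in>U. \<exists>r>0. \<forall>y. absv (y - x) < r \<longrightarrow> y \<in> U)"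
  unfolding field_topology_def F.openin_mtopology F.mball_def
  by (auto simp: subset_eq absv_diff_commute)

lemma topspace_field [simp]: "topspace (field_topology absv) = UNIV"
  by (simp add: field_topology_def)

lemma exists_small: "e > 0 \<Longrightarrow> \<exists>x. x \<noteq> 0 \<and> absv x < e"
proof (rule ccontr)
  assume e: "e > 0" and "\<nexists>x. x \<noteq> 0 \<and> absv x < e"
  then have "y = x" if "absv (y - x) < e" for x y using that by (metis eq_iff_diff_eq_0)
  then have "openin (field_topology absv) U" for U
    unfolding openin_field using e by blast
  then have "field_topology absv = discrete_topology UNIV"
    by (simp add: topology_eq)
  then show False using non_discrete by simp
qed

lemma closedin_le: "closedin (field_topology absv) {x. absv x \<le> r}"
proof -
  have "\<exists>e>0. \<forall>y. absv (y - x) < e \<longrightarrow> r < absv y" if x: "r < absv x" for x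
  proof (cases "x = 0")
    case True
    then show ?thesis using x absv_nonneg by (intro exI[of _ 1]) (auto intro: less_le_trans)
  next
    case False
    then show ?thesis using x absv_sum_eq[of _ x] by (intro exI[of _ "absv x"]) (metis absv_pos_iff diff_add_cancel)
  qed
  then have "openin (field_topology absv) (- {x. absv x \<le> r})"
    unfolding openin_field by (simp add: not_le)
  then show ?thesis by (simp add: closedin_def Compl_eq_Diff_UNIV)
qed

lemma continuous_mult: "continuous_map (field_topology absv) (field_topology absv) ((*) c)"
proof (cases "c = 0")
  case False
  have "openin (field_topology absv) {x. c * x \<in> U}" if U: "openin (field_topology absv) U" for U
    unfolding openin_field
  proof (intro ballI)
    fix x assume "x \<in> {x. c * x \<in> U}"
    then obtain r where r: "r > 0" "\<And>y. absv (y - c * x) < r \<Longrightarrow> y \<in> U"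
      using U[unfolded openin_field] by auto
    have "y \<in> {x. c * x \<in> U}" if "absv (y - x) < r / absv c" for y
      using that r(2)[of "c * y"] False absv_mult[of c "y - x"]
      by (simp add: right_diff_distrib pos_less_divide_eq mult.commute)
    then show "\<exists>r>0. \<forall>y. absv (y - x) < r \<longrightarrow> y \<in> {x. c * x \<in> U}"
      using r(1) False by (intro exI[of _ "r / absv c"]) auto
  qed
  then show ?thesis by (simp add: continuous_map_def)
next
  case True
  then have "(*) c = (\<lambda>_. 0)" by auto
  then show ?thesis by (simp add: continuous_map_const)
qed

text \<open>Small closed balls are compact by local compactness at 0; multiplication by
  \<open>inverse a\<close> enlarges them to any radius.\<close>

lemma compactin_le: "compactin (field_topology absv) {x. absv x \<le> r}"
proof -
  obtain U K where U: "openin (field_topology absv) U" "0 \<in> U" "U \<subseteq> K"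
    and K: "compactin (field_topology absv) K"
    using locally_compact[unfolded locally_compact_space_def, rule_format, of 0] by auto
  obtain e where e: "e > 0" "\<And>x. absv x < e \<Longrightarrow> x \<in> U"
    using bspec[OF U(1)[unfolded openin_field] U(2)] by auto
  obtain a where a: "a \<noteq> 0" "absv a < e / (\<bar>r\<bar> + 1)"
    using exists_small[of "e / (\<bar>r\<bar> + 1)"] e(1) by auto
  have lt: "absv a * r < e"
  proof -
    have "absv a * r \<le> absv a * (\<bar>r\<bar> + 1)" using absv_nonneg[of a] by (intro mult_left_mono) auto
    also have "\<dots> < e" using a(2) by (simp add: field_simps)
    finally show ?thesis .
  qed
  have "{x. absv x \<le> absv a * r} \<subseteq> K" using e(2) U(3) lt by fastforce
  then have "compactin (field_topology absv) {x. absv x \<le> absv a * r}"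
    using closed_compactin[OF K _ closedin_le] by blast
  then have "compactin (field_topology absv) ((*) (inverse a) ` {x. absv x \<le> absv a * r})"
    using image_compactin continuous_mult by blast
  moreover have "(*) (inverse a) ` {x. absv x \<le> absv a * r} = {x. absv x \<le> r}"
  proof -
    have "x \<in> (*) (inverse a) ` {x. absv x \<le> absv a * r}" if "absv x \<le> r" for x
      using that a(1) by (intro image_eqI[of _ _ "a * x"]) (auto simp: absv_mult mult_left_mono absv_nonneg)
    moreover have "absv (inverse a * x) \<le> r" if "absv x \<le> absv a * r" for x
    proof -
      have "absv (inverse a * x) = absv x / absv a" by (simp add: absv_mult absv_inverse divide_inverse)
      then show ?thesis using that a(1) by (simp add: pos_divide_le_eq mult.commute)
    qed
    ultimately show ?thesis by auto
  qed
  ultimately show ?thesis by simp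
qed

lemma continuous_map_absv:
  assumes "\<And>x e. e > 0 \<Longrightarrow> \<exists>d>0. \<forall>y. absv (y - x) < d \<longrightarrow> absv (g y - g x) < e"
  shows "continuous_map (field_topology absv) euclideanreal (\<lambda>x. absv (g x))"
proof -
  have tri: "\<bar>absv x - absv y\<bar> \<le> absv (x - y)" for x y
    using F.triangle[of x y 0] F.triangle[of y x 0] by (simp add: absv_diff_commute abs_le_iff)
  have "openin (field_topology absv) {x. absv (g x) \<in> U}" if "open U" for U
    unfolding openin_field
  proof (intro ballI)
    fix x assume "x \<in> {x. absv (g x) \<in> U}"
    then obtain e where e: "e > 0" "\<And>z. \<bar>z - absv (g x)\<bar> < e \<Longrightarrow> z \<in> U"
      using \<open>open U\<close> by (auto simp: open_dist dist_real_def)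
    obtain d where "d > 0" "\<And>y. absv (y - x) < d \<Longrightarrow> absv (g y - g x) < e"
      using assms[OF e(1)] by blast
    then show "\<exists>r>0. \<forall>y. absv (y - x) < r \<longrightarrow> y \<in> {x. absv (g x) \<in> U}"
      using e(2) le_less_trans[OF tri] by (intro exI[of _ d]) auto
  qed
  then show ?thesis by (simp add: continuous_map_def)
qed

lemma compactin_attains_inf:
  assumes K: "compactin (field_topology absv) K" "K \<noteq> {}"
    and f: "continuous_map (field_topology absv) euclideanreal f"
  shows "\<exists>x\<in>K. \<forall>y\<in>K. f x \<le> (f y :: real)"
proof -
  have "compact (f ` K)" using image_compactin[OF K(1) f] by simp
  then show ?thesis using compact_attains_inf[of "f ` K"] K(2) by auto
qed

text \<open>The open unit ball is also closed, hence compact, so the absolute value attains its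
  maximum on it. The maximum is not 0 because the topology is not discrete.\<close>

lemma exists_uniformizer: "\<exists>p. p \<noteq> 0 \<and> absv p < 1 \<and> (\<forall>x. absv x < 1 \<longrightarrow> absv x \<le> absv p)"
proof -
  have "absv y \<ge> 1" if "absv x \<ge> 1" "absv (y - x) < 1" for x y
    using absv_sum_eq[of "y - x" x] that by simp
  then have "openin (field_topology absv) {x. absv x \<ge> 1}"
    unfolding openin_field by (intro ballI exI[of _ 1]) auto
  moreover have "UNIV - {x. absv x < 1} = {x. absv x \<ge> 1}" by auto
  ultimately have "closedin (field_topology absv) {x. absv x < 1}"
    by (simp add: closedin_def)
  then have K: "compactin (field_topology absv) {x. absv x < 1}"
    using closed_compactin[OF compactin_le[of 1], of "{x. absv x < 1}"] by (simp add: Collect_mono)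
  have "continuous_map (field_topology absv) euclideanreal (\<lambda>x. - absv (id x))"
    by (intro continuous_map_minus continuous_map_absv) auto
  moreover have "{x. absv x < 1} \<noteq> {}" by (auto intro: exI[of _ 0])
  ultimately obtain p where p: "absv p < 1" "\<And>x. absv x < 1 \<Longrightarrow> absv x \<le> absv p"
    using compactin_attains_inf[OF K, of "\<lambda>x. - absv (id x)"] by auto
  obtain a where "a \<noteq> 0" "absv a < 1" using exists_small[of 1] by auto
  then have "p \<noteq> 0" using p(2)[of a] absv_nonneg[of a] by (metis absv_0 absv_eq_0_iff order_antisym)
  then show ?thesis using p by blast
qed

definition unif :: 'f where
  "unif = (SOME p. p \<noteq> 0 \<and> absv p < 1 \<and> (\<forall>x. absv x < 1 \<longrightarrow> absv x \<le> absv p))"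

lemma unif_nz [simp]: "unif \<noteq> 0" and absv_unif_less [simp]: "absv unif < 1"
  and absv_le_unif: "absv x < 1 \<Longrightarrow> absv x \<le> absv unif"
  using someI_ex[OF exists_uniformizer] unfolding unif_def by blast+

lemma absv_unif_pos [simp]: "0 < absv unif" by simp

lemma absv_unif_powi_le_iff: "absv unif powi a \<le> absv unif powi b \<longleftrightarrow> b \<le> a"
  by (metis absv_unif_less absv_unif_pos linorder_not_le order_less_imp_le power_int_decreasing
      power_int_strict_decreasing unif_nz absv_eq_0_iff)

lemma absv_unif_powi_inj: "absv unif powi a = absv unif powi b \<longleftrightarrow> a = b"
  by (metis absv_unif_powi_le_iff order_antisym order_refl)

lemma absv_eq_powi:
  assumes "x \<noteq> 0" shows "\<exists>k. absv x = absv unif powi k"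
proof -
  define s where "s = absv unif"
  have s: "0 < s" "s < 1" by (simp_all add: s_def)
  \<comment> \<open>Since \<open>s < 1\<close>, the logarithm reverses the order. So
    \<open>x / unif powi k\<close> has absolute value greater than \<open>s\<close> and at most 1,
    and the maximality of \<open>s\<close> below 1 forces it to be 1.\<close>
  define k where "k = \<lfloor>log s (absv x)\<rfloor>"
  have "absv x = s powr (log s (absv x))" using s assms by simp
  moreover have "s powr (log s (absv x)) \<le> s powr of_int k"
    using s by (intro powr_mono') (auto simp: k_def)
  moreover have "s powr of_int (k + 1) < s powr (log s (absv x))"
    using s by (intro powr_less_mono') (auto simp: k_def)
  ultimately have k: "s powi (k + 1) < absv x" "absv x \<le> s powi k"
    using s powr_real_of_int'[of s k] powr_real_of_int'[of s "k + 1"] by auto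
  have "absv (x / unif powi k) \<le> 1" "s < absv (x / unif powi k)"
    using k s by (auto simp: absv_divide absv_power_int s_def[symmetric] field_simps power_int_add)
  then have "absv (x / unif powi k) = 1"
    using absv_le_unif[of "x / unif powi k"] by (fastforce simp: s_def)
  then have "absv x = absv unif powi k"
    by (simp add: absv_divide absv_power_int field_simps)
  then show ?thesis ..
qed

text \<open>Unspecified at 0, whence the separate case \<open>x = 0\<close> in
  \<open>absv_le_powi_iff\<close>.\<close>

definition val :: "'f \<Rightarrow> int" where "val x = (THE k. absv x = absv unif powi k)"

lemma absv_val: "x \<noteq> 0 \<Longrightarrow> absv x = absv unif powi val x"
  unfolding val_def by (rule theI') (metis absv_eq_powi absv_unif_powi_inj)

lemma absv_le_powi_iff: "absv x \<le> absv unif powi k \<longleftrightarrow> x = 0 \<or> k \<le> val x"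
proof (cases "x = 0")
  case False
  then show ?thesis using absv_val[OF False] by (simp add: absv_unif_powi_le_iff)
qed (simp add: absv_nonneg)

text \<open>The powers of the maximal ideal, negative ones included: the conductor of
  \<open>\<psi>\<close> may be any of them.\<close>

definition pid :: "int \<Rightarrow> 'f set" where "pid k = {x. absv x \<le> absv unif powi k}"

lemma pid_mem: "x \<in> pid k \<longleftrightarrow> absv x \<le> absv unif powi k"
  by (simp add: pid_def)

lemma subgrp_pid: "subgrp (pid k)"
  unfolding subgrp_def using order_trans[OF absv_diff_le] by (auto simp: absv_nonneg pid_mem)

lemma pid_mono: "j \<le> k \<Longrightarrow> pid k \<subseteq> pid j"
  unfolding pid_def using absv_unif_powi_le_iff by (auto intro: order_trans)

lemma valuation_ring_eq: "valuation_ring absv = pid 0"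
  by (simp add: valuation_ring_def pid_def)

lemma maximal_ideal_eq: "maximal_ideal absv = pid 1"
  unfolding maximal_ideal_def pid_def using absv_le_unif le_less_trans[OF _ absv_unif_less] by auto

lemma pid_mult: "x \<in> pid j \<Longrightarrow> y \<in> pid k \<Longrightarrow> x * y \<in> pid (j + k)"
  unfolding pid_mem absv_mult
  by (subst power_int_add) (simp_all add: absv_nonneg mult_mono)

lemma pid_mult_0: "x \<in> pid 0 \<Longrightarrow> y \<in> pid k \<Longrightarrow> x * y \<in> pid k"
  using pid_mult[of x 0 y k] by simp

text \<open>The residue classes are disjoint open sets covering the compact valuation ring, so a
  finite subcover already contains all of them.\<close>

lemma finite_residue: "finite (cosets (pid 1) (pid 0))"
proof -
  have st: "stable (pid 1) (pid 0)"
    by (intro stable_subgrp subgrp_pid pid_mono) auto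
  have "openin (field_topology absv) U" if UC: "U \<in> cosets (pid 1) (pid 0)" for U
  proof -
    obtain a where U: "U = (+) a ` pid 1" using UC by (auto simp: cosets_def)
    have "y \<in> U" if "x \<in> U" "absv (y - x) < 1" for x y
    proof -
      have "y - x \<in> pid 1" using that(2) by (simp add: maximal_ideal_eq[symmetric] maximal_ideal_def)
      then show ?thesis using that(1) subgrp_add[OF subgrp_pid, of "y - x" 1 "x - a"]
        by (simp add: U mem_coset_iff)
    qed
    then show ?thesis unfolding openin_field by (intro ballI exI[of _ 1]) auto
  qed
  moreover have "pid 0 \<subseteq> \<Union> (cosets (pid 1) (pid 0))"
    using subgrp_zero[OF subgrp_pid] unfolding cosets_def by (force simp: mem_coset_iff)
  moreover have "compactin (field_topology absv) (pid 0)"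
    using compactin_le[of 1] by (simp add: pid_def)
  ultimately obtain \<F> where \<F>: "finite \<F>" "\<F> \<subseteq> cosets (pid 1) (pid 0)" "pid 0 \<subseteq> \<Union> \<F>"
    unfolding compactin_def by meson
  have "cosets (pid 1) (pid 0) \<subseteq> \<F>"
  proof
    fix C assume "C \<in> cosets (pid 1) (pid 0)"
    then obtain x where x: "x \<in> pid 0" "C = (+) x ` pid 1" by (auto simp: cosets_def)
    then obtain D where D: "D \<in> \<F>" "x \<in> D" using \<F>(3) by blast
    then obtain y where "D = (+) y ` pid 1" using \<F>(2) by (auto simp: cosets_def)
    then have "C = D" using D(2) x(2) by (simp add: coset_eq_iff[OF subgrp_pid] mem_coset_iff)
    then show "C \<in> \<F>" using D(1) by simp
  qed
  then show ?thesis using \<F>(1) finite_subset by blast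
qed

lemma residue_card_eq: "residue_card absv = card (cosets (pid 1) (pid 0))"
  by (simp add: residue_card_def subgroup_index_cosets valuation_ring_eq maximal_ideal_eq)

lemma residue_card_ge_2: "residue_card absv \<ge> 2"
proof -
  have "(+) 0 ` pid 1 \<in> cosets (pid 1) (pid 0)" "(+) 1 ` pid 1 \<in> cosets (pid 1) (pid 0)"
    unfolding cosets_def by (rule imageI, simp add: pid_mem)+
  then have "card {(+) 0 ` pid 1, (+) 1 ` pid 1} \<le> card (cosets (pid 1) (pid 0))"
    by (intro card_mono finite_residue) blast
  moreover have "(+) 0 ` pid 1 \<noteq> (+) 1 ` pid 1"
    unfolding coset_eq_iff[OF subgrp_pid] using absv_unif_less by (simp add: pid_mem not_le)
  ultimately show ?thesis by (simp add: residue_card_eq)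
qed

text \<open>Two natural numbers share a residue class because there are finitely many classes; hence
  the \<open>LEAST\<close> in \<open>residue_char\<close> ranges over a nonempty set.\<close>

lemma residue_char_pos: "residue_char absv > 0"
  and residue_char_mem: "of_nat (residue_char absv) \<in> pid 1"
proof -
  have "\<not> inj_on (\<lambda>n. (+) (of_nat n) ` pid 1) (UNIV :: nat set)"
  proof
    assume inj: "inj_on (\<lambda>n. (+) (of_nat n) ` pid 1) (UNIV :: nat set)"
    have "range (\<lambda>n. (+) (of_nat n) ` pid 1) \<subseteq> cosets (pid 1) (pid 0)"
      by (auto simp: cosets_def pid_mem absv_of_nat_le)
    then show False using finite_residue inj by (meson finite_imageD finite_subset infinite_UNIV_nat)
  qed
  then obtain m n where "m < n" "(+) (of_nat n) ` pid 1 = (+) (of_nat m) ` pid 1"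
    unfolding inj_on_def by (metis UNIV_I linorder_neqE_nat)
  then have "0 < n - m \<and> of_nat (n - m) \<in> maximal_ideal absv"
    by (simp add: coset_eq_iff[OF subgrp_pid] maximal_ideal_eq of_nat_diff)
  then have "0 < residue_char absv \<and> of_nat (residue_char absv) \<in> maximal_ideal absv"
    unfolding residue_char_def by (rule LeastI)
  then show "residue_char absv > 0" "of_nat (residue_char absv) \<in> pid 1"
    by (auto simp: maximal_ideal_eq)
qed

text \<open>A subgroup of the residue field that is maximal among those of unit order is everything:
  adjoining one more element multiplies the order by a divisor of \<open>p\<close>.\<close>

lemma residue_card_unit:
  assumes p: "(of_nat (residue_char absv) :: 'r::idom) dvd 1"
  shows "(of_nat (residue_card absv) :: 'r) dvd 1"
proof -
  define Q where "Q M \<longleftrightarrow> subgrp M \<and> pid 1 \<subseteq> M \<and> M \<subseteq> pid 0 \<and>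
    (of_nat (card (cosets (pid 1) M)) :: 'r) dvd 1" for M
  have sub01: "pid 1 \<subseteq> pid 0" by (simp add: pid_mono)
  have "cosets (pid 1) (pid 1) = {pid 1}"
    by (rule cosets_self) (rule subgrp_pid)
  then have "Q (pid 1)" unfolding Q_def using sub01 subgrp_pid by simp
  moreover have "\<forall>M. Q M \<longrightarrow> card (cosets (pid 1) M) \<le> residue_card absv"
    unfolding Q_def residue_card_eq by (auto intro!: card_mono finite_residue cosets_mono)
  ultimately obtain M where M: "Q M" and
    max: "\<And>M'. Q M' \<Longrightarrow> card (cosets (pid 1) M') \<le> card (cosets (pid 1) M)"
    using ex_has_greatest_nat[of Q "pid 1" "\<lambda>M. card (cosets (pid 1) M)" "Suc (residue_card absv)"]
    by (auto simp: less_Suc_eq_le)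
  note M' = M[unfolded Q_def]
  have "pid 0 \<subseteq> M"
  proof
    fix x assume x: "x \<in> pid 0"
    show "x \<in> M"
    proof (rule ccontr)
      assume xM: "x \<notin> M"
      \<comment> \<open>\<open>M2\<close> is \<open>M\<close> plus the integer multiples of
        \<open>x\<close>. \<open>I\<close> is the annihilator of \<open>x\<close> modulo
        \<open>M\<close>, an ideal of the integers that contains the residue characteristic.\<close>
      define M2 where "M2 = {y. \<exists>k. y - of_int k * x \<in> M}"
      define I where "I = {k. of_int k * x \<in> M}"
      have M: "subgrp M" using M' by blast
      have I: "subgrp I" using M by (auto simp: I_def subgrp_def left_diff_distrib)
      have M2: "subgrp M2" unfolding subgrp_def
      proof (intro conjI ballI)
        show "0 \<in> M2" unfolding M2_def using subgrp_zero[OF M] by (auto intro!: exI[of _ 0])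
        fix y z assume "y \<in> M2" "z \<in> M2"
        then obtain k l where "y - of_int k * x \<in> M" "z - of_int l * x \<in> M" by (auto simp: M2_def)
        then have "(y - z) - of_int (k - l) * x \<in> M"
          using subgrp_diff[OF M] by (fastforce simp: algebra_simps)
        then show "y - z \<in> M2" unfolding M2_def by blast
      qed
      have MM2: "M \<subseteq> M2" unfolding M2_def by (auto intro!: exI[of _ 0])
      have xM2: "x \<in> M2" unfolding M2_def using subgrp_zero[OF M] by (auto intro!: exI[of _ 1])
      have intp: "of_int k \<in> pid 0" for k
        by (cases k rule: int_cases2) (auto simp: pid_mem absv_of_nat_le)
      have M20: "M2 \<subseteq> pid 0"
      proof
        fix y assume "y \<in> M2"
        then obtain k where "y - of_int k * x \<in> pid 0" using M' by (auto simp: M2_def)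
        then show "y \<in> pid 0" using subgrp_add[OF subgrp_pid, of _ 0 "of_int k * x"] pid_mult_0[OF intp x]
          by fastforce
      qed
      have mult: "a * k \<in> I" if "k \<in> I" for a k :: int
        using that
      proof (induction a rule: int_induct[where k = 0])
        case (step1 i) then show ?case using subgrp_add[OF I] by (auto simp: distrib_right)
      next
        case (step2 i) then show ?case using subgrp_diff[OF I] by (auto simp: left_diff_distrib)
      qed (simp add: subgrp_zero[OF I])
      have "int (residue_char absv) \<in> I"
        unfolding I_def using pid_mult[OF residue_char_mem x] M' by auto
      note pI = this
      \<comment> \<open>\<open>d\<close> is the order of \<open>x\<close> modulo \<open>M\<close>,
        hence the index of \<open>M\<close> in \<open>M2\<close>. As a divisor of the residue
        characteristic it is a unit in \<open>'r\<close>.\<close>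
      define d where "d = (LEAST d. 0 < d \<and> int d \<in> I)"
      have d: "0 < d" "int d \<in> I"
        using LeastI[of "\<lambda>d. 0 < d \<and> int d \<in> I", OF conjI[OF residue_char_pos pI]] by (auto simp: d_def)
      have min: "e = 0" if "e < d" "int e \<in> I" for e
        using not_less_Least[of e "\<lambda>d. 0 < d \<and> int d \<in> I"] that unfolding d_def by auto
      have modI: "k mod int d = 0" if "k \<in> I" for k
      proof -
        have "k - (k div int d) * int d \<in> I" using subgrp_diff[OF I that mult[OF d(2)]] .
        then have "k mod int d \<in> I" by (simp add: minus_div_mult_eq_mod)
        moreover have "0 \<le> k mod int d" "k mod int d < int d" using d(1) by auto
        ultimately show ?thesis using min[of "nat (k mod int d)"] by (auto simp: nat_less_iff)
      qed
      have "d dvd residue_char absv" using modI[OF pI] by (simp add: mod_eq_0_iff_dvd)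
      then have ud: "(of_nat d :: 'r) dvd 1"
        using p by (metis dvd_def dvd_mult_left of_nat_mult)
      have "1 < d" using d min[of 0] xM unfolding I_def by (cases "d = 1") auto
      have "bij_betw (\<lambda>k. (+) (of_nat k * x) ` M) {..<d} (cosets M M2)"
        unfolding bij_betw_def
      proof (intro conjI subset_antisym subsetI)
        show "inj_on (\<lambda>k. (+) (of_nat k * x) ` M) {..<d}"
        proof (rule inj_onI)
          fix k l assume kl: "k \<in> {..<d}" "l \<in> {..<d}" "(+) (of_nat k * x) ` M = (+) (of_nat l * x) ` M"
          then have "int k - int l \<in> I"
            by (simp add: coset_eq_iff[OF M] I_def left_diff_distrib)
          then have "(int k - int l) mod int d = 0" by (rule modI)
          then show "k = l" using kl(1,2)
            by (simp add: mod_eq_0_iff_dvd mod_eq_dvd_iff[symmetric])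
        qed
      next
        fix C assume "C \<in> (\<lambda>k. (+) (of_nat k * x) ` M) ` {..<d}"
        then obtain k where k: "C = (+) (of_nat k * x) ` M" by auto
        have "of_nat k * x \<in> M2" unfolding M2_def using subgrp_zero[OF M] by (auto intro!: exI[of _ "int k"])
        then show "C \<in> cosets M M2" using k by (auto simp: cosets_def)
      next
        fix C assume "C \<in> cosets M M2"
        then obtain y k where y: "C = (+) y ` M" "y - of_int k * x \<in> M" by (auto simp: cosets_def M2_def)
        define j where "j = nat (k mod int d)"
        have j: "j < d" "int j = k mod int d" using d(1) by (auto simp: j_def nat_less_iff)
        have "k - int j \<in> I" unfolding j(2) using mult[OF d(2), of "k div int d"]
          by (simp add: minus_mod_eq_div_mult)
        then have "of_int k * x - of_nat j * x \<in> M" by (simp add: I_def left_diff_distrib)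
        then have "y - of_nat j * x \<in> M" using y(2) subgrp_diff_trans[OF M] by blast
        then show "C \<in> (\<lambda>k. (+) (of_nat k * x) ` M) ` {..<d}"
          using j(1) y(1) by (auto simp: coset_eq_iff[OF M])
      qed
      then have "card (cosets M M2) = d" using bij_betw_same_card by fastforce
      moreover have fin: "finite (cosets (pid 1) M2)"
        using finite_subset[OF cosets_mono[OF M20] finite_residue] .
      ultimately have card: "card (cosets (pid 1) M2) = card (cosets (pid 1) M) * d"
        using card_cosets_mult[of "pid 1" M M2] M' stable_subgrp[OF M2 MM2] subgrp_pid by simp
      have "(of_nat (card (cosets (pid 1) M) * d) :: 'r) dvd 1"
        using mult_dvd_mono[of "of_nat (card (cosets (pid 1) M)) :: 'r" 1 "of_nat d" 1] M' ud by simp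
      then have "Q M2" unfolding Q_def card using M2 MM2 M20 M' by auto
      moreover have "card (cosets (pid 1) M) > 0"
        using card_cosets_pos[OF finite_subset[OF cosets_mono finite_residue]] M' subgrp_zero[OF M] by blast
      ultimately show False using max[of M2] \<open>1 < d\<close> by (auto simp: card)
    qed
  qed
  then have "M = pid 0" using M' by blast
  then show ?thesis using M' by (simp add: residue_card_eq)
qed

text \<open>Compactness replaces Hensel's lemma. At a point \<open>X\<close> of the unit ball where
  the value is smallest, the derivative \<open>2 * X - t\<close> has absolute value
  \<open>absv t > 1\<close>, so from a nonzero value a Newton step would lead to a strictly smaller
  one inside the ball.\<close>

lemma quadratic_root:
  assumes t: "absv t > 1" and n: "absv n \<le> 1"
  shows "\<exists>X. X\<^sup>2 - t * X + n = 0"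
proof -
  define f where "f X = X\<^sup>2 - t * X + n" for X
  have f: "f (X + h) = f X + h * (2 * X - t + h)" for X h
    unfolding f_def by (simp add: power2_eq_square algebra_simps)
  have "continuous_map (field_topology absv) euclideanreal (\<lambda>x. absv (f x))"
  proof (rule continuous_map_absv)
    fix x e assume e: "(e::real) > 0"
    define C where "C = max (absv (2 * x - t)) 1"
    have C: "C \<ge> 1" by (simp add: C_def)
    have "absv (f y - f x) < e" if "absv (y - x) < min 1 (e / C)" for y
    proof -
      have "absv (2 * x - t + (y - x)) \<le> C"
        using order_trans[OF absv_ultrametric[of "2 * x - t" "y - x"], of C] that by (force simp: C_def)
      then have "absv (f y - f x) \<le> absv (y - x) * C"
        using f[of x "y - x"] by (simp add: absv_mult mult_left_mono absv_nonneg)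
      also have "\<dots> < e" using that C by (simp add: field_simps)
      finally show ?thesis .
    qed
    then show "\<exists>d>0. \<forall>y. absv (y - x) < d \<longrightarrow> absv (f y - f x) < e"
      using e C by (intro exI[of _ "min 1 (e / C)"]) auto
  qed
  moreover have "(0::'f) \<in> {x. absv x \<le> 1}" by simp
  ultimately obtain X where X: "absv X \<le> 1" and min: "\<And>Y. absv Y \<le> 1 \<Longrightarrow> absv (f X) \<le> absv (f Y)"
    using compactin_attains_inf[OF compactin_le[of 1], of "\<lambda>x. absv (f x)"] by blast
  have "f X = 0"
  proof (rule ccontr)
    assume nz: "f X \<noteq> 0"
    have X2: "absv (2 * X) \<le> 1" using X absv_of_nat_le[of 2] by (simp add: absv_mult mult_le_one absv_nonneg)
    then have "absv (2 * X) < absv (- t)" using t by simp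
    from absv_sum_eq[OF this] have den: "absv (2 * X - t) = absv t" by simp
    have den0: "2 * X - t \<noteq> 0" using den t by force
    have tX: "absv (t * X) \<le> absv t" using X t by (simp add: absv_mult mult_left_le)
    have XX: "absv (X\<^sup>2) \<le> 1" using X by (simp add: absv_power power_le_one absv_nonneg)
    have fX: "absv (f X) \<le> absv t"
      unfolding f_def using absv_ultrametric[of "X\<^sup>2 - t * X" n] absv_diff_le[of "X\<^sup>2" "t * X"] tX XX t n
      by linarith
    \<comment> \<open>The Newton step: it cancels the constant and linear terms of the expansion at
      \<open>X\<close>, leaving \<open>f (X + h) = h\<^sup>2\<close>.\<close>
    define h where "h = - f X / (2 * X - t)"
    have absh: "absv h = absv (f X) / absv t" by (simp add: h_def absv_divide den)
    then have h1: "absv h \<le> 1" using fX t by (simp add: divide_le_eq_1)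
    have "f (X + h) = f X + h * (2 * X - t) + h\<^sup>2" unfolding f by (simp add: power2_eq_square algebra_simps)
    then have "f (X + h) = h\<^sup>2" using den0 by (simp add: h_def)
    moreover have "absv (X + h) \<le> 1" using absv_ultrametric[of X h] X h1 by linarith
    ultimately have "absv (f X) \<le> absv h * absv h"
      using min[of "X + h"] by (simp add: power2_eq_square absv_mult)
    also have "\<dots> \<le> absv h" using h1 absv_nonneg[of h] by (simp add: mult_left_le)
    also have "\<dots> < absv (f X) / 1" unfolding absh using nz t by (intro divide_strict_left_mono) auto
    finally show False by simp
  qed
  then show ?thesis by (auto simp: f_def)
qed

end

section \<open>Quaternion division algebras\<close>

text \<open>Used for the exhausting filtrations \<open>K\<close> and \<open>pid\<close>. With
  \<open>m \<ge> 0\<close> the term \<open>P (- m)\<close> only grows when \<open>m\<close> is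
  doubled or added to another such bound.\<close>

lemma finite_min_exhaust:
  assumes "finite S" "S \<subseteq> (\<Union>k. P k)" "\<And>j k. j \<le> k \<Longrightarrow> P k \<subseteq> P (j::int)"
  shows "\<exists>m\<ge>0. S \<subseteq> P (- m)"
  using assms(1,2)
proof (induction S)
  case (insert x S)
  then obtain m where m: "m \<ge> 0" "S \<subseteq> P (- m)" by auto
  obtain k where k: "x \<in> P k" using insert.prems by auto
  have "P k \<subseteq> P (- (max m (- k)))" "P (- m) \<subseteq> P (- (max m (- k)))"
    by (rule assms(3); simp)+
  then show ?case using m k by (intro exI[of _ "max m (- k)"]) auto
qed auto

text \<open>That the algebra is a division algebra is carried by the type class of
  \<open>'a\<close>; the equations for \<open>i\<close> and \<open>j\<close> are also satisfied in
  matrix algebras.\<close>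

locale quaternion_basis = nonarch_local_field absv for absv :: "'f::field \<Rightarrow> real" +
  fixes scale :: "'f \<Rightarrow> 'a::division_ring \<Rightarrow> 'a" and a b :: 'f and i j :: 'a
  assumes char: "CHAR('f) \<noteq> 2"
    and vs: "vector_space scale"
    and scale_mult: "scale c (x * y) = scale c x * y" "scale c (x * y) = x * scale c y"
    and ab_nz [simp]: "a \<noteq> 0" "b \<noteq> 0"
    and ii: "i * i = scale a 1" and jj: "j * j = scale b 1" and ji: "j * i = - (i * j)"
    and dist: "distinct [1, i, j, i * j]"
    and indep: "\<not> module.dependent scale {1, i, j, i * j}"
    and span: "module.span scale {1, i, j, i * j} = UNIV"
begin

sublocale V: vector_space scale by (rule vs)

lemma two_nz [simp]: "(2::'f) \<noteq> 0"
proof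
  assume "(2::'f) = 0"
  then have "of_nat 2 = (0::'f)" by simp
  then have "CHAR('f) dvd 2" by (simp only: of_nat_eq_0_iff_char_dvd)
  then have "CHAR('f) = 1 \<or> CHAR('f) = 2" by (metis prime_nat_iff two_is_prime_nat)
  then show False using char CHAR_not_1 by auto
qed

section \<open>Coordinates, conjugation, trace and norm\<close>

definition q4 :: "'f \<Rightarrow> 'f \<Rightarrow> 'f \<Rightarrow> 'f \<Rightarrow> 'a" where
  "q4 t u v w = scale t 1 + scale u i + scale v j + scale w (i * j)"

lemma q4_exists: "\<exists>t u v w. x = q4 t u v w"
proof -
  have "x \<in> module.span scale {1, i, j, i * j}" using span by simp
  then obtain t u v w where "x - scale t 1 - scale u i - scale v j - scale w (i * j) = 0"
    unfolding V.span_breakdown_eq by auto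
  then have "x = q4 t u v w" unfolding q4_def by (simp add: algebra_simps)
  then show ?thesis by blast
qed

lemma q4_cases: obtains t u v w where "x = q4 t u v w"
  using q4_exists by blast

lemma q4_eq_0: "q4 t u v w = 0 \<longleftrightarrow> t = 0 \<and> u = 0 \<and> v = 0 \<and> w = 0"
proof
  assume 0: "q4 t u v w = 0"
  define f where "f x = (if x = 1 then t else if x = i then u else if x = j then v else w)" for x
  have d: "1 \<noteq> i" "1 \<noteq> j" "1 \<noteq> i * j" "i \<noteq> j" "i \<noteq> i * j" "j \<noteq> i * j" using dist by auto
  have "(\<Sum>x\<in>{1, i, j, i * j}. scale (f x) x) = q4 t u v w"
    unfolding q4_def f_def using d d[symmetric] by (auto simp: add.assoc)
  then have f: "f x = 0" if "x \<in> {1, i, j, i * j}" for x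
    using V.independentD[OF indep _ subset_refl _ that, of f] 0 by simp
  show "t = 0 \<and> u = 0 \<and> v = 0 \<and> w = 0"
    using f[of 1] f[of i] f[of j] f[of "i * j"] d d[symmetric] by (auto simp: f_def)
qed (simp add: q4_def)

lemma q4_add: "q4 t u v w + q4 t' u' v' w' = q4 (t + t') (u + u') (v + v') (w + w')"
  unfolding q4_def by (simp add: V.scale_left_distrib algebra_simps)

lemma q4_scale: "scale c (q4 t u v w) = q4 (c * t) (c * u) (c * v) (c * w)"
  unfolding q4_def by (simp add: V.scale_right_distrib)

lemma q4_minus: "- q4 t u v w = q4 (- t) (- u) (- v) (- w)"
  unfolding q4_def by (simp add: algebra_simps)

lemma q4_diff: "q4 t u v w - q4 t' u' v' w' = q4 (t - t') (u - u') (v - v') (w - w')"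
  unfolding q4_def by (simp add: V.scale_left_diff_distrib algebra_simps)

lemma q4_inject: "q4 t u v w = q4 t' u' v' w' \<longleftrightarrow> t = t' \<and> u = u' \<and> v = v' \<and> w = w'"
  using q4_eq_0[of "t - t'" "u - u'" "v - v'" "w - w'"] by (simp add: q4_diff[symmetric])

lemma scale_left: "scale c x * y = scale c (x * y)" and scale_right: "x * scale c y = scale c (x * y)"
  by (simp_all add: scale_mult[symmetric])

lemma basis_mult:
  "i * (i * j) = scale a j" "(i * j) * i = scale (- a) j" "j * (i * j) = scale (- b) i"
  "(i * j) * j = scale b i" "(i * j) * (i * j) = scale (- (a * b)) 1"
proof -
  show 1: "i * (i * j) = scale a j" by (simp add: mult.assoc[symmetric] ii scale_left)
  show 2: "(i * j) * i = scale (- a) j" using 1 by (simp add: mult.assoc ji)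
  show 3: "(i * j) * j = scale b i" by (simp add: mult.assoc jj scale_right)
  have "j * (i * j) = - (i * j) * j" by (simp add: mult.assoc[symmetric] ji)
  then show 4: "j * (i * j) = scale (- b) i" using 3 by simp
  have "(i * j) * (i * j) = i * (j * (i * j))" by (simp add: mult.assoc)
  then show "(i * j) * (i * j) = scale (- (a * b)) 1" by (simp add: 4 scale_right ii mult.commute)
qed

lemma q4_mult: "q4 t u v w * q4 t' u' v' w' =
  q4 (t * t' + a * u * u' + b * v * v' - a * b * w * w')
     (t * u' + u * t' - b * v * w' + b * w * v')
     (t * v' + v * t' + a * u * w' - a * w * u')
     (t * w' + w * t' + u * v' - v * u')"
  unfolding q4_def
  by (simp add: distrib_left distrib_right scale_left scale_right basis_mult ii jj ji
      V.scale_left_distrib V.scale_left_diff_distrib) (simp add: algebra_simps)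

definition re :: "'a \<Rightarrow> 'f" where "re x = (THE t. \<exists>u v w. x = q4 t u v w)"

lemma re_q4 [simp]: "re (q4 t u v w) = t"
  unfolding re_def by (rule the_equality) (auto simp: q4_inject)

definition em :: "'f \<Rightarrow> 'a" where "em c = scale c 1"

lemma em_q4: "em c = q4 c 0 0 0" by (simp add: em_def q4_def)

lemma em_inject [simp]: "em c = em d \<longleftrightarrow> c = d" by (simp add: em_q4 q4_inject)

lemma em_mult: "em (c * d) = em c * em d" by (simp add: em_q4 q4_mult)

lemma em_add: "em (c + d) = em c + em d" by (simp add: em_q4 q4_add)

lemma em_diff: "em (c - d) = em c - em d" by (simp add: em_q4 q4_diff)

lemma em_0 [simp]: "em 0 = 0" and em_1 [simp]: "em 1 = 1" by (simp_all add: em_def)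

lemma em_commute: "x * em c = em c * x" by (simp add: em_def scale_left scale_right)

lemma scale_em: "scale c x = em c * x" by (simp add: em_def scale_left)

definition conj :: "'a \<Rightarrow> 'a" where "conj x = em (2 * re x) - x"

lemma conj_q4 [simp]: "conj (q4 t u v w) = q4 t (- u) (- v) (- w)"
  by (simp add: conj_def em_q4 q4_diff)

definition tr :: "'a \<Rightarrow> 'f" where "tr x = 2 * re x"

definition nrm :: "'a \<Rightarrow> 'f" where "nrm x = re (x * conj x)"

lemma nrm_q4: "nrm (q4 t u v w) = t\<^sup>2 - a * u\<^sup>2 - b * v\<^sup>2 + a * b * w\<^sup>2"
  by (simp add: nrm_def q4_mult power2_eq_square algebra_simps)

lemma tr_q4: "tr (q4 t u v w) = 2 * t" by (simp add: tr_def)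

lemma mult_conj: "x * conj x = em (nrm x)"
  by (rule q4_cases[of x]) (simp add: em_q4 nrm_q4 q4_mult q4_inject power2_eq_square algebra_simps)

lemma conj_mult_self: "conj x * x = em (nrm x)"
  by (rule q4_cases[of x]) (simp add: em_q4 nrm_q4 q4_mult q4_inject power2_eq_square algebra_simps)

lemma conj_add: "conj (x + y) = conj x + conj y"
  by (rule q4_cases[of x], rule q4_cases[of y]) (simp add: q4_add)

lemma conj_conj [simp]: "conj (conj x) = x"
  by (rule q4_cases[of x]) simp

lemma conj_mult: "conj (x * y) = conj y * conj x"
  by (rule q4_cases[of x], rule q4_cases[of y]) (simp add: q4_mult q4_inject algebra_simps)

lemma conj_em [simp]: "conj (em c) = em c" by (simp add: em_q4)

lemma conj_minus: "conj (- x) = - conj x"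
  by (rule q4_cases[of x]) (simp add: q4_minus)

lemma add_conj: "x + conj x = em (tr x)" by (simp add: conj_def tr_def)

lemma conj_0 [simp]: "conj 0 = 0" and conj_1 [simp]: "conj 1 = 1"
  using conj_em[of 0] conj_em[of 1] by auto

lemma tr_add: "tr (x + y) = tr x + tr y"
  by (rule q4_cases[of x], rule q4_cases[of y]) (simp add: q4_add tr_q4 algebra_simps)

lemma tr_scale: "tr (scale c x) = c * tr x"
  by (rule q4_cases[of x]) (simp add: q4_scale tr_q4)

lemma tr_minus: "tr (- x) = - tr x"
  by (rule q4_cases[of x]) (simp add: q4_minus tr_q4)

lemma tr_diff: "tr (x - y) = tr x - tr y"
  using tr_add[of x "- y"] by (simp add: tr_minus)

lemma tr_conj [simp]: "tr (conj x) = tr x"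
  by (rule q4_cases[of x]) (simp add: tr_q4)

lemma tr_em [simp]: "tr (em c) = 2 * c" by (simp add: em_q4 tr_q4)

lemma tr_0 [simp]: "tr 0 = 0" using tr_em[of 0] by simp

lemma nrm_em [simp]: "nrm (em c) = c\<^sup>2" by (simp add: em_q4 nrm_q4)

lemma nrm_0 [simp]: "nrm 0 = 0" and nrm_1 [simp]: "nrm 1 = 1"
  using nrm_em[of 0] nrm_em[of 1] by auto

lemma nrm_conj [simp]: "nrm (conj x) = nrm x"
  by (rule q4_cases[of x]) (simp add: nrm_q4)

lemma nrm_minus [simp]: "nrm (- x) = nrm x"
  by (rule q4_cases[of x]) (simp add: q4_minus nrm_q4)

lemma nrm_mult: "nrm (x * y) = nrm x * nrm y"
proof -
  have "em (nrm (x * y)) = x * (y * conj y) * conj x"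
    by (simp add: mult_conj[symmetric] conj_mult mult.assoc)
  also have "\<dots> = em (nrm x * nrm y)"
    by (simp add: mult_conj em_commute[of x] mult.assoc em_mult[symmetric] mult.commute)
  finally show ?thesis by simp
qed

lemma nrm_scale: "nrm (scale c x) = c\<^sup>2 * nrm x"
  by (simp add: scale_em nrm_mult)

text \<open>Anisotropy, from the absence of zero divisors in \<open>'a\<close>.\<close>

lemma nrm_eq_0 [simp]: "nrm x = 0 \<longleftrightarrow> x = 0"
  using mult_conj[of x] by (metis conj_0 conj_conj em_0 mult_eq_0_iff nrm_0)

lemma nrm_inverse: "nrm (inverse x) = inverse (nrm x)"
proof (cases "x = 0")
  case False
  then have "nrm x * nrm (inverse x) = 1" by (simp add: nrm_mult[symmetric])
  then show ?thesis by (simp add: inverse_unique)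
qed simp

section \<open>The bilinear form of the norm\<close>

definition bil :: "'a \<Rightarrow> 'a \<Rightarrow> 'f" where "bil x y = tr (x * conj y)"

lemma nrm_add: "nrm (x + y) = nrm x + nrm y + bil x y"
proof -
  have "em (nrm (x + y)) = x * conj x + y * conj y + (x * conj y + conj (x * conj y))"
    by (simp add: mult_conj[symmetric] conj_add conj_mult algebra_simps)
  then have "em (nrm (x + y)) = em (nrm x + nrm y + bil x y)"
    unfolding mult_conj add_conj bil_def em_add .
  then show ?thesis by simp
qed

lemma polar_form_nrm: "polar_form nrm x y = bil x y"
  by (simp add: polar_form_def nrm_add)

lemma bil_commute: "bil x y = bil y x"
  unfolding bil_def by (metis conj_conj conj_mult tr_conj)

lemma bil_add_left: "bil (x + y) z = bil x z + bil y z"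
  by (simp add: bil_def distrib_right tr_add)

lemma bil_add_right: "bil x (y + z) = bil x y + bil x z"
  using bil_add_left bil_commute by metis

lemma bil_scale_left: "bil (scale c x) y = c * bil x y"
  by (simp add: bil_def scale_left tr_scale)

lemma bil_scale_right: "bil x (scale c y) = c * bil x y"
  using bil_scale_left bil_commute by metis

lemma bil_minus_left: "bil (- x) y = - bil x y"
  by (simp add: bil_def tr_minus)

lemma bil_minus_right: "bil x (- y) = - bil x y"
  using bil_minus_left bil_commute by metis

lemma bil_diff_left: "bil (x - y) z = bil x z - bil y z"
  by (simp add: bil_def left_diff_distrib tr_diff)

lemma bil_diff_right: "bil x (y - z) = bil x y - bil x z"
  using bil_diff_left bil_commute by metis

lemma bil_0 [simp]: "bil 0 x = 0" "bil x 0 = 0"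
  by (simp_all add: bil_def)

lemma bil_q4: "bil (q4 t u v w) (q4 t' u' v' w') =
  2 * (t * t' - a * u * u' - b * v * v' + a * b * w * w')"
  by (simp add: bil_def q4_mult tr_q4)

lemma linear_iff: "Vector_Spaces.linear scale (*) l \<longleftrightarrow>
  (\<forall>x y. l (x + y) = l x + l y) \<and> (\<forall>c x. l (scale c x) = c * l x)"
proof -
  have "vector_space ((*) :: 'f \<Rightarrow> 'f \<Rightarrow> 'f)"
    by unfold_locales (auto simp: algebra_simps)
  then show ?thesis
    unfolding Vector_Spaces.linear_def module_hom_def module_hom_axioms_def
    using vs vector_space_def by (auto simp: module_iff_vector_space)
qed

lemma dual_space_iff: "l \<in> dual_space scale \<longleftrightarrow>
  (\<forall>x y. l (x + y) = l x + l y) \<and> (\<forall>c x. l (scale c x) = c * l x)"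
  by (simp add: dual_space_def linear_iff)

lemma bil_surj:
  assumes "l \<in> dual_space scale" shows "\<exists>x. bil x = l"
proof -
  note l = assms[unfolded dual_space_iff]
  \<comment> \<open>In this basis the form is diagonal with entries \<open>2\<close>,
    \<open>- 2 * a\<close>, \<open>- 2 * b\<close>, \<open>2 * a * b\<close>; the values of
    \<open>l\<close> are divided by them.\<close>
  define x where "x = q4 (l 1 / 2) (- l i / (2 * a)) (- l j / (2 * b)) (l (i * j) / (2 * a * b))"
  have "bil x y = l y" for y
  proof (rule q4_cases[of y])
    fix t u v w assume y: "y = q4 t u v w"
    have "l y = t * l 1 + u * l i + v * l j + w * l (i * j)" unfolding y q4_def using l by simp
    also have "\<dots> = bil x y" unfolding y x_def bil_q4 by (simp add: field_simps)
    finally show ?thesis by simp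
  qed
  then show ?thesis by blast
qed

lemma bil_inj: "bil x = bil y \<longleftrightarrow> x = y"
proof
  assume "bil x = bil y"
  then have 0: "bil (x - y) z = 0" for z by (simp add: bil_diff_left)
  have "x - y = 0"
  proof (rule ccontr)
    assume "x - y \<noteq> 0"
    \<comment> \<open>This pairing is also the trace of 1, which is 2 and therefore nonzero.\<close>
    moreover have "bil (x - y) (conj (inverse (x - y))) = 0" by (rule 0)
    ultimately show False by (simp add: bil_def tr_em[of 1, simplified])
  qed
  then show "x = y" by simp
qed simp

lemma bil_dual: "bil x \<in> dual_space scale"
  by (simp add: dual_space_iff bil_add_right bil_scale_right)

lemma nondegenerate_nrm: "nondegenerate_quadratic_form scale nrm"
proof -
  have pf: "polar_form nrm = bil" by (intro ext polar_form_nrm)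
  have "bij_betw bil UNIV (dual_space scale)"
    unfolding bij_betw_def inj_on_def using bil_inj bil_dual by (auto dest: bil_surj)
  moreover have "(\<lambda>x. bil x y) \<in> dual_space scale" for y
    using bil_dual[of y] by (simp add: bil_commute[of _ y])
  ultimately show ?thesis
    unfolding nondegenerate_quadratic_form_def quadratic_form_def pf
    by (simp add: nrm_scale bil_dual)
qed

section \<open>Identification with the reduced norm\<close>

lemma standard_involution_conj: "standard_involution scale conj"
proof -
  have "Vector_Spaces.linear scale scale conj"
    by unfold_locales (auto simp: conj_add scale_em conj_mult em_commute)
  then show ?thesis unfolding standard_involution_def
    by (auto simp: conj_mult mult_conj em_def)
qed

text \<open>Scalars are fixed by linearity. For any other \<open>x\<close>, the scalars
  \<open>x * \<sigma> x\<close> and \<open>(1 + x) * \<sigma> (1 + x)\<close> force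
  \<open>\<sigma> x = em t - x\<close>. Then \<open>x\<close> satisfies two monic quadratic
  equations over the field, and their difference would make \<open>x\<close> a scalar unless
  \<open>t = tr x\<close>.\<close>

lemma standard_involution_unique:
  assumes "standard_involution scale \<sigma>" shows "\<sigma> = conj"
proof
  fix x
  note \<sigma> = assms[unfolded standard_involution_def]
  have em: "\<exists>c. y * \<sigma> y = em c" for y using \<sigma> by (auto simp: em_def)
  have lin: "\<sigma> (x + y) = \<sigma> x + \<sigma> y" "\<sigma> (scale c x) = scale c (\<sigma> x)" for x y c
    using \<sigma> by (auto simp: Vector_Spaces.linear_def module_hom_def module_hom_axioms_def)
  show "\<sigma> x = conj x"
  proof (cases "\<exists>c. x = em c")
    case True
    then show ?thesis using lin(2)[of _ 1] \<sigma> by (auto simp: em_def[symmetric] conj_em)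
  next
    case False
    obtain n where n: "x * \<sigma> x = em n" using em by blast
    obtain m where m: "(1 + x) * \<sigma> (1 + x) = em m" using em by blast
    define t where "t = m - n - 1"
    have "\<sigma> 1 = 1" using \<sigma> by blast
    then have "1 + x + (em n + \<sigma> x) = em m" using m n by (simp add: lin algebra_simps)
    then have "\<sigma> x = em m - em n - em 1 - x" by (simp add: algebra_simps)
    then have t: "\<sigma> x = em t - x" by (simp only: t_def em_diff)
    have "conj x = em (tr x) - x" using add_conj[of x] by (simp add: algebra_simps)
    with mult_conj[of x] have "x * em (tr x) - x * x = em (nrm x)" by (simp add: right_diff_distrib)
    moreover have "x * em t - x * x = em n" using n t by (simp add: right_diff_distrib)
    ultimately have eq: "em (t - tr x) * x = em (n - nrm x)"
      by (simp add: em_diff em_commute left_diff_distrib) (metis diff_add_cancel diff_diff_eq2 add_diff_cancel_left' diff_diff_add)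
    have "t = tr x"
    proof (rule ccontr)
      assume "t \<noteq> tr x"
      then have "x = em (inverse (t - tr x)) * (em (t - tr x) * x)"
        by (simp add: mult.assoc[symmetric] em_mult[symmetric])
      then show False using False unfolding eq em_mult[symmetric] by blast
    qed
    then have "x + \<sigma> x = x + conj x" using t add_conj[of x] by simp
    then show ?thesis by simp
  qed
qed

lemma reduced_norm_eq: "reduced_norm scale = nrm"
proof
  fix x
  have "(THE \<sigma>. standard_involution scale \<sigma>) = conj"
    using standard_involution_conj standard_involution_unique by blast
  then have "reduced_norm scale x = (THE c. em c = em (nrm x))"
    by (simp add: reduced_norm_def em_def[symmetric] mult_conj)
  then show "reduced_norm scale x = nrm x" by simp
qed

lemma quadratic_eq: "x * x - em (tr x) * x + em (nrm x) = 0"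
proof -
  have "conj x = em (tr x) - x" using add_conj[of x] by (simp add: algebra_simps)
  with conj_mult_self[of x] show ?thesis by (simp add: left_diff_distrib algebra_simps)
qed

text \<open>Otherwise \<open>x\<close> would satisfy a quadratic equation that splits over \<open>F\<close>.\<close>

lemma tr_integral:
  assumes n: "absv (nrm x) \<le> 1" shows "absv (tr x) \<le> 1"
proof (rule ccontr)
  assume "\<not> absv (tr x) \<le> 1"
  then obtain X where X: "X\<^sup>2 - tr x * X + nrm x = 0" using quadratic_root n by (meson not_le)
  then have "nrm x = X * (tr x - X)" by (simp add: power2_eq_square algebra_simps)
  have "(x - em X) * (x - em (tr x - X)) =
      x * x - (em X + em (tr x - X)) * x + em X * em (tr x - X)"
    by (simp add: left_diff_distrib right_diff_distrib distrib_right em_commute[of x])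
  also have "\<dots> = x * x - em (tr x) * x + em (X * (tr x - X))"
    by (simp add: em_add[symmetric] em_mult)
  also have "\<dots> = 0" using quadratic_eq[of x] \<open>nrm x = X * (tr x - X)\<close> by simp
  finally have "x = em X \<or> x = em (tr x - X)" by simp
  then obtain c where c: "x = em c" by blast
  then have "absv c \<le> 1" using n by (simp add: absv_power power_le_one_iff absv_nonneg)
  then have "absv (2 * c) \<le> 1" using absv_of_nat_le[of 2] by (simp add: absv_mult mult_le_one absv_nonneg)
  then show False using \<open>\<not> absv (tr x) \<le> 1\<close> c by simp
qed

text \<open>Dividing by the larger element reduces this to
  \<open>nrm (z + 1) = nrm z + tr z + 1\<close> with integral \<open>nrm z\<close>, where
  \<open>tr_integral\<close> bounds the trace.\<close>

lemma nrm_ultrametric: "absv (nrm (x + y)) \<le> max (absv (nrm x)) (absv (nrm y))"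
proof -
  have *: "absv (nrm (x + y)) \<le> absv (nrm y)" if "absv (nrm x) \<le> absv (nrm y)" for x y
  proof (cases "y = 0")
    case True
    then show ?thesis using that by (simp add: absv_nonneg)
  next
    case False
    define z where "z = x * inverse y"
    have z: "absv (nrm z) \<le> 1"
      using that False
      unfolding z_def nrm_mult nrm_inverse absv_mult absv_inverse
      by (simp add: divide_inverse[symmetric] divide_le_eq_1 absv_nonneg)
    have "x + y = (z + 1) * y" using False by (simp add: z_def distrib_right mult.assoc)
    moreover have "absv (nrm (z + 1)) \<le> 1"
      unfolding nrm_add bil_def using tr_integral[OF z] z absv_ultrametric[of "nrm z + 1" "tr z"]
        absv_ultrametric[of "nrm z" 1] by simp
    ultimately show ?thesis by (simp add: nrm_mult absv_mult mult_left_le_one_le absv_nonneg)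
  qed
  show ?thesis
    using *[of x y] *[of y x] by (cases "absv (nrm x) \<le> absv (nrm y)") (auto simp: add.commute)
qed

text \<open>The index is the valuation of the norm: the uniformizer of the centre shifts it by 2.\<close>

definition K :: "int \<Rightarrow> 'a set" where "K k = {x. absv (nrm x) \<le> absv unif powi k}"

lemma K_mem: "x \<in> K k \<longleftrightarrow> nrm x \<in> pid k" by (simp add: K_def pid_mem)

lemma subgrp_K: "subgrp (K k)"
  unfolding subgrp_def
proof (intro conjI ballI)
  fix x y assume "x \<in> K k" "y \<in> K k"
  then show "x - y \<in> K k" using nrm_ultrametric[of x "- y"] by (simp add: K_def)
qed (simp add: K_def absv_nonneg)

lemma K_mono: "k \<le> l \<Longrightarrow> K l \<subseteq> K k"
  using subsetD[OF pid_mono] by (auto simp: K_mem)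

lemma K_mult: "x \<in> K k \<Longrightarrow> y \<in> K l \<Longrightarrow> x * y \<in> K (k + l)"
  by (simp add: K_mem nrm_mult pid_mult)

lemma K_conj [simp]: "conj x \<in> K k \<longleftrightarrow> x \<in> K k"
  by (simp add: K_mem)

lemma em_K: "c \<in> pid k \<Longrightarrow> em c \<in> K (2 * k)"
  using pid_mult[of c k c k] by (simp add: K_mem power2_eq_square)

lemma scale_K: "c \<in> pid k \<Longrightarrow> x \<in> K l \<Longrightarrow> scale c x \<in> K (2 * k + l)"
proof -
  assume "c \<in> pid k" "x \<in> K l"
  then have "em c * x \<in> K (2 * k + l)" using K_mult em_K by blast
  then show ?thesis by (subst scale_em)
qed

lemma unif_powi_pid: "unif powi k \<in> pid k"
  by (simp add: pid_mem absv_power_int)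

lemma scale_unif_K: "scale (unif powi k) x \<in> K (2 * k + l) \<longleftrightarrow> x \<in> K l"
proof
  assume "scale (unif powi k) x \<in> K (2 * k + l)"
  then have "scale (unif powi (- k)) (scale (unif powi k) x) \<in> K (2 * (- k) + (2 * k + l))"
    by (rule scale_K[OF unif_powi_pid])
  moreover have eq: "scale (unif powi (- k)) (scale (unif powi k) x) = x" by (simp add: power_int_minus)
  ultimately show "x \<in> K l" unfolding eq by simp
qed (intro scale_K unif_powi_pid)

lemma K_exhaust: "\<exists>k. x \<in> K k"
  by (metis K_mem absv_eq_powi absv_0 absv_nonneg order_refl pid_mem zero_le_power_int absv_unif_pos order_less_imp_le)

text \<open>Since \<open>x * x\<close> is \<open>unif\<close> times an element of
  \<open>K 0\<close>, its trace lies in \<open>pid 1\<close>; and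
  \<open>(tr x)\<^sup>2 = tr (x * x) + 2 * nrm x\<close>.\<close>

lemma tr_K_1: assumes x: "x \<in> K 1" shows "tr x \<in> pid 1"
proof -
  define y where "y = scale (unif powi (- 1)) (x * x)"
  have "y \<in> K (2 * (- 1) + (1 + 1))" unfolding y_def by (intro scale_K K_mult unif_powi_pid x)
  then have "absv (tr y) \<le> 1" by (intro tr_integral) (simp add: K_def)
  moreover have "x * x = scale unif y" by (simp add: y_def)
  ultimately have 1: "absv (tr (x * x)) \<le> absv unif" by (simp add: tr_scale absv_mult mult_left_le absv_nonneg)
  have "(tr x)\<^sup>2 = tr (x * x) + 2 * nrm x"
    by (rule q4_cases[of x]) (simp add: tr_q4 nrm_q4 q4_mult power2_eq_square algebra_simps)
  moreover have "absv (2 * nrm x) \<le> absv unif"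
    using x absv_of_nat_le[of 2] mult_mono[of "absv 2" 1 "absv (nrm x)" "absv unif"]
    by (simp add: K_def absv_mult absv_nonneg)
  ultimately have "absv (tr x)^2 \<le> absv unif"
    using 1 absv_ultrametric[of "tr (x * x)" "2 * nrm x"] absv_power[of "tr x" 2] by simp
  then have "absv (tr x)^2 < 1" using absv_unif_less by (rule le_less_trans)
  then have "absv (tr x) < 1"
    by (metis absv_nonneg not_le one_le_power)
  then show ?thesis using absv_le_unif by (simp add: pid_mem)
qed

text \<open>The odd exponent records a gain: already on the maximal ideal \<open>K 1\<close> the
  trace is divisible by \<open>unif\<close>. This gain is the shift by one in
  \<open>perp_K\<close>.\<close>

lemma tr_K: assumes x: "x \<in> K (2 * k - 1)" shows "tr x \<in> pid k"
proof -
  define y where "y = scale (unif powi (1 - k)) x"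
  have "y \<in> K (2 * (1 - k) + (2 * k - 1))" unfolding y_def by (intro scale_K unif_powi_pid x)
  then have "tr y \<in> pid 1" by (intro tr_K_1) simp
  moreover have "x = scale (unif powi (k - 1)) y" by (simp add: y_def power_int_add[symmetric])
  ultimately have "tr x \<in> pid (k - 1 + 1)" using pid_mult[OF unif_powi_pid] by (simp only: tr_scale)
  then show ?thesis by simp
qed

text \<open>Multiples of the lattice spanned by the basis. Indices and compactness are obtained for
  these by coordinates and then carried over to the \<open>K k\<close>.\<close>

definition E :: "int \<Rightarrow> 'a set" where
  "E k = {q4 t u v w | t u v w. t \<in> pid k \<and> u \<in> pid k \<and> v \<in> pid k \<and> w \<in> pid k}"

lemma pid_exhaust: "\<exists>k. c \<in> pid k"
  by (metis absv_eq_powi absv_0 absv_nonneg order_refl pid_mem zero_le_power_int absv_unif_pos order_less_imp_le)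

text \<open>One inclusion holds because the basis lies in \<open>K (- m1)\<close>, the other because
  the coordinates of \<open>x\<close> are traces of \<open>x\<close> times basis elements, up to
  factors in \<open>pid (- m2)\<close>.\<close>

lemma E_K_compare: "\<exists>m\<ge>0. \<forall>k. K (2 * k) \<subseteq> E (k - m) \<and> E k \<subseteq> K (2 * (k - m))"
proof -
  obtain m1 where m1: "m1 \<ge> 0" "{1, i, j, i * j} \<subseteq> K (- m1)"
    using finite_min_exhaust[of "{1, i, j, i * j}" K, OF _ _ K_mono] K_exhaust by auto
  obtain m2 where m2: "m2 \<ge> 0" "{1 / 2, 1 / (2 * a), 1 / (2 * b), - 1 / (2 * a * b)} \<subseteq> pid (- m2)"
    using finite_min_exhaust[of "{1 / 2, 1 / (2 * a), 1 / (2 * b), - 1 / (2 * a * b)}" pid, OF _ _ pid_mono]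
      pid_exhaust by auto
  define m where "m = m1 + m2"
  have m1': "{1, i, j, i * j} \<subseteq> K (2 * (- m1))" using m1 K_mono[of "2 * (- m1)" "- m1"] by auto
  have "E k \<subseteq> K (2 * (k - m))" for k
  proof
    fix x assume "x \<in> E k"
    then obtain t u v w where x: "x = q4 t u v w" "t \<in> pid k" "u \<in> pid k" "v \<in> pid k" "w \<in> pid k"
      by (auto simp: E_def)
    have "x \<in> K (2 * k + 2 * (- m1))" unfolding x(1) q4_def
      using m1' x by (intro subgrp_add[OF subgrp_K] scale_K) auto
    then show "x \<in> K (2 * (k - m))"
      using K_mono[of "2 * (k - m)" "2 * k + 2 * (- m1)"] m2(1) by (auto simp: m_def)
  qed
  moreover have "K (2 * k) \<subseteq> E (k - m)" for k
  proof
    fix x assume x: "x \<in> K (2 * k)"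
    obtain t u v w where q: "x = q4 t u v w" by (rule q4_cases)
    have *: "tr (x * y) * c \<in> pid (k - m)" if "y \<in> {1, i, j, i * j}"
      "c \<in> {1 / 2, 1 / (2 * a), 1 / (2 * b), - 1 / (2 * a * b)}" for y c
    proof -
      have "x * y \<in> K (2 * k + 2 * (- m1))" using m1' that x by (intro K_mult) auto
      then have "tr (x * y) \<in> pid (k - m1)"
        using K_mono[of "2 * (k - m1) - 1" "2 * k + 2 * (- m1)"] by (intro tr_K) auto
      then have "tr (x * y) * c \<in> pid (k - m1 + (- m2))" using subsetD[OF m2(2) that(2)] by (rule pid_mult)
      then show ?thesis by (simp add: m_def algebra_simps)
    qed
    have b: "1 = q4 1 0 0 0" "i = q4 0 1 0 0" "j = q4 0 0 1 0" "i * j = q4 0 0 0 1"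
      by (simp_all add: q4_def)
    have e: "t = tr (x * 1) * (1 / 2)" "u = tr (x * i) * (1 / (2 * a))"
      "v = tr (x * j) * (1 / (2 * b))" "w = tr (x * (i * j)) * (- 1 / (2 * a * b))"
      by (simp add: q tr_q4) (subst b(2) b(3) b(4), simp add: q q4_mult tr_q4)+
    have "t \<in> pid (k - m)" by (subst e(1), rule *) auto
    moreover have "u \<in> pid (k - m)" by (subst e(2), rule *) auto
    moreover have "v \<in> pid (k - m)" by (subst e(3), rule *) auto
    moreover have "w \<in> pid (k - m)" by (subst e(4), rule *) auto
    ultimately show "x \<in> E (k - m)" unfolding E_def q by blast
  qed
  ultimately show ?thesis using m1(1) m2(1) by (intro exI[of _ m]) (auto simp: m_def)
qed

end

section \<open>Indices of modules over the valuation ring\<close>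

context nonarch_local_field
begin

abbreviation "q \<equiv> residue_card absv"

lemma unif_powi_mult_pid: "unif powi k * x \<in> pid (k + l) \<longleftrightarrow> x \<in> pid l"
proof
  assume "unif powi k * x \<in> pid (k + l)"
  then have "unif powi (- k) * (unif powi k * x) \<in> pid (- k + (k + l))"
    by (rule pid_mult[rotated]) (simp add: pid_mem absv_power_int)
  then show "x \<in> pid l" by (simp add: power_int_minus mult.assoc[symmetric])
qed (rule pid_mult, simp add: pid_mem absv_power_int)

lemma index_pid: "card (cosets (pid (k + 1)) (pid k)) = q"
  unfolding residue_card_eq
proof (rule card_cosets_bij[symmetric, where g = "\<lambda>x. unif powi k * x"])
  show "stable (pid 1) (pid 0)" "stable (pid (k + 1)) (pid k)"
    by (intro stable_subgrp subgrp_pid pid_mono; simp)+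
  show "unif powi k * x - unif powi k * y \<in> pid (k + 1) \<longleftrightarrow> x - y \<in> pid 1" for x y
    using unif_powi_mult_pid[of k "x - y" 1] by (simp add: right_diff_distrib)
  show "unif powi k * x \<in> pid k" if "x \<in> pid 0" for x
    using unif_powi_mult_pid[of k x 0] that by simp
  show "\<exists>x\<in>pid 0. y - unif powi k * x \<in> pid (k + 1)" if "y \<in> pid k" for y
  proof (intro bexI)
    show "y / unif powi k \<in> pid 0" using unif_powi_mult_pid[of k "y / unif powi k" 0] that by simp
  qed (simp add: subgrp_zero[OF subgrp_pid])
qed (rule subgrp_pid)+

lemma finite_pid: "finite (cosets (pid (k + 1)) (pid k))"
  by (rule card_ge_0_finite) (use index_pid[of k] residue_card_ge_2 in simp)

lemma unit_pid: "x \<in> pid 0 \<Longrightarrow> x \<notin> pid 1 \<Longrightarrow> absv x = 1"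
  unfolding maximal_ideal_eq[symmetric] maximal_ideal_def by (auto simp: pid_mem)

lemma one_notin_pid: "1 \<notin> pid 1"
  unfolding maximal_ideal_eq[symmetric] maximal_ideal_def by simp

lemma divide_unit_pid: "absv y = 1 \<Longrightarrow> x / y \<in> pid k \<longleftrightarrow> x \<in> pid k"
  by (simp add: pid_mem absv_divide)

end

context quaternion_basis
begin

section \<open>Modules over the valuation ring and chains with simple quotients\<close>

definition omod :: "'a set \<Rightarrow> bool" where
  "omod M \<longleftrightarrow> subgrp M \<and> (\<forall>c\<in>pid 0. \<forall>x\<in>M. scale c x \<in> M)"

definition adj :: "'a set \<Rightarrow> 'a \<Rightarrow> 'a set" where
  "adj M x = {y. \<exists>c\<in>pid 0. y - scale c x \<in> M}"

lemma omod_subgrp: "omod M \<Longrightarrow> subgrp M"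
  by (simp add: omod_def)

lemma omod_scale: "omod M \<Longrightarrow> c \<in> pid 0 \<Longrightarrow> x \<in> M \<Longrightarrow> scale c x \<in> M"
  by (simp add: omod_def)

lemma omod_K: "omod (K k)"
  unfolding omod_def using subgrp_K scale_K[of _ 0 _ k] by auto

lemma omod_adj: assumes "omod M" shows "omod (adj M x)"
  unfolding omod_def subgrp_def
proof (intro conjI ballI)
  note M = omod_subgrp[OF assms]
  show "0 \<in> adj M x" unfolding adj_def
    using subgrp_zero[OF M] subgrp_zero[OF subgrp_pid] by (auto intro!: bexI[of _ 0])
  show "y - z \<in> adj M x" if yz: "y \<in> adj M x" "z \<in> adj M x" for y z
  proof -
    obtain c d where cd: "c \<in> pid 0" "d \<in> pid 0" "y - scale c x \<in> M" "z - scale d x \<in> M"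
      using yz by (auto simp: adj_def)
    have "(y - z) - scale (c - d) x = (y - scale c x) - (z - scale d x)"
      by (simp add: V.scale_left_diff_distrib)
    then have "(y - z) - scale (c - d) x \<in> M" using cd subgrp_diff[OF M] by metis
    then show ?thesis unfolding adj_def using cd subgrp_diff[OF subgrp_pid] by blast
  qed
  show "scale e y \<in> adj M x" if ey: "e \<in> pid 0" "y \<in> adj M x" for e y
  proof -
    obtain c where c: "c \<in> pid 0" "y - scale c x \<in> M" using ey by (auto simp: adj_def)
    have "scale e (y - scale c x) \<in> M" using omod_scale[OF assms] ey c by blast
    then have "scale e y - scale (e * c) x \<in> M" by (simp add: V.scale_right_diff_distrib)
    then show ?thesis unfolding adj_def using pid_mult_0[OF ey(1) c(1)] by blast
  qed
qed

lemma adj_supset: "M \<subseteq> adj M x"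
  unfolding adj_def using subgrp_zero[OF subgrp_pid] by (auto intro!: bexI[of _ 0])

lemma mem_adj: "omod M \<Longrightarrow> x \<in> adj M x"
  unfolding adj_def using subgrp_zero[OF omod_subgrp] by (auto intro!: bexI[of _ 1] simp: pid_mem)

lemma adj_subset: "omod M' \<Longrightarrow> M \<subseteq> M' \<Longrightarrow> x \<in> M' \<Longrightarrow> adj M x \<subseteq> M'"
proof
  fix y assume M': "omod M'" "M \<subseteq> M'" "x \<in> M'" "y \<in> adj M x"
  then obtain c where c: "c \<in> pid 0" "y - scale c x \<in> M'" by (auto simp: adj_def)
  then have "y - scale c x + scale c x \<in> M'"
    using M' by (intro subgrp_add omod_subgrp omod_scale) auto
  then show "y \<in> M'" by simp
qed

text \<open>The map \<open>c \<mapsto> scale c x\<close> identifies the residue field with the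
  quotient of \<open>adj M x\<close> by \<open>M\<close>.\<close>

lemma index_adj:
  assumes M: "omod M" and x: "x \<notin> M" "scale unif x \<in> M"
  shows "card (cosets M (adj M x)) = q"
  unfolding residue_card_eq
proof (rule card_cosets_bij[symmetric, where g = "\<lambda>c. scale c x"])
  show "stable (pid 1) (pid 0)" by (intro stable_subgrp subgrp_pid pid_mono) simp
  show "stable M (adj M x)" by (intro stable_subgrp omod_subgrp omod_adj adj_supset M)
  show "subgrp (pid 1)" "subgrp M" by (rule subgrp_pid omod_subgrp M)+
  show "scale c x - scale d x \<in> M \<longleftrightarrow> c - d \<in> pid 1" if "c \<in> pid 0" "d \<in> pid 0" for c d
  proof -
    define e where "e = c - d"
    have e: "e \<in> pid 0" using that subgrp_diff[OF subgrp_pid] by (simp add: e_def)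
    have "scale e x \<in> M \<longleftrightarrow> e \<in> pid 1"
    proof
      assume "e \<in> pid 1"
      then have "e / unif \<in> pid 0" using unif_powi_mult_pid[of 1 "e / unif" 0] by simp
      then have "scale (e / unif) (scale unif x) \<in> M" using omod_scale[OF M] x(2) by blast
      then show "scale e x \<in> M" by simp
    next
      assume ex: "scale e x \<in> M"
      show "e \<in> pid 1"
      proof (rule ccontr)
        assume "e \<notin> pid 1"
        then have u: "absv e = 1" using unit_pid e by blast
        then have "inverse e \<in> pid 0" by (simp add: pid_mem absv_inverse)
        then have "scale (inverse e) (scale e x) \<in> M" using omod_scale[OF M] ex by blast
        moreover have "e \<noteq> 0" using u by auto
        ultimately show False using x(1) by simp
      qed
    qed
    then show ?thesis by (simp add: e_def V.scale_left_diff_distrib)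
  qed
  show "scale c x \<in> adj M x" if "c \<in> pid 0" for c
    using omod_scale[OF omod_adj[OF M] that mem_adj[OF M]] .
  show "\<exists>c\<in>pid 0. y - scale c x \<in> M" if "y \<in> adj M x" for y
    using that by (simp add: adj_def)
qed

lemma scale_unif_power_K: "\<exists>n. scale (unif ^ n) y \<in> K k"
proof -
  obtain l where l: "y \<in> K l" using K_exhaust by blast
  define n where "n = nat \<bar>k - l\<bar>"
  have "scale (unif powi int n) y \<in> K (2 * int n + l)" using l by (intro scale_K unif_powi_pid)
  moreover have "int n = \<bar>k - l\<bar>" by (simp add: n_def)
  then have "k \<le> 2 * int n + l" using abs_ge_self[of "k - l"] abs_ge_zero[of "k - l"] by linarith
  ultimately show ?thesis using K_mono by (auto intro!: exI[of _ n])
qed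

text \<open>Induction along a composition series. An intermediate module with \<open>Q\<close> of
  largest index over \<open>H\<close> must be \<open>M\<close>: otherwise an element outside it is
  multiplied by \<open>unif\<close> up to the last multiple that stays outside, and that multiple is
  adjoined. The multiples enter the module eventually because it contains
  \<open>K k\<close>.\<close>

lemma omod_chain [consumes 5, case_names base step]:
  assumes H: "omod H" and M: "omod M" and sub: "H \<subseteq> M" and fin: "finite (cosets H M)"
    and KH: "K k \<subseteq> H"
    and base: "Q H"
    and step: "\<And>M' x. omod M' \<Longrightarrow> H \<subseteq> M' \<Longrightarrow> M' \<subseteq> M \<Longrightarrow> Q M' \<Longrightarrow> x \<in> M \<Longrightarrow> x \<notin> M' \<Longrightarrow>
      scale unif x \<in> M' \<Longrightarrow> Q (adj M' x)"
  shows "Q M"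
proof -
  define P where "P M' \<longleftrightarrow> omod M' \<and> H \<subseteq> M' \<and> M' \<subseteq> M \<and> Q M'" for M'
  have "P H" using H sub base by (simp add: P_def)
  moreover have "\<forall>M'. P M' \<longrightarrow> card (cosets H M') < Suc (card (cosets H M))"
    unfolding P_def by (auto simp: less_Suc_eq_le intro!: card_mono fin cosets_mono)
  ultimately obtain M' where M': "P M'" and max: "\<And>N. P N \<Longrightarrow> card (cosets H N) \<le> card (cosets H M')"
    using ex_has_greatest_nat[of P H "\<lambda>M. card (cosets H M)"] by blast
  have "M \<subseteq> M'"
  proof (rule ccontr)
    assume "\<not> M \<subseteq> M'"
    then obtain y where y: "y \<in> M" "y \<notin> M'" by blast
    obtain n0 where "scale (unif ^ n0) y \<in> K k" using scale_unif_power_K by blast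
    then have n0: "scale (unif ^ n0) y \<in> M'" using KH M' by (auto simp: P_def)
    define n where "n = (LEAST n. scale (unif ^ n) y \<in> M')"
    have n: "scale (unif ^ n) y \<in> M'" unfolding n_def by (rule LeastI, rule n0)
    have "n \<noteq> 0" using n y(2) by (cases n) auto
    then obtain m where m: "n = Suc m" by (cases n) auto
    define x where "x = scale (unif ^ m) y"
    have "unif ^ m \<in> pid 0" using unif_powi_pid[of "int m"] pid_mono[of 0 "int m"] by auto
    then have xM: "x \<in> M" unfolding x_def using omod_scale[OF M] y by blast
    have x: "x \<notin> M'" unfolding x_def using not_less_Least[of m "\<lambda>n. scale (unif ^ n) y \<in> M'"] m
      by (simp add: n_def)
    have ux: "scale unif x \<in> M'" using n by (simp add: m x_def)
    have PA: "P (adj M' x)"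
      using M' step[OF _ _ _ _ xM x ux] omod_adj adj_supset[of M' x] adj_subset[OF M _ xM]
      unfolding P_def by blast
    have "card (cosets M' (adj M' x)) = q" using index_adj M' x ux by (auto simp: P_def)
    moreover have fA: "finite (cosets H (adj M' x))"
      using PA fin cosets_mono finite_subset unfolding P_def by meson
    ultimately have "card (cosets H (adj M' x)) = card (cosets H M') * q"
      using card_cosets_mult[of H M' "adj M' x"] H M' PA adj_supset[of M' x]
      by (auto simp: P_def omod_subgrp stable_subgrp)
    moreover have "card (cosets H M') > 0"
      using M' fin subgrp_zero[OF omod_subgrp] finite_subset[OF cosets_mono]
      unfolding P_def by (intro card_cosets_pos[of _ _ 0]) blast+
    ultimately show False using max[OF PA] residue_card_ge_2
      by (metis One_nat_def less_le_trans linorder_not_le mult.right_neutral mult_less_cancel1 one_less_numeral_iff semiring_norm(76))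
  qed
  then have "M' = M" using M' by (auto simp: P_def)
  then show ?thesis using M' by (simp add: P_def)
qed

lemma index_power:
  assumes "omod H" "omod M" "H \<subseteq> M" "finite (cosets H M)" "K k \<subseteq> H"
  shows "\<exists>n. card (cosets H M) = q ^ n"
  using assms
proof (rule omod_chain[where Q = "\<lambda>M. \<exists>n. card (cosets H M) = q ^ n"])
  show "\<exists>n. card (cosets H H) = q ^ n"
    using cosets_self[OF omod_subgrp[OF assms(1)]] by (auto intro!: exI[of _ 0])
next
  fix M' x assume M': "omod M'" "H \<subseteq> M'" "M' \<subseteq> M" "\<exists>n. card (cosets H M') = q ^ n"
    and x: "x \<in> M" "x \<notin> M'" "scale unif x \<in> M'"
  have "finite (cosets H (adj M' x))"
    using adj_subset[OF assms(2) M'(3) x(1)] assms(4) finite_subset[OF cosets_mono] by blast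
  then have "card (cosets H (adj M' x)) = card (cosets H M') * q"
    using card_cosets_mult[of H M' "adj M' x"] assms M' adj_supset[of M' x] index_adj[OF M'(1) x(2,3)]
    by (auto simp: omod_subgrp omod_adj stable_subgrp)
  then show "\<exists>n. card (cosets H (adj M' x)) = q ^ n"
    using M'(4) by (metis power_Suc2)
qed

text \<open>Four independent exponents allow passing from \<open>E k\<close> to
  \<open>E (k + 1)\<close> one coordinate at a time, each time with index \<open>q\<close>.\<close>

definition box :: "int \<Rightarrow> int \<Rightarrow> int \<Rightarrow> int \<Rightarrow> 'a set" where
  "box k l m n = {q4 t u v w | t u v w. t \<in> pid k \<and> u \<in> pid l \<and> v \<in> pid m \<and> w \<in> pid n}"

lemma q4_box: "q4 t u v w \<in> box k l m n \<longleftrightarrow> t \<in> pid k \<and> u \<in> pid l \<and> v \<in> pid m \<and> w \<in> pid n"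
  by (auto simp: box_def q4_inject)

lemma E_box: "E k = box k k k k" by (simp add: E_def box_def)

lemma subgrp_box: "subgrp (box k l m n)"
  unfolding subgrp_def
proof (intro conjI ballI)
  show "0 \<in> box k l m n"
    using q4_box[of 0 0 0 0 k l m n] subgrp_zero[OF subgrp_pid] by (simp add: q4_def)
  fix x y assume "x \<in> box k l m n" "y \<in> box k l m n"
  then show "x - y \<in> box k l m n"
    by (rule_tac q4_cases[of x], rule_tac q4_cases[of y])
      (auto simp: q4_box q4_diff intro: subgrp_diff[OF subgrp_pid])
qed

lemma box_mono: "k \<le> k' \<Longrightarrow> l \<le> l' \<Longrightarrow> m \<le> m' \<Longrightarrow> n \<le> n' \<Longrightarrow> box k' l' m' n' \<subseteq> box k l m n"
  unfolding box_def using subsetD[OF pid_mono] by blast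

lemma index_box:
  assumes "subgrp B'" "subgrp B" "B' \<subseteq> B"
    and g: "\<And>c d. g c - g d = (g (c - d) :: 'a)" "\<And>c. c \<in> pid k \<Longrightarrow> g c \<in> B"
      "\<And>c. c \<in> pid k \<Longrightarrow> g c \<in> B' \<longleftrightarrow> c \<in> pid (k + 1)"
      "\<And>y. y \<in> B \<Longrightarrow> \<exists>c\<in>pid k. y - g c \<in> B'"
  shows "card (cosets B' B) = q"
  unfolding index_pid[of k, symmetric]
proof (rule card_cosets_bij[symmetric, where g = g])
  show "stable (pid (k + 1)) (pid k)" by (intro stable_subgrp subgrp_pid pid_mono) simp
  show "stable B' B" by (intro stable_subgrp assms)
qed (use assms subgrp_pid subgrp_diff[OF subgrp_pid] in auto)

lemma index_box_steps:
  "card (cosets (box (k + 1) l m n) (box k l m n)) = q"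
  "card (cosets (box k (l + 1) m n) (box k l m n)) = q"
  "card (cosets (box k l (m + 1) n) (box k l m n)) = q"
  "card (cosets (box k l m (n + 1)) (box k l m n)) = q"
proof -
  note z [simp] = subgrp_zero[OF subgrp_pid]
  note i = index_box[OF subgrp_box subgrp_box]
  have bx: "c \<in> A \<Longrightarrow> \<exists>d\<in>A. c - d \<in> pid n" for c A n by (rule bexI[of _ c]) simp_all
  have ex: "y \<in> box k l m n \<Longrightarrow> \<exists>t u v w. y = q4 t u v w \<and> t \<in> pid k \<and> u \<in> pid l \<and> v \<in> pid m \<and> w \<in> pid n" for y
    by (auto simp: box_def)
  show "card (cosets (box (k + 1) l m n) (box k l m n)) = q"
    by (rule i[where g = "\<lambda>t. q4 t 0 0 0" and k = k]) (auto intro: bx simp: q4_diff q4_box box_mono dest!: ex)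
  show "card (cosets (box k (l + 1) m n) (box k l m n)) = q"
    by (rule i[where g = "\<lambda>t. q4 0 t 0 0" and k = l]) (auto intro: bx simp: q4_diff q4_box box_mono dest!: ex)
  show "card (cosets (box k l (m + 1) n) (box k l m n)) = q"
    by (rule i[where g = "\<lambda>t. q4 0 0 t 0" and k = m]) (auto intro: bx simp: q4_diff q4_box box_mono dest!: ex)
  show "card (cosets (box k l m (n + 1)) (box k l m n)) = q"
    by (rule i[where g = "\<lambda>t. q4 0 0 0 t" and k = n]) (auto intro: bx simp: q4_diff q4_box box_mono dest!: ex)
qed

lemma index_trans:
  assumes "subgrp H" "subgrp M" "subgrp N" "H \<subseteq> M" "M \<subseteq> N"
    and "card (cosets H M) > 0" "card (cosets M N) > 0"
  shows "card (cosets H N) = card (cosets H M) * card (cosets M N) \<and> finite (cosets H N)"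
proof -
  have "finite (cosets H N)"
    by (rule finite_cosets_trans[OF assms(1,2,4)]) (use assms card_ge_0_finite in auto)
  then show ?thesis using card_cosets_mult[OF assms(1,2,4)] assms by (auto simp: stable_subgrp)
qed

lemma index_E: "card (cosets (E (k + 1)) (E k)) = q ^ 4"
proof -
  have q: "q > 0" using residue_card_ge_2 by simp
  have 1: "card (cosets (box k k (k+1) (k+1)) (box k k k k)) = q * q"
    using index_trans[OF subgrp_box subgrp_box subgrp_box, of k k "k+1" "k+1" k k k "k+1" k k k k]
      index_box_steps q by (auto simp: box_mono)
  have 2: "card (cosets (box (k+1) (k+1) (k+1) (k+1)) (box k k (k+1) (k+1))) = q * q"
    using index_trans[OF subgrp_box subgrp_box subgrp_box, of "k+1" "k+1" "k+1" "k+1" k "k+1" "k+1" "k+1" k k "k+1" "k+1"]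
      index_box_steps q by (auto simp: box_mono)
  show ?thesis unfolding E_box
    using index_trans[OF subgrp_box subgrp_box subgrp_box, of "k+1" "k+1" "k+1" "k+1" k k "k+1" "k+1" k k k k] 1 2 q
    by (auto simp: box_mono power4_eq_xxxx mult.assoc)
qed

lemma subgrp_E: "subgrp (E k)" by (simp add: E_box subgrp_box)

lemma E_mono: "k \<le> l \<Longrightarrow> E l \<subseteq> E k" by (simp add: E_box box_mono)

lemma finite_E: "finite (cosets (E (k + int n)) (E k))"
proof (induction n)
  case 0
  then show ?case by (simp add: cosets_self subgrp_E)
next
  case (Suc n)
  have "card (cosets (E (k + int n + 1)) (E (k + int n))) > 0"
    unfolding index_E using residue_card_ge_2 by simp
  moreover have "card (cosets (E (k + int n)) (E k)) > 0"
    using card_cosets_pos[OF Suc subgrp_zero[OF subgrp_E]] .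
  ultimately have "finite (cosets (E (k + int n + 1)) (E k))"
    using index_trans[OF subgrp_E subgrp_E subgrp_E, of "k + int n + 1" "k + int n" k] by (simp add: E_mono)
  then show ?case by (simp add: algebra_simps)
qed

text \<open>Both sets are enclosed between boxes. The absolute values in \<open>k'\<close> and
  \<open>n\<close> avoid halving exponents, which may be odd.\<close>

lemma finite_K: "finite (cosets (K l) (K k))"
proof -
  obtain m where m: "m \<ge> 0" "\<And>k. K (2 * k) \<subseteq> E (k - m)" "\<And>k. E k \<subseteq> K (2 * (k - m))"
    using E_K_compare by blast
  define k' where "k' = - \<bar>k\<bar> - m"
  define n where "n = nat (2 * m + \<bar>k\<bar> + \<bar>l\<bar>)"
  have "2 * (- \<bar>k\<bar>) \<le> k" by linarith
  then have 1: "K k \<subseteq> E k'" using m(2)[of "- \<bar>k\<bar>"] K_mono[of "2 * (- \<bar>k\<bar>)" k] by (auto simp: k'_def)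
  have "l \<le> 2 * (k' + int n - m)" using m(1) unfolding k'_def n_def by simp
  then have 2: "E (k' + int n) \<subseteq> K l"
    using m(3)[of "k' + int n"] K_mono[of l "2 * (k' + int n - m)"] by blast
  have "finite (cosets (K l) (E k'))"
    by (rule finite_cosets_coarse[OF subgrp_E subgrp_K 2 finite_E])
  then show ?thesis using cosets_mono[OF 1] finite_subset by blast
qed

lemma K_sub_E: "\<exists>k. E k \<subseteq> K l"
proof -
  obtain m where "m \<ge> 0" "\<And>k. E k \<subseteq> K (2 * (k - m))" using E_K_compare by blast
  note this(2)[of "\<bar>l\<bar> + m"]
  moreover have "l \<le> 2 * \<bar>l\<bar>" by linarith
  ultimately have "E (\<bar>l\<bar> + m) \<subseteq> K l" using K_mono[of l "2 * \<bar>l\<bar>"] by auto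
  then show ?thesis ..
qed

lemma card_scale:
  assumes "subgrp H" "subgrp M" "H \<subseteq> M" "subgrp H'" "subgrp M'" "H' \<subseteq> M'"
    and "\<And>x. scale unif x \<in> H' \<longleftrightarrow> x \<in> H" "\<And>x. scale unif x \<in> M' \<longleftrightarrow> x \<in> M"
  shows "card (cosets H' M') = card (cosets H M)"
proof (rule card_cosets_bij[symmetric, where g = "scale unif"])
  show "\<exists>x\<in>M. y - scale unif x \<in> H'" if "y \<in> M'" for y
    using assms(8)[of "scale (inverse unif) y"] that subgrp_zero[OF assms(4)]
    by (intro bexI[of _ "scale (inverse unif) y"]) auto
  show "scale unif x - scale unif y \<in> H' \<longleftrightarrow> x - y \<in> H" for x y
    using assms(7)[of "x - y"] by (simp add: V.scale_right_diff_distrib)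
qed (use assms stable_subgrp in auto)

lemma scale_unif_E: "scale unif x \<in> E (k + 1) \<longleftrightarrow> x \<in> E k"
  using unif_powi_mult_pid[of 1 _ k]
  by (rule_tac q4_cases[of x]) (simp add: E_box q4_scale q4_box add.commute)

text \<open>Multiplication by \<open>unif\<close> carries \<open>E k\<close> and \<open>K 0\<close>
  to \<open>E (k + 1)\<close> and \<open>K 2\<close>. In the two chains from
  \<open>E (k + 1)\<close> up to \<open>K 0\<close>, through \<open>E k\<close> and through
  \<open>K 2\<close>, the equal indices cancel and leave the index of \<open>E (k + 1)\<close> in
  \<open>E k\<close>.\<close>

lemma index_K_2: "card (cosets (K 2) (K 0)) = q ^ 4"
proof -
  obtain k where k: "E k \<subseteq> K 0" using K_sub_E by blast
  have uK: "scale unif x \<in> K 2 \<longleftrightarrow> x \<in> K 0" for x using scale_unif_K[of 1 x 0] by simp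
  have k2: "E (k + 1) \<subseteq> K 2"
  proof
    fix x assume "x \<in> E (k + 1)"
    then have "scale (inverse unif) x \<in> E k" using scale_unif_E[of "scale (inverse unif) x" k] by simp
    then show "x \<in> K 2" using uK[of "scale (inverse unif) x"] k by auto
  qed
  obtain l where l: "K l \<subseteq> E (k + 1)"
  proof -
    obtain m where "m \<ge> 0" "\<And>k. K (2 * k) \<subseteq> E (k - m)" using E_K_compare by blast
    from this(2)[of "k + 1 + m"] have "K (2 * (k + 1 + m)) \<subseteq> E (k + 1)" by simp
    then show thesis using that by blast
  qed
  have fin: "finite (cosets (E (k + 1)) (K 0))"
    by (rule finite_cosets_coarse[OF subgrp_K subgrp_E l finite_K])
  have "card (cosets (E (k + 1)) (K 0)) = card (cosets (E (k + 1)) (E k)) * card (cosets (E k) (K 0))"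
    by (rule card_cosets_mult) (auto intro!: subgrp_E E_mono stable_subgrp subgrp_K k fin)
  moreover have "card (cosets (E (k + 1)) (K 0)) = card (cosets (E (k + 1)) (K 2)) * card (cosets (K 2) (K 0))"
    by (rule card_cosets_mult) (auto intro!: subgrp_E stable_subgrp subgrp_K k2 fin K_mono)
  moreover have "card (cosets (E (k + 1)) (K 2)) = card (cosets (E k) (K 0))"
    by (rule card_scale) (auto intro!: subgrp_E subgrp_K k k2 simp: uK scale_unif_E)
  moreover have "card (cosets (E k) (K 0)) > 0"
  proof (rule card_cosets_pos[OF _ subgrp_zero[OF subgrp_K]])
    show "finite (cosets (E k) (K 0))"
      by (rule finite_cosets_coarse[OF subgrp_E subgrp_E E_mono fin]) simp
  qed
  ultimately show ?thesis by (simp add: index_E)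
qed

section \<open>The residue field of the algebra\<close>

text \<open>The cross term \<open>bil y (x - y)\<close> is the trace of an element of
  \<open>K 1\<close>.\<close>

lemma nrm_congr:
  assumes "x \<in> K 0" "y \<in> K 0" "x - y \<in> K 1" shows "nrm x - nrm y \<in> pid 1"
proof -
  have "nrm x = nrm y + nrm (x - y) + bil y (x - y)" using nrm_add[of y "x - y"] by simp
  moreover have "y * conj (x - y) \<in> K (0 + 1)" using assms by (intro K_mult) auto
  then have "bil y (x - y) \<in> pid 1" unfolding bil_def using tr_K[of _ 1] by simp
  ultimately show ?thesis using assms(3) subgrp_add[OF subgrp_pid] by (simp add: K_mem)
qed

lemma tr_congr: "x - y \<in> K 1 \<Longrightarrow> tr x - tr y \<in> pid 1"
  using tr_K[of "x - y" 1] by (simp add: tr_diff)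

lemma unit_K: "x \<in> K 0 \<Longrightarrow> x \<notin> K 1 \<Longrightarrow> absv (nrm x) = 1"
  unfolding K_mem by (rule unit_pid)

lemma unit_mult_K: "absv (nrm d) = 1 \<Longrightarrow> d * x \<in> K k \<longleftrightarrow> x \<in> K k"
  "absv (nrm d) = 1 \<Longrightarrow> x * d \<in> K k \<longleftrightarrow> x \<in> K k"
  by (simp_all add: K_def nrm_mult absv_mult)

lemma one_K: "1 \<in> K 0" "1 \<notin> K 1"
  using one_notin_pid by (simp_all add: K_mem pid_mem)

abbreviation "qD \<equiv> card (cosets (K 1) (K 0))"

definition Fn :: "'f \<Rightarrow> 'a set" where "Fn c = {x \<in> K 0. nrm x - c \<in> pid 1}"

definition Ft :: "'f \<Rightarrow> 'a set" where "Ft c = {x \<in> K 0. tr x - c \<in> pid 1}"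

lemma stable_K: "k \<le> l \<Longrightarrow> stable (K l) (K k)"
  by (intro stable_subgrp subgrp_K K_mono)

lemma stable_Fn: "stable (K 1) (Fn c)"
  unfolding stable_def
proof (intro ballI)
  fix x h assume x: "x \<in> Fn c" and h: "h \<in> K 1"
  then have xh: "x + h \<in> K 0" using stable_K[of 0 1] by (auto simp: Fn_def stable_def)
  then have "nrm (x + h) - nrm x \<in> pid 1" using x h by (intro nrm_congr) (auto simp: Fn_def)
  then show "x + h \<in> Fn c"
    using x xh subgrp_diff_trans[OF subgrp_pid, of "nrm (x + h)" "nrm x"] by (auto simp: Fn_def)
qed

lemma stable_Ft: "stable (K 1) (Ft c)"
  unfolding stable_def
proof (intro ballI)
  fix x h assume x: "x \<in> Ft c" and h: "h \<in> K 1"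
  then have xh: "x + h \<in> K 0" using stable_K[of 0 1] by (auto simp: Ft_def stable_def)
  have "tr (x + h) - tr x \<in> pid 1" using h by (intro tr_congr) simp
  then show "x + h \<in> Ft c"
    using x xh subgrp_diff_trans[OF subgrp_pid, of "tr (x + h)" "tr x"] by (auto simp: Ft_def)
qed

lemma finite_Fn: "finite (cosets (K 1) (Fn c))" and finite_Ft: "finite (cosets (K 1) (Ft c))"
  by (rule finite_subset[OF cosets_mono finite_K[of 1 0]]; force simp: Fn_def Ft_def)+

text \<open>Left multiplication by \<open>d\<close>, whose norm is a unit congruent to
  \<open>c\<close>, permutes the cosets of \<open>K 1\<close> in \<open>K 0\<close> and carries
  \<open>Fn 1\<close> to \<open>Fn c\<close>.\<close>

lemma card_Fn_eq:
  assumes d: "d \<in> Fn c" and c: "c \<in> pid 0" "c \<notin> pid 1"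
  shows "card (cosets (K 1) (Fn c)) = card (cosets (K 1) (Fn 1))"
proof (rule card_cosets_bij[symmetric, where g = "\<lambda>x. d * x"])
  have "nrm d \<notin> pid 1"
    using d c(2) subgrp_diff[OF subgrp_pid, of "nrm d" 1 "nrm d - c"] by (auto simp: Fn_def)
  moreover have dK: "d \<in> K 0" using d by (simp add: Fn_def)
  ultimately have u: "absv (nrm d) = 1" by (intro unit_K) (auto simp: K_mem)
  then have d0: "d \<noteq> 0" by auto
  show "d * x - d * y \<in> K 1 \<longleftrightarrow> x - y \<in> K 1" for x y
    using unit_mult_K(1)[OF u, of "x - y"] by (simp add: right_diff_distrib)
  show "d * x \<in> Fn c" if "x \<in> Fn 1" for x
  proof -
    have "nrm d * (nrm x - 1) \<in> pid 1"
      using that dK by (intro pid_mult_0) (auto simp: Fn_def K_mem)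
    then have "nrm d * (nrm x - 1) + (nrm d - c) \<in> pid 1"
      using d by (intro subgrp_add[OF subgrp_pid]) (auto simp: Fn_def)
    then show ?thesis using that by (simp add: Fn_def nrm_mult unit_mult_K u right_diff_distrib)
  qed
  show "\<exists>x\<in>Fn 1. y - d * x \<in> K 1" if y: "y \<in> Fn c" for y
  proof (intro bexI)
    have "nrm y - nrm d \<in> pid 1"
      using y d subgrp_diff[OF subgrp_pid, of "nrm y - c" 1 "nrm d - c"] by (simp add: Fn_def)
    then have "(nrm y - nrm d) / nrm d \<in> pid 1" using divide_unit_pid[OF u] by simp
    moreover have "(nrm y - nrm d) / nrm d = nrm (inverse d * y) - 1"
      using d0 by (simp add: nrm_mult nrm_inverse diff_divide_distrib) (simp add: divide_inverse mult.commute)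
    moreover have "absv (nrm (inverse d)) = 1" by (simp add: nrm_inverse absv_inverse u)
    ultimately show "inverse d * y \<in> Fn 1" using y by (simp add: Fn_def unit_mult_K)
    show "y - d * (inverse d * y) \<in> K 1"
      using d0 by (simp add: mult.assoc[symmetric] subgrp_zero[OF subgrp_K])
  qed
qed (intro subgrp_K stable_Fn)+

lemma card_Fn_0: "c \<in> pid 1 \<Longrightarrow> card (cosets (K 1) (Fn c)) = 1"
proof -
  assume c: "c \<in> pid 1"
  have "nrm x - c \<in> pid 1 \<longleftrightarrow> nrm x \<in> pid 1" for x
    using c subgrp_add[OF subgrp_pid, of "nrm x - c" 1 c] subgrp_diff[OF subgrp_pid, of "nrm x" 1 c] by auto
  then have "Fn c = K 1" using K_mono[of 0 1] by (auto simp: Fn_def K_mem[symmetric])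
  then show ?thesis by (simp add: cosets_self subgrp_K)
qed

text \<open>With \<open>u = 1 - w\<^sup>-\<^sup>1\<close> one has \<open>n(u) - 1 = (1 - tr w) / n(w)\<close>.\<close>

lemma card_Fn_1: "card (cosets (K 1) (Fn 1)) = 1 + card (cosets (K 1) (Ft 1))"
proof -
  \<comment> \<open>The class of 1 is the one solution that is not of the form
    \<open>1 - inverse w\<close>; it accounts for the summand 1.\<close>
  define Z where "Z = (+) 1 ` K 1"
  have Zst: "stable (K 1) Z" unfolding Z_def by (intro stable_coset subgrp_K) simp
  have "x \<in> Fn 1" if "x - 1 \<in> K 1" for x
    using stable_diff[OF stable_Fn, of 1 1 x] that one_K subgrp_zero[OF subgrp_pid]
    by (auto simp: Fn_def)
  then have ZF: "Z \<subseteq> Fn 1" by (auto simp: Z_def)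
  have "card (cosets (K 1) Z) = 1"
    unfolding Z_def by (subst card_cosets_coset) (auto simp: cosets_self subgrp_K)
  moreover have "card (cosets (K 1) (Ft 1)) = card (cosets (K 1) (Fn 1 - Z))"
  proof (rule card_cosets_bij[where g = "\<lambda>w. 1 - inverse w"])
    show "stable (K 1) (Fn 1 - Z)" by (intro stable_Diff subgrp_K stable_Fn Zst)
    have u: "absv (nrm w) = 1" if "w \<in> Ft 1" for w
    proof (rule unit_K)
      show "w \<in> K 0" using that by (simp add: Ft_def)
      show "w \<notin> K 1"
      proof
        assume "w \<in> K 1"
        then have "tr w \<in> pid 1" by (rule tr_K_1)
        then show False
          using that subgrp_diff[OF subgrp_pid, of "tr w" 1 "tr w - 1"] one_notin_pid by (simp add: Ft_def)
      qed
    qed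
    show "1 - inverse w - (1 - inverse w') \<in> K 1 \<longleftrightarrow> w - w' \<in> K 1"
      if w: "w \<in> Ft 1" "w' \<in> Ft 1" for w w'
    proof -
      have nz: "w \<noteq> 0" "w' \<noteq> 0" using u[OF w(1)] u[OF w(2)] by auto
      have "1 - inverse w - (1 - inverse w') = inverse w' * ((w - w') * inverse w)"
        using nz by (simp add: left_diff_distrib right_diff_distrib mult.assoc[symmetric])
      moreover have "absv (nrm (inverse w)) = 1" "absv (nrm (inverse w')) = 1"
        using u[OF w(1)] u[OF w(2)] by (simp_all add: nrm_inverse absv_inverse)
      ultimately show ?thesis using unit_mult_K by metis
    qed
    show "1 - inverse w \<in> Fn 1 - Z" if w: "w \<in> Ft 1" for w
    proof -
      note uw = u[OF w]
      have nz: "w \<noteq> 0" using uw by auto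
      have ui: "absv (nrm (inverse w)) = 1" using uw by (simp add: nrm_inverse absv_inverse)
      have "inverse w \<in> K 0" "inverse w \<notin> K 1" using unit_mult_K[OF ui, of 1] one_K by auto
      then have K0: "1 - inverse w \<in> K 0" and nZ: "1 - inverse w \<notin> Z"
        using subgrp_diff[OF subgrp_K one_K(1)] subgrp_minus[OF subgrp_K, of "- inverse w"]
        by (auto simp: Z_def mem_coset_iff)
      have "1 - inverse w = (w + (- 1)) * inverse w"
        using nz by (simp add: left_diff_distrib)
      then have eq: "nrm (1 - inverse w) = (nrm w + nrm (- 1) + bil w (- 1)) / nrm w"
        by (simp only: nrm_mult nrm_inverse nrm_add divide_inverse)
      have bil1: "bil w 1 = tr w" by (simp add: bil_def)
      have "(nrm w + nrm (- 1) + bil w (- 1)) / nrm w - 1 = (1 - tr w) / nrm w"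
        using nz bil1 by (simp add: bil_minus_right field_simps)
      with eq have "nrm (1 - inverse w) - 1 = (1 - tr w) / nrm w" by simp
      moreover have "1 - tr w \<in> pid 1"
        using w subgrp_diff_commute[OF subgrp_pid] by (auto simp: Ft_def)
      ultimately have "nrm (1 - inverse w) - 1 \<in> pid 1" using divide_unit_pid[OF uw] by simp
      then show ?thesis using K0 nZ by (simp add: Fn_def)
    qed
    show "\<exists>w\<in>Ft 1. z - (1 - inverse w) \<in> K 1" if z: "z \<in> Fn 1 - Z" for z
    proof -
      define y where "y = 1 - z"
      have zy: "z = 1 + (- y)" by (simp add: y_def)
      have "y \<in> K 0" unfolding y_def using z by (intro subgrp_diff[OF subgrp_K one_K(1)]) (auto simp: Fn_def)
      moreover have "y \<notin> K 1" using z subgrp_diff_commute[OF subgrp_K, of z 1 1]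
        by (auto simp: y_def Z_def mem_coset_iff)
      ultimately have uy: "absv (nrm y) = 1" by (rule unit_K)
      then have nz: "y \<noteq> 0" by auto
      have "nrm z - 1 = nrm y - tr y"
        unfolding zy nrm_add by (simp add: bil_commute[of 1] bil_minus_left bil_minus_right bil_def tr_minus)
      then have "tr y - nrm y \<in> pid 1"
        using z subgrp_diff_commute[OF subgrp_pid, of "tr y" "nrm y"] by (simp add: Fn_def)
      then have "(tr y - nrm y) / nrm y \<in> pid 1" using divide_unit_pid[OF uy] by simp
      moreover have "inverse y = scale (inverse (nrm y)) (conj y)"
      proof (rule inverse_unique)
        show "y * scale (inverse (nrm y)) (conj y) = 1"
          using nz by (simp add: scale_right mult_conj em_def)
      qed
      then have "tr (inverse y) = inverse (nrm y) * tr y" by (simp only: tr_scale tr_conj)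
      then have "tr (inverse y) - 1 = (tr y - nrm y) / nrm y"
        using nz by (simp only: diff_divide_distrib) (simp add: divide_inverse mult.commute)
      moreover have "inverse y \<in> K 0"
        using uy by (simp add: K_def nrm_inverse absv_inverse)
      ultimately have "inverse y \<in> Ft 1" by (simp add: Ft_def)
      moreover have "z - (1 - inverse (inverse y)) \<in> K 1"
        using nz subgrp_zero[OF subgrp_K] by (simp add: y_def)
      ultimately show ?thesis by blast
    qed
  qed (intro subgrp_K stable_Ft)+
  moreover have "card (cosets (K 1) (Fn 1)) = card (cosets (K 1) Z) + card (cosets (K 1) (Fn 1 - Z))"
    unfolding card_cosets by (rule csum_union) (intro subgrp_K stable_Fn ZF Zst finite_Fn)+
  ultimately show ?thesis by simp
qed

text \<open>If some norm has valuation 1, multiplication by such an element identifies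
  \<open>K 0\<close> modulo \<open>K 1\<close> with \<open>K 1\<close> modulo \<open>K 2\<close>, so
  that \<open>qD\<^sup>2 = q ^ 4\<close>. Otherwise \<open>K 1 = K 2\<close>; this unramified case
  is excluded in \<open>residue_structure\<close>.\<close>

lemma qD_cases: "qD = q ^ 4 \<or> (qD = q ^ 2 \<and> (\<exists>e. absv (nrm e) = absv unif))"
proof (cases "\<exists>x. x \<in> K 1 \<and> x \<notin> K 2")
  case True
  then obtain e where e: "nrm e \<in> pid 1" "nrm e \<notin> pid 2" by (auto simp: K_mem)
  then have nz: "nrm e \<noteq> 0" using subgrp_zero[OF subgrp_pid] by metis
  then have "1 \<le> val (nrm e)" "\<not> 2 \<le> val (nrm e)"
    using e nz unfolding pid_mem absv_le_powi_iff by auto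
  then have "val (nrm e) = 1" by simp
  then have ae: "absv (nrm e) = absv unif" using absv_val[OF nz] by simp
  have sh: "e * x \<in> K (k + 1) \<longleftrightarrow> x \<in> K k" for x k
    by (simp add: K_def nrm_mult absv_mult ae power_int_add mult.commute)
  have e0: "e \<noteq> 0" using nz by auto
  have "card (cosets (K (1 + 1)) (K 1)) = qD"
  proof (rule card_cosets_bij[symmetric, where g = "\<lambda>x. e * x"])
    show "e * x - e * y \<in> K (1 + 1) \<longleftrightarrow> x - y \<in> K 1" for x y
      using sh[of "x - y" 1] by (simp only: right_diff_distrib)
    show "e * x \<in> K 1" if "x \<in> K 0" for x using that sh[of x 0] by simp
    show "\<exists>x\<in>K 0. y - e * x \<in> K (1 + 1)" if "y \<in> K 1" for y
    proof (intro bexI)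
      have "e * (inverse e * y) = y" using e0 by (simp add: mult.assoc[symmetric])
      then show "inverse e * y \<in> K 0" "y - e * (inverse e * y) \<in> K (1 + 1)"
        using sh[of "inverse e * y" 0] that subgrp_zero[OF subgrp_K] by auto
    qed
  qed (auto intro: subgrp_K stable_K)
  moreover have "q ^ 4 = card (cosets (K 2) (K 1)) * qD"
    unfolding index_K_2[symmetric]
    by (rule card_cosets_mult) (auto intro!: subgrp_K K_mono stable_K finite_K)
  ultimately have "(q ^ 2) ^ 2 = qD ^ 2" by (simp add: power4_eq_xxxx power2_eq_square)
  then show ?thesis using ae by (metis power2_eq_iff_nonneg zero_le)
next
  case False
  then have "K 1 = K 2" using K_mono[of 1 2] by auto
  then show ?thesis using index_K_2 by simp
qed

lemma sum_card_Fn: "qD = csum (pid 1) (pid 0) (\<lambda>c. card (cosets (K 1) (Fn c)))"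
  unfolding card_cosets Fn_def
proof (rule csum_fibre)
  show "stable (pid 1) (pid 0)" by (intro stable_subgrp subgrp_pid pid_mono) simp
qed (auto intro: subgrp_K stable_K finite_K subgrp_pid finite_residue nrm_congr simp: K_mem)

lemma sum_card_Ft: "qD = csum (pid 1) (pid 0) (\<lambda>c. card (cosets (K 1) (Ft c)))"
  unfolding card_cosets Ft_def
proof (rule csum_fibre)
  show "stable (pid 1) (pid 0)" by (intro stable_subgrp subgrp_pid pid_mono) simp
  show "tr x \<in> pid 0" if "x \<in> K 0" for x using tr_K[of x 0] K_mono[of "-1" 0] that by auto
qed (auto intro: subgrp_K stable_K finite_K subgrp_pid finite_residue tr_congr)

lemma stable_pid: "k \<le> l \<Longrightarrow> stable (pid l) (pid k)"
  by (intro stable_subgrp subgrp_pid pid_mono)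

text \<open>Translation by \<open>scale c w\<close> shifts the trace by \<open>c\<close> modulo
  \<open>pid 1\<close>.\<close>

lemma card_Ft_eq:
  assumes w: "w \<in> Ft 1" and c: "c \<in> pid 0"
  shows "card (cosets (K 1) (Ft c)) = card (cosets (K 1) (Ft 0))"
proof (rule card_cosets_bij[symmetric, where g = "\<lambda>x. x + scale c w"])
  have cw: "scale c w \<in> K 0" using scale_K[OF c, of w 0] w by (simp add: Ft_def)
  have "c * (tr w - 1) \<in> pid 1" using w c by (intro pid_mult_0) (auto simp: Ft_def)
  then have tcw: "tr (scale c w) - c \<in> pid 1" by (simp add: tr_scale right_diff_distrib)
  show "x + scale c w \<in> Ft c" if "x \<in> Ft 0" for x
    using subgrp_add[OF subgrp_K, of x 0 "scale c w"] subgrp_add[OF subgrp_pid, of "tr x" 1 "tr (scale c w) - c"]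
      that cw tcw by (simp add: Ft_def tr_add add_diff_eq)
  show "\<exists>x\<in>Ft 0. y - (x + scale c w) \<in> K 1" if "y \<in> Ft c" for y
  proof (intro bexI)
    show "y - scale c w \<in> Ft 0"
      using subgrp_diff[OF subgrp_K, of y 0 "scale c w"] subgrp_diff[OF subgrp_pid, of "tr y - c" 1 "tr (scale c w) - c"]
        that cw tcw by (simp add: Ft_def tr_diff)
  qed (simp add: subgrp_zero[OF subgrp_K])
qed (auto intro: subgrp_K stable_Ft)

text \<open>Only an inequality at this stage: the residual norm is not yet known to be surjective,
  so the fibre over \<open>c\<close> may be empty.\<close>

lemma card_Fn_le: "c \<in> pid 0 \<Longrightarrow> c \<notin> pid 1 \<Longrightarrow> card (cosets (K 1) (Fn c)) \<le> card (cosets (K 1) (Fn 1))"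
  by (cases "Fn c = {}") (use card_Fn_eq in \<open>auto simp: cosets_def\<close>)

lemma card_units: "card (cosets (pid 1) (pid 0 - pid 1)) = q - 1"
proof -
  have "q = card (cosets (pid 1) (pid 1)) + card (cosets (pid 1) (pid 0 - pid 1))"
    unfolding residue_card_eq card_cosets
    by (rule csum_union) (auto intro: subgrp_pid stable_pid finite_residue simp: pid_mono)
  then show ?thesis by (simp add: cosets_self subgrp_pid)
qed

lemma qD_eq_sum: "qD = 1 + csum (pid 1) (pid 0 - pid 1) (\<lambda>c. card (cosets (K 1) (Fn c)))"
proof -
  have "csum (pid 1) (pid 1) (\<lambda>c. card (cosets (K 1) (Fn c))) = csum (pid 1) (pid 1) (\<lambda>_. 1)"
    by (rule csum_cong) (auto intro: subgrp_pid stable_pid simp: card_Fn_0)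
  then have "csum (pid 1) (pid 1) (\<lambda>c. card (cosets (K 1) (Fn c))) = 1"
    by (simp add: csum_const cosets_self subgrp_pid)
  moreover have "qD = csum (pid 1) (pid 1) (\<lambda>c. card (cosets (K 1) (Fn c))) +
      csum (pid 1) (pid 0 - pid 1) (\<lambda>c. card (cosets (K 1) (Fn c)))"
    by (subst sum_card_Fn, rule csum_union)
      (auto intro: subgrp_pid stable_pid finite_residue simp: pid_mono)
  ultimately show ?thesis by simp
qed

lemma stable_units: "stable (pid 1) (pid 0 - pid 1)"
  by (intro stable_Diff subgrp_pid stable_pid) simp_all

lemma qD_le: "qD \<le> 1 + (q - 1) * card (cosets (K 1) (Fn 1))"
proof -
  have "csum (pid 1) (pid 0 - pid 1) (\<lambda>c. card (cosets (K 1) (Fn c)))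
      \<le> csum (pid 1) (pid 0 - pid 1) (\<lambda>c. card (cosets (K 1) (Fn 1)))"
    unfolding csum_def
  proof (rule sum_mono)
    fix C assume "C \<in> cosets (pid 1) (pid 0 - pid 1)"
    then obtain c where "c \<in> pid 0 - pid 1" "C = (+) c ` pid 1" by (auto simp: cosets_def)
    then have "(SOME x. x \<in> C) \<in> pid 0 - pid 1"
      using some_coset_mem[OF subgrp_pid stable_units] by blast
    then show "card (cosets (K 1) (Fn (SOME x. x \<in> C))) \<le> card (cosets (K 1) (Fn 1))"
      using card_Fn_le by blast
  qed
  then show ?thesis using qD_eq_sum by (simp add: csum_const card_units)
qed

text \<open>Let \<open>t\<close> be the number of classes of trace 1. If \<open>t = 0\<close>, then
  \<open>qD_le\<close> gives \<open>qD \<le> q\<close>, against \<open>q\<^sup>2 \<le> qD\<close>.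
  Otherwise all trace fibres have \<open>t\<close> classes, so \<open>qD = q * t\<close>; with
  \<open>qD \<le> 1 + (q - 1) * (1 + t)\<close> this gives \<open>t \<le> q\<close>, whence
  \<open>qD = q\<^sup>2\<close> and the alternative \<open>q ^ 4\<close> of \<open>qD_cases\<close>
  is impossible.\<close>

lemma residue_structure:
  shows qD_eq: "qD = q\<^sup>2" and card_Fn_1_eq: "card (cosets (K 1) (Fn 1)) = q + 1"
    and Ft_1_nonempty: "Ft 1 \<noteq> {}" and exists_nrm_unif: "\<exists>e. absv (nrm e) = absv unif"
proof -
  define t where "t = card (cosets (K 1) (Ft 1))"
  have q2: "q \<ge> 2" by (rule residue_card_ge_2)
  have le: "qD \<le> 1 + (q - 1) * (1 + t)" using qD_le by (simp add: card_Fn_1 t_def)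
  have "q ^ 2 \<le> q ^ 4" using q2 by (intro power_increasing) auto
  then have ge: "q\<^sup>2 \<le> qD" using qD_cases by auto
  have "q < q\<^sup>2" using q2 by (simp add: power2_eq_square)
  then have lt: "q < qD" using ge by simp
  show ne: "Ft 1 \<noteq> {}"
  proof
    assume "Ft 1 = {}"
    then have "t = 0" by (simp add: t_def cosets_def)
    then show False using le lt q2 by simp
  qed
  then obtain w where w: "w \<in> Ft 1" by blast
  have one: "1 \<in> pid 0" by (simp add: pid_mem)
  have "qD = csum (pid 1) (pid 0) (\<lambda>_. t)"
  proof (subst sum_card_Ft, rule csum_cong)
    fix c assume "c \<in> pid 0"
    then show "card (cosets (K 1) (Ft c)) = t"
      unfolding t_def using card_Ft_eq[OF w] card_Ft_eq[OF w one] by simp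
  qed (auto intro: subgrp_pid stable_pid)
  then have qt: "qD = q * t" by (simp add: csum_const residue_card_eq)
  obtain r where r: "q = Suc r" using q2 by (cases q) auto
  have "t \<le> q" using le unfolding qt r by (simp add: algebra_simps)
  then have "qD \<le> q\<^sup>2" unfolding qt power2_eq_square by simp
  then show e: "qD = q\<^sup>2" using ge by simp
  then have "q * t = q * q" using qt by (simp add: power2_eq_square)
  then have "t = q" using q2 by simp
  then show "card (cosets (K 1) (Fn 1)) = q + 1" by (simp add: card_Fn_1 t_def)
  have "q ^ 2 < q ^ 4" using q2 by (intro power_strict_increasing) auto
  then show "\<exists>e. absv (nrm e) = absv unif" using qD_cases e by auto
qed

text \<open>The upper bounds \<open>q + 1\<close> for the \<open>q - 1\<close> unit fibres add up to
  the exact total \<open>q\<^sup>2 - 1\<close>, so every one of them is attained.\<close>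

lemma card_Fn_unit:
  assumes "c \<in> pid 0" "c \<notin> pid 1" shows "card (cosets (K 1) (Fn c)) = q + 1"
proof -
  let ?U = "pid 0 - pid 1"
  have "csum (pid 1) ?U (\<lambda>c. card (cosets (K 1) (Fn c))) = csum (pid 1) ?U (\<lambda>_. q + 1)"
  proof -
    obtain r where r: "q = Suc r" using residue_card_ge_2 by (cases q) auto
    show ?thesis using qD_eq_sum qD_eq
      by (simp add: csum_const card_units) (simp add: r power2_eq_square algebra_simps)
  qed
  then have eq: "(\<Sum>C\<in>cosets (pid 1) ?U. card (cosets (K 1) (Fn (SOME x. x \<in> C)))) = (\<Sum>C\<in>cosets (pid 1) ?U. q + 1)"
    by (simp add: csum_def)
  have in_U: "(SOME x. x \<in> C) \<in> ?U" if CU: "C \<in> cosets (pid 1) ?U" for C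
  proof -
    obtain c where "c \<in> ?U" "C = (+) c ` pid 1" using CU by (auto simp: cosets_def)
    then show ?thesis using some_coset_mem[OF subgrp_pid stable_units] by blast
  qed
  define C where "C = (+) c ` pid 1"
  have C: "C \<in> cosets (pid 1) ?U" using assms by (auto simp: C_def cosets_def)
  have "card (cosets (K 1) (Fn (SOME x. x \<in> C))) = q + 1"
  proof (rule sum_mono_inv[OF eq _ C])
    show "finite (cosets (pid 1) ?U)" using finite_subset[OF cosets_mono finite_residue] by blast
    show "card (cosets (K 1) (Fn (SOME x. x \<in> D))) \<le> q + 1" if "D \<in> cosets (pid 1) ?U" for D
      using card_Fn_le[of "SOME x. x \<in> D"] in_U[OF that] card_Fn_1_eq by auto
  qed
  moreover have "Fn (SOME x. x \<in> C) = Fn c"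
  proof -
    have d: "(SOME x. x \<in> C) - c \<in> pid 1" unfolding C_def by (rule some_coset[OF subgrp_pid])
    then have d': "c - (SOME x. x \<in> C) \<in> pid 1" using subgrp_diff_commute[OF subgrp_pid] by blast
    show ?thesis using subgrp_diff_trans[OF subgrp_pid _ d] subgrp_diff_trans[OF subgrp_pid _ d']
      by (auto simp: Fn_def)
  qed
  ultimately show ?thesis by simp
qed

lemma gauss_sum:
  fixes \<phi> :: "'f \<Rightarrow> 'r::idom"
  assumes hom: "\<And>x y. \<phi> (x + y) = \<phi> x * \<phi> y" and triv: "\<And>x. x \<in> pid 1 \<Longrightarrow> \<phi> x = 1"
    and e: "e \<in> pid 0" "\<phi> e \<noteq> 1"
  shows "csum (K 1) (K 0) (\<lambda>x. \<phi> (nrm x)) = - of_nat q"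
proof -
  have inv: "\<phi> x = \<phi> y" if "x - y \<in> pid 1" for x y
    using hom[of "x - y" y] triv[OF that] by simp
  have "csum (K 1) (K 0) (\<lambda>x. \<phi> (nrm x)) = csum (pid 1) (pid 0) (\<lambda>c. csum (K 1) (Fn c) (\<lambda>x. \<phi> (nrm x)))"
    unfolding Fn_def
    by (rule csum_fibre) (auto intro: stable_pid subgrp_K stable_K finite_K subgrp_pid finite_residue nrm_congr simp: K_mem)
  also have "\<dots> = csum (pid 1) (pid 0) (\<lambda>c. of_nat (card (cosets (K 1) (Fn c))) * \<phi> c)"
  proof (rule csum_cong)
    fix c assume "c \<in> pid 0"
    have "csum (K 1) (Fn c) (\<lambda>x. \<phi> (nrm x)) = csum (K 1) (Fn c) (\<lambda>_. \<phi> c)"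
      by (rule csum_cong[OF subgrp_K stable_Fn]) (auto intro: inv simp: Fn_def)
    then show "csum (K 1) (Fn c) (\<lambda>x. \<phi> (nrm x)) = of_nat (card (cosets (K 1) (Fn c))) * \<phi> c"
      by (simp add: csum_const)
  qed (auto intro: subgrp_pid stable_pid)
  also have "\<dots> = csum (pid 1) (pid 1) (\<lambda>c. of_nat (card (cosets (K 1) (Fn c))) * \<phi> c) +
      csum (pid 1) (pid 0 - pid 1) (\<lambda>c. of_nat (card (cosets (K 1) (Fn c))) * \<phi> c)"
    by (rule csum_union) (auto intro: subgrp_pid stable_pid finite_residue simp: pid_mono)
  also have "csum (pid 1) (pid 1) (\<lambda>c. of_nat (card (cosets (K 1) (Fn c))) * \<phi> c) = csum (pid 1) (pid 1) (\<lambda>_. 1)"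
    by (rule csum_cong) (auto intro: subgrp_pid stable_pid simp: card_Fn_0 triv)
  also have "csum (pid 1) (pid 1) (\<lambda>_. 1) = (1 :: 'r)"
    by (simp add: csum_const cosets_self subgrp_pid)
  also have "csum (pid 1) (pid 0 - pid 1) (\<lambda>c. of_nat (card (cosets (K 1) (Fn c))) * \<phi> c) =
      csum (pid 1) (pid 0 - pid 1) (\<lambda>c. of_nat (q + 1) * \<phi> c)"
    by (rule csum_cong) (use card_Fn_unit in \<open>auto intro: subgrp_pid stable_units\<close>)
  also have "\<dots> = of_nat (q + 1) * csum (pid 1) (pid 0 - pid 1) \<phi>" by (rule csum_mult_left)
  also have "csum (pid 1) (pid 0 - pid 1) \<phi> = - 1"
  proof -
    have "csum (pid 1) (pid 0) \<phi> = 0"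
      by (rule csum_character[where a = e]) (auto intro: subgrp_pid simp: e hom invar_def inv pid_mono)
    moreover have "csum (pid 1) (pid 0) \<phi> = csum (pid 1) (pid 1) \<phi> + csum (pid 1) (pid 0 - pid 1) \<phi>"
      by (rule csum_union) (auto intro: subgrp_pid stable_pid finite_residue simp: pid_mono)
    moreover have "csum (pid 1) (pid 1) \<phi> = csum (pid 1) (pid 1) (\<lambda>_. 1)"
      by (rule csum_cong) (auto intro: subgrp_pid stable_pid simp: triv)
    moreover have "csum (pid 1) (pid 1) (\<lambda>_. 1) = (1 :: 'r)"
      by (simp add: csum_const cosets_self subgrp_pid)
    ultimately show ?thesis by (simp add: eq_neg_iff_add_eq_0 add.commute)
  qed
  finally show ?thesis by simp
qed

text \<open>Scalars provide the even valuations, and their products with an element from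
  \<open>exists_nrm_unif\<close> the odd ones. Hence every \<open>K k\<close> is a multiple of
  \<open>K 0\<close>.\<close>

lemma exists_nrm_val: "\<exists>d. d \<noteq> 0 \<and> absv (nrm d) = absv unif powi k"
proof -
  obtain e where e: "absv (nrm e) = absv unif" using exists_nrm_unif by blast
  have odd_even: "\<exists>l. k = 2 * l \<or> k = 2 * l + 1" by presburger
  then obtain l where l: "k = 2 * l \<or> k = 2 * l + 1" ..
  define d where "d = (if k = 2 * l then em (unif powi l) else scale (unif powi l) e)"
  have "absv (unif powi l) * absv (unif powi l) = absv unif powi (2 * l)"
    by (simp add: absv_power_int power_int_add[symmetric])
  then have d: "absv (nrm d) = absv unif powi k"
    using l e by (auto simp: d_def nrm_scale absv_mult power2_eq_square power_int_add mult.assoc)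
  moreover have "d \<noteq> 0"
  proof
    assume "d = 0"
    then have "absv unif powi k = 0" using d by simp
    then show False by simp
  qed
  ultimately show ?thesis by blast
qed

lemma shift_K: "absv (nrm d) = absv unif powi l \<Longrightarrow> d * x \<in> K (l + k) \<longleftrightarrow> x \<in> K k"
  by (simp add: K_def nrm_mult absv_mult power_int_add)

lemma csum_shift:
  assumes d: "d \<noteq> 0" "absv (nrm d) = absv unif powi l" and inv: "invar (K (l + n)) (K (l + k)) \<Phi>" and "k \<le> n"
  shows "csum (K (l + n)) (K (l + k)) \<Phi> = csum (K n) (K k) (\<lambda>x. \<Phi> (d * x))"
proof (rule csum_bij[symmetric, where g = "\<lambda>x. d * x"])
  show iff: "d * x - d * y \<in> K (l + n) \<longleftrightarrow> x - y \<in> K n" for x y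
    using shift_K[OF d(2), of "x - y"] by (simp add: right_diff_distrib)
  show "\<exists>x\<in>K k. y - d * x \<in> K (l + n)" if "y \<in> K (l + k)" for y
  proof (intro bexI)
    have "d * (inverse d * y) = y" using d by (simp add: mult.assoc[symmetric])
    then show "inverse d * y \<in> K k" "y - d * (inverse d * y) \<in> K (l + n)"
      using shift_K[OF d(2), of "inverse d * y"] that subgrp_zero[OF subgrp_K] by auto
  qed
  show "invar (K n) (K k) (\<lambda>x. \<Phi> (d * x))"
    using inv iff shift_K[OF d(2)] by (auto simp: invar_def)
qed (use assms shift_K in \<open>auto intro: subgrp_K stable_K\<close>)

lemma index_K: "card (cosets (K (k + 1)) (K k)) = q\<^sup>2"
proof -
  obtain d where "d \<noteq> 0" "absv (nrm d) = absv unif powi k" using exists_nrm_val by blast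
  from csum_shift[OF this, of 1 0 "\<lambda>_. 1::nat"] show ?thesis
    using qD_eq by (simp add: card_cosets)
qed

end

section \<open>Dual lattices\<close>

context nonarch_local_field
begin

text \<open>The search for the least exponent starts at \<open>val x + 1\<close>, so that at offset
  0 the element \<open>x\<close> itself shows that the exponent cannot be lowered.\<close>

lemma character_conductor:
  fixes \<psi> :: "'f \<Rightarrow> 'r::idom"
  assumes \<psi>: "smooth_character absv \<psi>" and nt: "\<psi> x \<noteq> 1"
  shows "\<exists>m. (\<forall>x\<in>pid m. \<psi> x = 1) \<and> (\<exists>a\<in>pid (m - 1). \<psi> a \<noteq> 1)"
proof -
  have hom: "\<psi> (x + y) = \<psi> x * \<psi> y" and unit: "\<psi> x dvd 1" for x y
    using \<psi> by (auto simp: smooth_character_def)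
  have "\<psi> 0 \<noteq> 0" using unit[of 0] by auto
  then have "\<psi> 0 = 1" using hom[of 0 0] by simp
  moreover have op: "openin (field_topology absv) {x. \<psi> x = 1}"
    using \<psi> by (simp add: smooth_character_def)
  ultimately obtain r where r: "r > 0" "\<And>y. absv y < r \<Longrightarrow> \<psi> y = 1"
    using bspec[OF op[unfolded openin_field], of 0] by auto
  have "x \<noteq> 0" using nt \<open>\<psi> 0 = 1\<close> by auto
  obtain a where a: "a \<noteq> 0" "absv a < r" using exists_small[OF r(1)] by blast
  define P where "P n \<longleftrightarrow> (\<forall>y\<in>pid (val x + 1 + int n). \<psi> y = 1)" for n
  have "P (nat (val a - val x))"
    unfolding P_def
  proof
    fix y assume "y \<in> pid (val x + 1 + int (nat (val a - val x)))"
    then have "y \<in> pid (val a)" using subsetD[OF pid_mono] by (smt (verit) int_nat_eq)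
    then have "absv y < r" using a absv_val[OF a(1)] by (simp add: pid_mem)
    then show "\<psi> y = 1" by (rule r(2))
  qed
  then have PL: "P (LEAST n. P n)" by (rule LeastI)
  define n where "n = (LEAST n. P n)"
  have "\<exists>a\<in>pid (val x + int n). \<psi> a \<noteq> 1"
  proof (cases n)
    case 0
    have "x \<in> pid (val x)" using absv_val[OF \<open>x \<noteq> 0\<close>] by (simp add: pid_mem)
    then show ?thesis using 0 nt by auto
  next
    case (Suc k)
    then have "\<not> P k" using not_less_Least[of k P] by (simp add: n_def)
    then show ?thesis by (simp add: P_def Suc ac_simps)
  qed
  moreover have "\<forall>y\<in>pid (val x + 1 + int n). \<psi> y = 1" using PL unfolding n_def[symmetric] by (simp only: P_def)
  ultimately show ?thesis by (intro exI[of _ "val x + 1 + int n"]) (simp add: add.commute)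
qed

end

locale quaternion_character = quaternion_basis absv scale a b i j
  for absv :: "'f::field \<Rightarrow> real" and scale :: "'f \<Rightarrow> 'a::division_ring \<Rightarrow> 'a" and a b i j +
  fixes \<psi> :: "'f \<Rightarrow> 'r::idom" and m :: int
  assumes \<psi>_add: "\<psi> (x + y) = \<psi> x * \<psi> y"
    and \<psi>_triv: "x \<in> pid m \<Longrightarrow> \<psi> x = 1"
    and \<psi>_nontriv: "\<exists>a\<in>pid (m - 1). \<psi> a \<noteq> 1"
begin

lemma \<psi>_0 [simp]: "\<psi> 0 = 1"
  by (rule \<psi>_triv) (simp add: pid_mem absv_nonneg)

lemma \<psi>_minus_mult: "\<psi> (- x) * \<psi> x = 1"
  using \<psi>_add[of "- x" x] by simp

lemma \<psi>_minus_eq_1: "\<psi> (- x) = 1 \<longleftrightarrow> \<psi> x = 1"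
  using \<psi>_minus_mult[of x] by auto

text \<open>Otherwise the multiples of \<open>e\<close> would include an element of
  \<open>pid (m - 1)\<close> where \<open>\<psi>\<close> is nontrivial. This turns orthogonality
  under \<open>\<psi>\<close> into a divisibility property of \<open>bil\<close>.\<close>

lemma pid_char: assumes "\<And>c. c \<in> pid 0 \<Longrightarrow> \<psi> (c * e) = 1" shows "e \<in> pid m"
proof (rule ccontr)
  assume e: "e \<notin> pid m"
  then have e0: "e \<noteq> 0" using subgrp_zero[OF subgrp_pid] by auto
  then have "val e \<le> m - 1" using e by (simp add: pid_mem absv_le_powi_iff)
  obtain a where a: "a \<in> pid (m - 1)" "\<psi> a \<noteq> 1" using \<psi>_nontriv by blast
  have "absv a \<le> absv e"
    using a(1) \<open>val e \<le> m - 1\<close> absv_val[OF e0] absv_unif_powi_le_iff[of "m - 1" "val e"] by (simp add: pid_mem)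
  then have "a / e \<in> pid 0" using e0 by (simp add: pid_mem absv_divide divide_le_eq_1)
  from assms[OF this] show False using e0 a(2) by simp
qed

section \<open>Duality with respect to the bilinear form\<close>

definition perp :: "'a set \<Rightarrow> 'a set" where
  "perp M = {x. \<forall>y\<in>M. \<psi> (bil x y) = 1}"

lemma perp_antimono: "H \<subseteq> M \<Longrightarrow> perp M \<subseteq> perp H"
  by (auto simp: perp_def)

lemma omod_perp: assumes "omod M" shows "omod (perp M)"
  unfolding omod_def subgrp_def perp_def
proof (intro conjI ballI CollectI; (elim CollectE)?)
  show "\<psi> (bil (x - y) z) = 1" if "\<forall>y\<in>M. \<psi> (bil x y) = 1" "\<forall>z\<in>M. \<psi> (bil y z) = 1" "z \<in> M" for x y z
    using that \<psi>_add[of "bil x z" "- bil y z"] \<psi>_minus_eq_1[of "bil y z"] by (simp add: bil_diff_left)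
  show "\<psi> (bil (scale c x) y) = 1" if "c \<in> pid 0" "\<forall>y\<in>M. \<psi> (bil x y) = 1" "y \<in> M" for c x y
    using that omod_scale[OF assms that(1,3)] by (simp add: bil_scale_left bil_scale_right[symmetric])
qed simp

lemma perp_bil_pid:
  assumes "omod M" "x \<in> perp M" "y \<in> M" shows "bil x y \<in> pid m"
proof (rule pid_char)
  fix c assume "c \<in> pid 0"
  then have "scale c y \<in> M" using omod_scale assms by blast
  then show "\<psi> (c * bil x y) = 1" using assms(2) by (auto simp: perp_def bil_scale_right)
qed

text \<open>The inverse different of the maximal order is the inverse of its maximal ideal.\<close>

lemma perp_K: "perp (K k) = K (2 * m - 1 - k)"
proof (intro equalityI subsetI)
  fix x assume x: "x \<in> K (2 * m - 1 - k)"
  have "\<psi> (bil x y) = 1" if "y \<in> K k" for y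
  proof -
    have "x * conj y \<in> K (2 * m - 1 - k + k)" using x that by (intro K_mult) simp_all
    then have "bil x y \<in> pid m" unfolding bil_def by (intro tr_K) simp
    then show ?thesis by (rule \<psi>_triv)
  qed
  then show "x \<in> perp (K k)" by (simp add: perp_def)
next
  fix x assume x: "x \<in> perp (K k)"
  show "x \<in> K (2 * m - 1 - k)"
  proof (rule ccontr)
    assume n: "x \<notin> K (2 * m - 1 - k)"
    then have x0: "x \<noteq> 0" using subgrp_zero[OF subgrp_K] by auto
    define v where "v = val (nrm x)"
    have v: "absv (nrm x) = absv unif powi v" using absv_val[of "nrm x"] x0 by (simp add: v_def)
    then have "v \<le> 2 * m - 2 - k" using n by (simp add: K_def absv_unif_powi_le_iff)
    obtain a where a: "a \<in> pid (m - 1)" "\<psi> a \<noteq> 1" using \<psi>_nontriv by blast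
    obtain w where w: "w \<in> Ft 1" using Ft_1_nonempty by blast
    have "tr w \<notin> pid 1"
      using w subgrp_diff[OF subgrp_pid, of "tr w" 1 "tr w - 1"] one_notin_pid by (auto simp: Ft_def)
    moreover have "tr w \<in> pid 0" using w tr_K[of w 0] K_mono[of "-1" 0] by (auto simp: Ft_def)
    ultimately have u: "absv (tr w) = 1" by (rule unit_pid[rotated])
    then have t0: "tr w \<noteq> 0" by auto
    \<comment> \<open>Chosen so that \<open>x * conj y\<close> is \<open>scale (a / tr w) w\<close>,
      whose trace is \<open>a\<close>; because \<open>tr w\<close> is a unit, \<open>y\<close> stays
      in \<open>K k\<close>.\<close>
    define y where "y = conj (inverse x * scale (a / tr w) w)"
    have "a / tr w \<in> pid (m - 1)" using a divide_unit_pid[OF u] by simp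
    then have "scale (a / tr w) w \<in> K (2 * (m - 1) + 0)" using w by (intro scale_K) (auto simp: Ft_def)
    moreover have "inverse x \<in> K (- v)" by (simp add: K_def nrm_inverse absv_inverse v power_int_minus)
    ultimately have "y \<in> K (- v + (2 * (m - 1) + 0))" unfolding y_def K_conj by (intro K_mult)
    then have "y \<in> K k" using K_mono[of k "- v + (2 * (m - 1) + 0)"] \<open>v \<le> 2 * m - 2 - k\<close> by auto
    moreover have "bil x y = a" using x0 t0
      by (simp add: bil_def y_def mult.assoc[symmetric] tr_scale)
    ultimately show False using x a(2) by (auto simp: perp_def)
  qed
qed

text \<open>In each simple step, pairing with the adjoined \<open>x\<close> embeds the quotient of
  the duals into \<open>pid (m - 1)\<close> modulo \<open>pid m\<close>, which has \<open>q\<close>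
  elements. The inequality suffices: \<open>vexp_perp\<close> obtains equality by comparison with
  the \<open>K k\<close>.\<close>

lemma dual_index_le:
  assumes H: "omod H" and M: "omod M" and sub: "H \<subseteq> M" and fin: "finite (cosets H M)" and KH: "K k \<subseteq> H"
  shows "finite (cosets (perp M) (perp H)) \<and> card (cosets (perp M) (perp H)) \<le> card (cosets H M)"
  using assms
proof (rule omod_chain[where Q = "\<lambda>M. finite (cosets (perp M) (perp H)) \<and> card (cosets (perp M) (perp H)) \<le> card (cosets H M)"])
  show "finite (cosets (perp H) (perp H)) \<and> card (cosets (perp H) (perp H)) \<le> card (cosets H H)"
    using cosets_self[OF omod_subgrp] H omod_perp by simp
next
  fix M' x
  assume M': "omod M'" "H \<subseteq> M'" "M' \<subseteq> M"
    "finite (cosets (perp M') (perp H)) \<and> card (cosets (perp M') (perp H)) \<le> card (cosets H M')"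
    and x: "x \<in> M" "x \<notin> M'" "scale unif x \<in> M'"
  define M2 where "M2 = adj M' x"
  have M2: "omod M2" "M' \<subseteq> M2" "x \<in> M2" unfolding M2_def by (intro omod_adj adj_supset mem_adj M')+
  have "finite (cosets (perp M2) (perp M')) \<and> card (cosets (perp M2) (perp M')) \<le> card (cosets (pid (m - 1 + 1)) (pid (m - 1)))"
  proof (rule card_cosets_inj[where g = "\<lambda>y. bil y x"])
    show "subgrp (perp M2)" "stable (perp M2) (perp M')"
      by (intro stable_subgrp omod_subgrp omod_perp perp_antimono M2 M')+
    show "bil y x \<in> pid (m - 1)" if "y \<in> perp M'" for y
    proof -
      have "unif * bil y x \<in> pid m"
        using perp_bil_pid[OF M'(1) that x(3)] by (simp add: bil_scale_right)
      then show ?thesis using unif_powi_mult_pid[of 1 "bil y x" "m - 1"] by simp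
    qed
    show "bil y x - bil z x \<in> pid (m - 1 + 1) \<longleftrightarrow> y - z \<in> perp M2" if yz: "y \<in> perp M'" "z \<in> perp M'" for y z
    proof -
      define d where "d = y - z"
      have d: "d \<in> perp M'" unfolding d_def using yz M' by (intro subgrp_diff omod_subgrp omod_perp)
      have "bil d x \<in> pid m \<longleftrightarrow> d \<in> perp M2"
      proof
        assume dx: "bil d x \<in> pid m"
        show "d \<in> perp M2" unfolding perp_def
        proof (intro CollectI ballI)
          fix u assume "u \<in> M2"
          then obtain c where c: "c \<in> pid 0" "u - scale c x \<in> M'" by (auto simp: M2_def adj_def)
          have "bil d u = c * bil d x + bil d (u - scale c x)" by (simp add: bil_diff_right bil_scale_right)
          moreover have "\<psi> (c * bil d x) = 1" using pid_mult_0[OF c(1) dx] by (rule \<psi>_triv)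
          moreover have "\<psi> (bil d (u - scale c x)) = 1" using d c(2) by (auto simp: perp_def)
          ultimately show "\<psi> (bil d u) = 1" by (simp add: \<psi>_add)
        qed
      qed (use perp_bil_pid M2 in blast)
      then show ?thesis by (simp add: d_def bil_diff_left)
    qed
  qed (rule subgrp_pid finite_pid)+
  then have *: "finite (cosets (perp M2) (perp M'))" "card (cosets (perp M2) (perp M')) \<le> q"
    by (simp_all only: index_pid)
  have zero: "0 \<in> perp N" for N by (simp add: perp_def)
  have "card (cosets (perp M2) (perp H)) = card (cosets (perp M2) (perp M')) * card (cosets (perp M') (perp H)) \<and> finite (cosets (perp M2) (perp H))"
    using * M' M2 H by (intro index_trans) (auto intro!: omod_subgrp omod_perp perp_antimono card_cosets_pos zero)
  moreover have "card (cosets H M2) = card (cosets H M') * q"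
    unfolding M2_def index_adj[OF M'(1) x(2,3), symmetric]
    by (rule card_cosets_mult)
      (use M' H M2 finite_subset[OF cosets_mono[OF adj_subset[OF M M'(3) x(1)]] fin] in
        \<open>auto intro!: omod_subgrp stable_subgrp simp: M2_def\<close>)
  ultimately show "finite (cosets (perp (adj M' x)) (perp H)) \<and>
      card (cosets (perp (adj M' x)) (perp H)) \<le> card (cosets H (adj M' x))"
    using M'(4) mult_le_mono[OF *(2), of "card (cosets (perp M') (perp H))" "card (cosets H M')"]
    by (simp add: M2_def mult.commute)
qed

text \<open>Bounded open submodules. This description without generators passes directly to
  intersections and duals; \<open>lattice_latt\<close> supplies it for a given lattice.\<close>

definition latt :: "'a set \<Rightarrow> bool" where
  "latt M \<longleftrightarrow> omod M \<and> (\<exists>k. M \<subseteq> K k) \<and> (\<exists>l. K l \<subseteq> M)"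

lemma latt_K: "latt (K k)"
  using omod_K by (auto simp: latt_def)

lemma latt_omod: "latt M \<Longrightarrow> omod M" and latt_subgrp: "latt M \<Longrightarrow> subgrp M"
  by (auto simp: latt_def omod_subgrp)

lemma latt_Int: assumes "latt M" "latt N" shows "latt (M \<inter> N)"
proof -
  obtain l1 l2 where l: "K l1 \<subseteq> M" "K l2 \<subseteq> N" using assms by (auto simp: latt_def)
  have "K (max l1 l2) \<subseteq> M \<inter> N" using l K_mono[of l1 "max l1 l2"] K_mono[of l2 "max l1 l2"] by auto
  then show ?thesis using assms unfolding latt_def omod_def by (auto intro: subgrp_Int)
qed

lemma latt_perp: assumes "latt M" shows "latt (perp M)"
proof -
  obtain k l where "M \<subseteq> K k" "K l \<subseteq> M" using assms by (auto simp: latt_def)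
  then have "K (2 * m - 1 - k) \<subseteq> perp M" "perp M \<subseteq> K (2 * m - 1 - l)"
    using perp_antimono perp_K by metis+
  then show ?thesis using assms omod_perp by (auto simp: latt_def)
qed

lemma finite_latt: assumes "latt H" "latt M" shows "finite (cosets H M)"
proof -
  obtain k l where kl: "M \<subseteq> K k" "K l \<subseteq> H" using assms by (auto simp: latt_def)
  have "finite (cosets (K l) M)" using finite_subset[OF cosets_mono[OF kl(1)] finite_K] .
  then show ?thesis using finite_cosets_coarse[OF subgrp_K latt_subgrp[OF assms(1)] kl(2)] by blast
qed

lemma index_latt_mult:
  assumes "latt G" "latt H" "latt M" "G \<subseteq> H" "H \<subseteq> M"
  shows "card (cosets G M) = card (cosets G H) * card (cosets H M)"
  by (rule card_cosets_mult) (use assms in \<open>auto intro!: latt_subgrp stable_subgrp finite_latt\<close>)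

lemma index_latt_power: assumes "latt H" "latt M" "H \<subseteq> M" shows "\<exists>n. card (cosets H M) = q ^ n"
proof -
  obtain k where "K k \<subseteq> H" using assms by (auto simp: latt_def)
  then show ?thesis using index_power[of H M k] finite_latt assms latt_omod by blast
qed

lemma index_K_K: "card (cosets (K (k + int n)) (K k)) = q ^ (2 * n)"
proof (induction n)
  case 0
  then show ?case by (simp add: cosets_self subgrp_K)
next
  case (Suc n)
  have "card (cosets (K (k + int n + 1)) (K k)) = card (cosets (K (k + int n + 1)) (K (k + int n))) * card (cosets (K (k + int n)) (K k))"
    by (rule index_latt_mult) (auto intro!: latt_K K_mono)
  also have "\<dots> = q ^ (2 * Suc n)" unfolding index_K Suc.IH by (simp add: power_add[symmetric])
  finally show ?case by (simp add: algebra_simps)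
qed

lemma q_gt_1: "q > 1" using residue_card_ge_2 by simp

text \<open>The base-\<open>q\<close> logarithm of the volume of \<open>M\<close> when
  \<open>K 0\<close> has volume 1, so that \<open>K l\<close> has volume
  \<open>q powi (- 2 * l)\<close>. The condition \<open>0 \<le> e + 2 * l\<close> guards against
  truncation by \<open>nat\<close>.\<close>

definition vexp :: "'a set \<Rightarrow> int" where
  "vexp M = (THE e. \<forall>l. K l \<subseteq> M \<longrightarrow> 0 \<le> e + 2 * l \<and> card (cosets (K l) M) = q ^ nat (e + 2 * l))"

lemma vexp_aux:
  assumes "latt M"
  shows "\<exists>!e. \<forall>l. K l \<subseteq> M \<longrightarrow> 0 \<le> e + 2 * l \<and> card (cosets (K l) M) = q ^ nat (e + 2 * l)"
proof -
  obtain l0 where l0: "K l0 \<subseteq> M" using assms by (auto simp: latt_def)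
  obtain n0 where n0: "card (cosets (K l0) M) = q ^ n0" using index_latt_power[OF latt_K assms l0] by blast
  \<comment> \<open>The exponent read off at \<open>l0\<close> serves every level because each step
    of the filtration has index \<open>q\<^sup>2\<close>; levels on both sides of \<open>l0\<close>
    occur.\<close>
  have 1: "0 \<le> int n0 - 2 * l0 + 2 * l \<and> card (cosets (K l) M) = q ^ nat (int n0 - 2 * l0 + 2 * l)"
    if l: "K l \<subseteq> M" for l
  proof (cases "l0 \<le> l")
    case True
    define d where "d = nat (l - l0)"
    have ld: "l = l0 + int d" using True by (simp add: d_def)
    have "card (cosets (K l) M) = card (cosets (K l) (K l0)) * card (cosets (K l0) M)"
      by (rule index_latt_mult) (use True l0 in \<open>auto intro!: latt_K assms K_mono\<close>)
    also have "\<dots> = q ^ (2 * d + n0)" unfolding n0 ld index_K_K by (simp add: power_add)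
    finally show ?thesis using ld by (simp add: nat_eq_iff) (simp add: algebra_simps nat_add_distrib nat_mult_distrib)
  next
    case False
    define d where "d = nat (l0 - l)"
    have ld: "l0 = l + int d" using False by (simp add: d_def)
    obtain n where n: "card (cosets (K l) M) = q ^ n" using index_latt_power[OF latt_K assms l] by blast
    have "card (cosets (K l0) M) = card (cosets (K l0) (K l)) * card (cosets (K l) M)"
      by (rule index_latt_mult) (use False l in \<open>auto intro!: latt_K assms K_mono\<close>)
    then have "q ^ n0 = q ^ (2 * d + n)" using n0 n index_K_K[of l d] by (simp add: ld power_add)
    then have "n0 = 2 * d + n" using q_gt_1 by (simp add: power_inject_exp)
    then show ?thesis using ld n by simp
  qed
  show ?thesis
  proof (rule ex1I[of _ "int n0 - 2 * l0"])
    fix e assume "\<forall>l. K l \<subseteq> M \<longrightarrow> 0 \<le> e + 2 * l \<and> card (cosets (K l) M) = q ^ nat (e + 2 * l)"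
    then have "0 \<le> e + 2 * l0" "q ^ nat (e + 2 * l0) = q ^ n0" using l0 n0 by auto
    then have "nat (e + 2 * l0) = n0" using q_gt_1 by (simp add: power_inject_exp)
    then show "e = int n0 - 2 * l0" using \<open>0 \<le> e + 2 * l0\<close> by simp
  qed (use 1 in blast)
qed

lemma vexp:
  assumes "latt M" "K l \<subseteq> M"
  shows "0 \<le> vexp M + 2 * l" "card (cosets (K l) M) = q ^ nat (vexp M + 2 * l)"
  using theI'[OF vexp_aux[OF assms(1)]] assms(2) unfolding vexp_def[symmetric] by auto

lemma vexp_index:
  assumes "latt H" "latt M" "H \<subseteq> M"
  shows "vexp H \<le> vexp M" "card (cosets H M) = q ^ nat (vexp M - vexp H)"
proof -
  obtain l where l: "K l \<subseteq> H" using assms by (auto simp: latt_def)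
  obtain n where n: "card (cosets H M) = q ^ n" using index_latt_power[OF assms] by blast
  have "card (cosets (K l) M) = card (cosets (K l) H) * card (cosets H M)"
    by (rule index_latt_mult) (use l assms latt_K in auto)
  then have "q ^ nat (vexp M + 2 * l) = q ^ (nat (vexp H + 2 * l) + n)"
    using vexp(2)[OF assms(2), of l] vexp(2)[OF assms(1) l] l assms(3) n by (simp add: power_add)
  then have "nat (vexp M + 2 * l) = nat (vexp H + 2 * l) + n" using q_gt_1 by (simp add: power_inject_exp)
  then have "int (nat (vexp M + 2 * l)) = int (nat (vexp H + 2 * l)) + int n" by simp
  moreover have "K l \<subseteq> M" using l assms(3) by blast
  ultimately have "vexp M = vexp H + int n"
    using vexp(1)[OF assms(2), of l] vexp(1)[OF assms(1) l] by simp
  then show "vexp H \<le> vexp M" "card (cosets H M) = q ^ nat (vexp M - vexp H)" using n by auto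
qed

lemma vexp_K: "vexp (K k) = - 2 * k"
proof -
  have "q ^ nat (vexp (K k) + 2 * k) = q ^ 0"
    using vexp(2)[OF latt_K subset_refl, of k] by (simp add: cosets_self subgrp_K)
  then have "nat (vexp (K k) + 2 * k) = 0" using q_gt_1 by (simp add: power_inject_exp)
  then show ?thesis using vexp(1)[OF latt_K subset_refl, of k] by simp
qed

text \<open>This is \<open>dual_index_le\<close> in terms of volumes: from \<open>H\<close> to
  \<open>M\<close> the dual shrinks at most by the factor by which the module grows.\<close>

lemma vexp_perp_mono:
  assumes "latt H" "latt M" "H \<subseteq> M"
  shows "vexp H + vexp (perp H) \<le> vexp M + vexp (perp M)"
proof -
  obtain k where "K k \<subseteq> H" using assms by (auto simp: latt_def)
  then have "card (cosets (perp M) (perp H)) \<le> card (cosets H M)"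
    using dual_index_le[of H M k] assms latt_omod finite_latt by blast
  then have "q ^ nat (vexp (perp H) - vexp (perp M)) \<le> q ^ nat (vexp M - vexp H)"
    using vexp_index(2)[OF assms] vexp_index(2)[of "perp M" "perp H"] assms latt_perp perp_antimono by simp
  then have "nat (vexp (perp H) - vexp (perp M)) \<le> nat (vexp M - vexp H)"
    using q_gt_1 by (simp add: power_increasing_iff)
  then show ?thesis
    using vexp_index(1)[OF assms] by linarith
qed

text \<open>The left-hand side is monotone in \<open>M\<close> and takes the same value at all \<open>K k\<close>.\<close>

lemma vexp_perp: assumes "latt M" shows "vexp M + vexp (perp M) = 2 - 4 * m"
proof -
  have K: "vexp (K k) + vexp (perp (K k)) = 2 - 4 * m" for k
    by (simp add: perp_K vexp_K)
  obtain k l where "M \<subseteq> K k" "K l \<subseteq> M" using assms by (auto simp: latt_def)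
  then show ?thesis
    using vexp_perp_mono[OF assms latt_K, of k] vexp_perp_mono[OF latt_K assms, of l] by (simp add: K)
qed

text \<open>\<open>B\<close> is a finite generating set and may be dependent. The module is bounded
  because \<open>B\<close> is finite, and open because suitable multiples of \<open>1\<close>,
  \<open>i\<close>, \<open>j\<close>, \<open>i * j\<close> lie in it.\<close>

lemma lattice_latt: assumes "lattice absv scale L" shows "latt L"
proof -
  obtain B where B: "finite B" "V.span B = UNIV"
    and L: "L = {\<Sum>b\<in>B. scale (c b) b | c. c ` B \<subseteq> valuation_ring absv}"
    using assms by (auto simp: lattice_def)
  have L_mem: "(\<Sum>b\<in>B. scale (c b) b) \<in> L" if "\<And>b. b \<in> B \<Longrightarrow> c b \<in> pid 0" for c
    using that by (auto simp: L valuation_ring_eq)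
  have L_ex: "\<exists>c. x = (\<Sum>b\<in>B. scale (c b) b) \<and> (\<forall>b\<in>B. c b \<in> pid 0)" if "x \<in> L" for x
    using that by (auto simp: L valuation_ring_eq)
  have om: "omod L" unfolding omod_def subgrp_def
  proof (intro conjI ballI)
    show "0 \<in> L" using L_mem[of "\<lambda>_. 0"] subgrp_zero[OF subgrp_pid] by simp
    show "x - y \<in> L" if xy: "x \<in> L" "y \<in> L" for x y
    proof -
      obtain c d where "x = (\<Sum>b\<in>B. scale (c b) b)" "y = (\<Sum>b\<in>B. scale (d b) b)"
        and "\<forall>b\<in>B. c b \<in> pid 0" "\<forall>b\<in>B. d b \<in> pid 0"
        using L_ex[OF xy(1)] L_ex[OF xy(2)] by blast
      then show ?thesis using L_mem[of "\<lambda>b. c b - d b"]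
        by (simp add: sum_subtractf V.scale_left_diff_distrib subgrp_diff[OF subgrp_pid])
    qed
    show "scale e x \<in> L" if ex: "e \<in> pid 0" "x \<in> L" for e x
    proof -
      obtain c where "x = (\<Sum>b\<in>B. scale (c b) b)" "\<forall>b\<in>B. c b \<in> pid 0" using L_ex[OF ex(2)] by blast
      then show ?thesis using L_mem[of "\<lambda>b. e * c b"] ex(1)
        by (simp add: V.scale_sum_right pid_mult_0)
    qed
  qed
  have "\<exists>k\<ge>0. B \<subseteq> K (- k)"
    using K_exhaust by (intro finite_min_exhaust[OF B(1) _ K_mono]) auto
  then obtain k where k: "B \<subseteq> K (- k)" by blast
  have "L \<subseteq> K (- k)"
  proof
    fix x assume "x \<in> L"
    then obtain c where c: "x = (\<Sum>b\<in>B. scale (c b) b)" "\<forall>b\<in>B. c b \<in> pid 0" using L_ex by blast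
    have "(\<Sum>b\<in>B'. scale (c b) b) \<in> K (- k)" if "B' \<subseteq> B" for B'
      using finite_subset[OF that B(1)] that
    proof (induction B')
      case empty
      then show ?case by (simp add: subgrp_zero[OF subgrp_K])
    next
      case (insert b B')
      have "scale (c b) b \<in> K (2 * 0 + - k)" using insert.prems c(2) k by (intro scale_K) auto
      then show ?case using insert by (simp add: subgrp_add[OF subgrp_K])
    qed
    then show "x \<in> K (- k)" using c(1) by simp
  qed
  moreover have "\<exists>l. K l \<subseteq> L"
  proof -
    have "\<exists>n. scale (unif powi n) y \<in> L" for y
    proof -
      have "y \<in> V.span B" using B by simp
      then obtain u where u: "y = (\<Sum>b\<in>B. scale (u b) b)" using V.span_finite[OF B(1)] by auto
      have "\<exists>k\<ge>0. u ` B \<subseteq> pid (- k)"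
        using pid_exhaust B(1) by (intro finite_min_exhaust[OF _ _ pid_mono]) auto
      then obtain k where k: "u ` B \<subseteq> pid (- k)" by blast
      have "unif powi k * u b \<in> pid 0" if "b \<in> B" for b
        using unif_powi_mult_pid[of k "u b" "- k"] k that by auto
      then have "(\<Sum>b\<in>B. scale (unif powi k * u b) b) \<in> L" by (rule L_mem)
      then have "scale (unif powi k) y \<in> L" by (simp add: u V.scale_sum_right)
      then show ?thesis ..
    qed
    then obtain f where f: "\<And>y. scale (unif powi f y) y \<in> L" by metis
    define n where "n = max (max (f 1) (f i)) (max (f j) (f (i * j)))"
    have sc: "scale t y \<in> L" if "t \<in> pid n" "f y \<le> n" for t y
    proof -
      have "t / unif powi f y \<in> pid 0"
        using unif_powi_mult_pid[of "f y" "t / unif powi f y" 0] subsetD[OF pid_mono[OF that(2)] that(1)] by simp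
      then have "scale (t / unif powi f y) (scale (unif powi f y) y) \<in> L" using omod_scale[OF om] f by blast
      then show ?thesis by simp
    qed
    have "E n \<subseteq> L"
    proof
      fix x assume "x \<in> E n"
      then obtain t u v w where x: "x = q4 t u v w" "t \<in> pid n" "u \<in> pid n" "v \<in> pid n" "w \<in> pid n"
        by (auto simp: E_def)
      show "x \<in> L" unfolding x(1) q4_def using x
        by (intro subgrp_add[OF omod_subgrp[OF om]] sc) (auto simp: n_def)
    qed
    moreover obtain r where "\<And>k. K (2 * k) \<subseteq> E (k - r)" using E_K_compare by blast
    then have "K (2 * (n + r)) \<subseteq> E n" by (metis add_diff_cancel_right')
    ultimately show ?thesis by blast
  qed
  ultimately show ?thesis using om by (auto simp: latt_def)
qed

text \<open>The exponent is the logarithm of the volume of \<open>perp L\<close> divided by that of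
  \<open>L\<close>, and \<open>vexp_perp\<close> eliminates the dual. \<open>D\<close> stands for
  the dual lattice in the space of functionals.\<close>

lemma modulus_exponent_eq:
  assumes L: "latt L" and \<nu>: "\<nu> ` D = perp L"
  shows "modulus_exponent q \<nu> D L = 2 - 4 * m - 2 * vexp L"
proof -
  let ?P = "perp L" and ?I = "perp L \<inter> L"
  have P: "latt ?P" and I: "latt ?I" using L latt_perp latt_Int by auto
  have "real q powi a = real (subgroup_index ?P ?I) / real (subgroup_index L ?I) \<longleftrightarrow> a = vexp ?P - vexp L" for a
  proof -
    have "real (subgroup_index ?P ?I) = real q powi (vexp ?P - vexp ?I)"
      "real (subgroup_index L ?I) = real q powi (vexp L - vexp ?I)"
      using vexp_index[OF I P] vexp_index[OF I L] by (auto simp: subgroup_index_cosets power_int_def)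
    then have "real (subgroup_index ?P ?I) / real (subgroup_index L ?I) = real q powi (vexp ?P - vexp L)"
      using q_gt_1 by (simp add: power_int_diff[symmetric])
    moreover have "real q powi a = real q powi b \<longleftrightarrow> a = b" for a b
      using power_int_strict_increasing[of a b "real q"] power_int_strict_increasing[of b a "real q"] q_gt_1
      by (cases a b rule: linorder_cases) auto
    ultimately show ?thesis by simp
  qed
  then have "modulus_exponent q \<nu> D L = vexp ?P - vexp L"
    by (simp add: modulus_exponent_def \<nu>)
  then show ?thesis using vexp_perp[OF L] by simp
qed

end

section \<open>Topology and Haar measure\<close>

context quaternion_basis
begin

abbreviation "XT \<equiv> canonical_topology absv scale"

text \<open>The coordinate functionals, written so that membership in \<open>dual_space\<close> is
  immediate.\<close>

definition cofun :: "nat \<Rightarrow> 'a \<Rightarrow> 'f" where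
  "cofun n = bil (if n = 0 then q4 (1 / 2) 0 0 0 else if n = 1 then q4 0 (- 1 / (2 * a)) 0 0
    else if n = 2 then q4 0 0 (- 1 / (2 * b)) 0 else q4 0 0 0 (1 / (2 * a * b)))"

lemma cofun_q4: "cofun 0 (q4 t u v w) = t" "cofun (Suc 0) (q4 t u v w) = u"
  "cofun 2 (q4 t u v w) = v" "cofun 3 (q4 t u v w) = w"
  by (simp_all add: cofun_def bil_q4)

lemma openin_pid: "openin (field_topology absv) {c. c - d \<in> pid k}"
  unfolding openin_field
proof (intro ballI exI conjI allI impI)
  fix c c' assume c: "c \<in> {c. c - d \<in> pid k}" and "absv (c' - c) < absv unif powi k"
  then have "c' - c \<in> pid k" by (simp add: pid_mem)
  then show "c' \<in> {c. c - d \<in> pid k}" using c subgrp_diff_trans[OF subgrp_pid] by blast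
qed simp

lemma exists_pid_ball: assumes "r > 0" shows "\<exists>k. \<forall>c\<in>pid k. absv c < r"
proof -
  obtain x where x: "x \<noteq> 0" "absv x < r" using exists_small[OF assms] by blast
  then show ?thesis using absv_val[OF x(1)] by (intro exI[of _ "val x"]) (auto simp: pid_mem)
qed

lemma bil_continuous: "\<exists>k. \<forall>h\<in>K k. bil z h \<in> pid n"
proof -
  obtain l where l: "z \<in> K l" using K_exhaust by blast
  have "bil z h \<in> pid n" if "h \<in> K (2 * n - 1 - l)" for h
  proof -
    have "z * conj h \<in> K (l + (2 * n - 1 - l))" using l that by (intro K_mult) simp_all
    then show ?thesis unfolding bil_def by (intro tr_K) simp
  qed
  then show ?thesis by blast
qed

text \<open>The \<open>K k\<close> are a neighbourhood basis of 0. Every functional is some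
  \<open>bil z\<close>, which is small on small \<open>K k\<close>; conversely, four coordinate
  conditions confine \<open>y - x\<close> to \<open>E n\<close>, and \<open>E n\<close> lies in
  \<open>K k\<close> for large \<open>n\<close>.\<close>

lemma openin_canon: "openin XT U \<longleftrightarrow> (\<forall>x\<in>U. \<exists>k. \<forall>h\<in>K k. x + h \<in> U)"
proof
  assume "openin XT U"
  then have "generate_topology_on {l -` U | l U. l \<in> dual_space scale \<and> openin (field_topology absv) U} U"
    by (simp add: canonical_topology_def openin_topology_generated_by_iff)
  then show "\<forall>x\<in>U. \<exists>k. \<forall>h\<in>K k. x + h \<in> U"
  proof (induction rule: generate_topology_on.induct)
    case (Int A B)
    show ?case
    proof
      fix x assume "x \<in> A \<inter> B"
      then obtain k l where "\<forall>h\<in>K k. x + h \<in> A" "\<forall>h\<in>K l. x + h \<in> B" using Int by blast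
      then show "\<exists>k. \<forall>h\<in>K k. x + h \<in> A \<inter> B"
        using K_mono[of k "max k l"] K_mono[of l "max k l"] by (intro exI[of _ "max k l"]) auto
    qed
  next
    case (UN \<U>)
    then show ?case by (meson UnionE UnionI)
  next
    case (Basis S)
    then obtain l V where S: "S = l -` V" and l: "l \<in> dual_space scale" and V: "openin (field_topology absv) V"
      by blast
    obtain z where z: "l = bil z" using bil_surj[OF l] by blast
    show ?case
    proof
      fix x assume "x \<in> S"
      then have "l x \<in> V" by (simp add: S)
      then obtain r where r: "r > 0" "\<And>y. absv (y - l x) < r \<Longrightarrow> y \<in> V"
        using bspec[OF V[unfolded openin_field]] by blast
      obtain n where n: "\<forall>c\<in>pid n. absv c < r" using exists_pid_ball[OF r(1)] by blast
      obtain k where k: "\<forall>h\<in>K k. bil z h \<in> pid n" using bil_continuous by blast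
      have "x + h \<in> S" if "h \<in> K k" for h
        using r(2)[of "l (x + h)"] n k that by (simp add: S z bil_add_right)
      then show "\<exists>k. \<forall>h\<in>K k. x + h \<in> S" by blast
    qed
  qed auto
next
  assume U: "\<forall>x\<in>U. \<exists>k. \<forall>h\<in>K k. x + h \<in> U"
  have basis: "openin XT (l -` V)" if "l \<in> dual_space scale" "openin (field_topology absv) V" for l V
    unfolding canonical_topology_def using that by (intro topology_generated_by_Basis) blast
  show "openin XT U"
  proof (subst openin_subopen, intro ballI)
    fix x assume "x \<in> U"
    then obtain k where k: "\<And>h. h \<in> K k \<Longrightarrow> x + h \<in> U" using U by blast
    obtain n where n: "E n \<subseteq> K k" using K_sub_E by blast
    define W where "W c = cofun c -` {d. d - cofun c x \<in> pid n}" for c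
    have "cofun c \<in> dual_space scale" for c unfolding cofun_def by (rule bil_dual)
    then have W: "openin XT (W c)" for c unfolding W_def by (intro basis openin_pid)
    have "y \<in> U" if "y \<in> W 0 \<inter> W (Suc 0) \<inter> (W 2 \<inter> W 3)" for y
    proof -
      have "y - x \<in> E n" if "y \<in> W 0 \<inter> W (Suc 0) \<inter> (W 2 \<inter> W 3)"
        using that unfolding W_def E_box
        by (rule_tac q4_cases[of x], rule_tac q4_cases[of y]) (simp add: cofun_q4 q4_diff q4_box)
      then show ?thesis using that n k[of "y - x"] by auto
    qed
    moreover have "x \<in> W c" for c by (simp add: W_def subgrp_zero[OF subgrp_pid])
    moreover have "openin XT (W 0 \<inter> W (Suc 0) \<inter> (W 2 \<inter> W 3))" by (intro openin_Int W)
    ultimately show "\<exists>T. openin XT T \<and> x \<in> T \<and> T \<subseteq> U" by blast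
  qed
qed

lemma topspace_canon [simp]: "topspace XT = UNIV"
  using openin_subset[of XT UNIV] openin_canon[of UNIV] by auto

lemma openin_coset: "openin XT ((+) x ` K k)"
  unfolding openin_canon using stable_coset[OF subgrp_K subset_refl] unfolding stable_def by blast

text \<open>The set is a continuous image of the product of \<open>S\<close> with a compact ball of
  the field. Four applications, starting from \<open>{0}\<close>, give \<open>E n\<close>.\<close>

lemma compactin_adjoin:
  assumes "compactin XT S" shows "compactin XT {x + scale c e | x c. x \<in> S \<and> c \<in> pid n}"
proof -
  let ?f = "\<lambda>(x, c). x + scale c e"
  have "continuous_map (prod_topology XT (field_topology absv)) XT ?f"
    unfolding continuous_map_def
  proof (intro conjI allI impI)
    fix U assume U: "openin XT U"
    show "openin (prod_topology XT (field_topology absv))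
      {p \<in> topspace (prod_topology XT (field_topology absv)). ?f p \<in> U}"
      unfolding openin_prod_topology_alt
    proof (intro allI impI)
      fix x c assume "(x, c) \<in> {p \<in> topspace (prod_topology XT (field_topology absv)). ?f p \<in> U}"
      then have "x + scale c e \<in> U" by simp
      then obtain k where k: "\<And>h. h \<in> K k \<Longrightarrow> x + scale c e + h \<in> U" using U[unfolded openin_canon] by blast
      obtain l where l: "e \<in> K l" using K_exhaust by blast
      have "\<exists>r. k \<le> 2 * r + l" by presburger
      then obtain r where kr: "k \<le> 2 * r + l" by blast
      have r: "scale d e \<in> K k" if "d \<in> pid r" for d
        using scale_K[OF that l] K_mono[OF kr] by blast
      have "?f (y, d) \<in> U" if "y \<in> (+) x ` K k" "d - c \<in> pid r" for y d
      proof -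
        have "(y - x) + scale (d - c) e \<in> K k"
          using that r by (intro subgrp_add[OF subgrp_K]) (auto simp: mem_coset_iff)
        from k[OF this] show ?thesis by (simp add: V.scale_left_diff_distrib algebra_simps)
      qed
      then show "\<exists>V W. openin XT V \<and> openin (field_topology absv) W \<and> x \<in> V \<and> c \<in> W \<and>
        V \<times> W \<subseteq> {p \<in> topspace (prod_topology XT (field_topology absv)). ?f p \<in> U}"
        using openin_coset[of x k] openin_pid[of c r] subgrp_zero[OF subgrp_K] subgrp_zero[OF subgrp_pid]
        by (intro exI[of _ "(+) x ` K k"] exI[of _ "{d. d - c \<in> pid r}"]) (auto simp: mem_coset_iff)
    qed
  qed auto
  moreover have "compactin (prod_topology XT (field_topology absv)) (S \<times> pid n)"
    using assms compactin_le by (auto simp: compactin_Times pid_def)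
  ultimately have "compactin XT (?f ` (S \<times> pid n))" using image_compactin by blast
  moreover have "?f ` (S \<times> pid n) = {x + scale c e | x c. x \<in> S \<and> c \<in> pid n}" by force
  ultimately show ?thesis by simp
qed

lemma compactin_E: "compactin XT (E n)"
proof -
  define A where "A e S = {x + scale c e | x c. x \<in> S \<and> c \<in> pid n}" for e S
  have "compactin XT (A (i * j) (A j (A i (A 1 {0}))))"
    unfolding A_def by (intro compactin_adjoin) simp
  moreover have "A (i * j) (A j (A i (A 1 {0}))) = E n"
  proof (intro equalityI subsetI)
    fix x assume "x \<in> A (i * j) (A j (A i (A 1 {0})))"
    then obtain t u v w where "t \<in> pid n" "u \<in> pid n" "v \<in> pid n" "w \<in> pid n"
      "x = 0 + scale t 1 + scale u i + scale v j + scale w (i * j)"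
      unfolding A_def by blast
    then show "x \<in> E n" unfolding E_def q4_def by auto
  next
    fix x assume "x \<in> E n"
    then obtain t u v w where *: "t \<in> pid n" "u \<in> pid n" "v \<in> pid n" "w \<in> pid n"
      "x = 0 + scale t 1 + scale u i + scale v j + scale w (i * j)"
      unfolding E_def q4_def by auto
    then show "x \<in> A (i * j) (A j (A i (A 1 {0})))" unfolding A_def by blast
  qed
  ultimately show ?thesis by simp
qed

lemma closedin_K: "closedin XT (K k)"
proof -
  have "openin XT (UNIV - K k)"
    unfolding openin_canon
  proof (intro ballI exI)
    show "x + h \<in> UNIV - K k" if "x \<in> UNIV - K k" "h \<in> K k" for x h
      using that subgrp_diff[OF subgrp_K, of "x + h" k h] by auto
  qed
  then show ?thesis by (simp add: closedin_def)
qed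

lemma compactin_K: "compactin XT (K k)"
proof -
  obtain m where m: "\<And>k. K (2 * k) \<subseteq> E (k - m)" using E_K_compare by blast
  have "2 * (- \<bar>k\<bar>) \<le> k" by linarith
  then have "K k \<subseteq> E (- \<bar>k\<bar> - m)" using m K_mono by blast
  then show ?thesis by (rule closed_compactin[OF compactin_E _ closedin_K])
qed

text \<open>A quantitative form of membership in the Schwartz space: it turns integrals into sums
  over \<open>K k\<close> modulo \<open>K l\<close>.\<close>

definition sch :: "int \<Rightarrow> int \<Rightarrow> ('a \<Rightarrow> 'r::idom) \<Rightarrow> bool" where
  "sch k l \<Phi> \<longleftrightarrow> (\<forall>x. \<Phi> x \<noteq> 0 \<longrightarrow> x \<in> K k) \<and> (\<forall>x. \<forall>h\<in>K l. \<Phi> (x + h) = \<Phi> x)"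

lemma sch_supp: "sch k l \<Phi> \<Longrightarrow> \<Phi> x \<noteq> 0 \<Longrightarrow> x \<in> K k" and sch_inv: "sch k l \<Phi> \<Longrightarrow> h \<in> K l \<Longrightarrow> \<Phi> (x + h) = \<Phi> x"
  by (auto simp: sch_def)

lemma sch_mono: "sch k l \<Phi> \<Longrightarrow> k' \<le> k \<Longrightarrow> l \<le> l' \<Longrightarrow> sch k' l' \<Phi>"
  unfolding sch_def using K_mono[of k' k] K_mono[of l l'] by blast

lemma sch_invar: "sch k l \<Phi> \<Longrightarrow> invar (K l) S \<Phi>"
  unfolding invar_def by (metis diff_add_cancel add.commute sch_inv)

text \<open>Compactness of the support is used twice: a cover by sets \<open>K n\<close> bounds the
  support, and a cover by cosets on which \<open>\<Phi>\<close> is constant gives a uniform level of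
  invariance.\<close>

lemma schwartz_iff: "\<Phi> \<in> schwartz_space absv scale \<longleftrightarrow> (\<exists>k l. sch k l \<Phi>)"
proof
  assume "\<exists>k l. sch k l \<Phi>"
  then obtain k l where s: "sch k l \<Phi>" by blast
  have "\<exists>U. openin XT U \<and> x \<in> U \<and> (\<forall>y\<in>U. \<Phi> y = \<Phi> x)" for x
    using openin_coset[of x l] sch_inv[OF s] subgrp_zero[OF subgrp_K, of l]
    by (intro exI[of _ "(+) x ` K l"]) (auto simp: mem_coset_iff)
  moreover have "XT closure_of {x. \<Phi> x \<noteq> 0} \<subseteq> K k"
    by (rule closure_of_minimal[OF _ closedin_K]) (use sch_supp[OF s] in auto)
  then have "compactin XT (XT closure_of {x. \<Phi> x \<noteq> 0})"
    by (rule closed_compactin[OF compactin_K]) (rule closedin_closure_of)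
  ultimately show "\<Phi> \<in> schwartz_space absv scale" by (simp add: schwartz_space_def)
next
  assume "\<Phi> \<in> schwartz_space absv scale"
  then have loc: "\<And>x. \<exists>U. openin XT U \<and> x \<in> U \<and> (\<forall>y\<in>U. \<Phi> y = \<Phi> x)"
    and comp: "compactin XT (XT closure_of {x. \<Phi> x \<noteq> 0})" (is "compactin XT ?C")
    by (auto simp: schwartz_space_def)
  have supp: "x \<in> ?C" if "\<Phi> x \<noteq> 0" for x
    using closure_of_subset[of "{x. \<Phi> x \<noteq> 0}" XT] that by auto
  have cover: "\<exists>\<F>. finite \<F> \<and> \<F> \<subseteq> \<U> \<and> ?C \<subseteq> \<Union> \<F>" if "\<And>U. U \<in> \<U> \<Longrightarrow> openin XT U" "?C \<subseteq> \<Union> \<U>" for \<U>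
    using comp that unfolding compactin_def by blast
  have "\<exists>\<F>. finite \<F> \<and> \<F> \<subseteq> range K \<and> ?C \<subseteq> \<Union> \<F>"
  proof (rule cover)
    show "openin XT U" if "U \<in> range K" for U using that openin_coset[of 0] by auto
    show "?C \<subseteq> \<Union> (range K)" using K_exhaust by auto
  qed
  then obtain \<F> where \<F>: "finite \<F>" "\<F> \<subseteq> range K" "?C \<subseteq> \<Union> \<F>" by blast
  obtain I where I: "finite I" "\<F> = K ` I" using finite_subset_image[OF \<F>(1,2)] by blast
  define k where "k = Min (insert 0 I)"
  have k: "?C \<subseteq> K k"
  proof
    fix x assume "x \<in> ?C"
    then obtain n where n: "n \<in> I" "x \<in> K n" using \<F>(3) I(2) by blast
    then have "k \<le> n" unfolding k_def using I(1) by (intro Min_le) auto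
    then show "x \<in> K k" using n K_mono by blast
  qed
  define P where "P = (\<lambda>p. \<forall>h\<in>K (snd p). \<Phi> (fst p + h) = \<Phi> (fst p))"
  define N where "N = (\<lambda>p :: 'a \<times> int. (+) (fst p) ` K (snd p))"
  have "\<exists>\<F>. finite \<F> \<and> \<F> \<subseteq> N ` {p. P p} \<and> ?C \<subseteq> \<Union> \<F>"
  proof (rule cover)
    show "openin XT U" if "U \<in> N ` {p. P p}" for U using that openin_coset by (auto simp: N_def)
    have "x \<in> \<Union> (N ` {p. P p})" for x
    proof -
      obtain U where U: "openin XT U" "x \<in> U" "\<forall>y\<in>U. \<Phi> y = \<Phi> x" using loc by blast
      then obtain l where "\<forall>h\<in>K l. x + h \<in> U" unfolding openin_canon by blast
      then have "P (x, l)" using U(3) by (simp add: P_def)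
      moreover have "x \<in> N (x, l)" by (simp add: N_def mem_coset_iff subgrp_zero[OF subgrp_K])
      ultimately show ?thesis by blast
    qed
    then show "?C \<subseteq> \<Union> (N ` {p. P p})" by blast
  qed
  then obtain \<G> where \<G>: "finite \<G>" "\<G> \<subseteq> N ` {p. P p}" "?C \<subseteq> \<Union> \<G>" by blast
  obtain J where J: "finite J" "J \<subseteq> {p. P p}" "\<G> = N ` J" using finite_subset_image[OF \<G>(1,2)] by blast
  define l where "l = Max (insert 0 (snd ` J))"
  have inC: "\<Phi> (x + h) = \<Phi> x" if x: "x \<in> ?C" and h: "h \<in> K l" for x h
  proof -
    obtain p where p: "p \<in> J" "x \<in> N p" using x \<G>(3) J(3) by blast
    have "snd p \<le> l" unfolding l_def using J(1) p by (intro Max_ge) auto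
    then have h': "h \<in> K (snd p)" using h K_mono by blast
    have 1: "x - fst p \<in> K (snd p)" using p(2) by (simp add: N_def mem_coset_iff)
    then have 2: "x - fst p + h \<in> K (snd p)" using h' by (rule subgrp_add[OF subgrp_K])
    have "P p" using p J(2) by blast
    then have "\<Phi> (fst p + (x - fst p)) = \<Phi> (fst p)" "\<Phi> (fst p + (x - fst p + h)) = \<Phi> (fst p)"
      unfolding P_def using 1 2 by blast+
    then show ?thesis by (simp add: algebra_simps)
  qed
  have "\<Phi> (x + h) = \<Phi> x" if h: "h \<in> K l" for x h
  \<comment> \<open>The argument starts from whichever of the two points lies in \<open>?C\<close>;
    if neither does, both values are 0.\<close>
  proof (cases "x \<in> ?C \<or> x + h \<in> ?C")
    case True
    then show ?thesis using inC[of x h] inC[of "x + h" "- h"] h subgrp_minus[OF subgrp_K h] by auto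
  next
    case False
    then have "\<Phi> x = 0" "\<Phi> (x + h) = 0" using supp by blast+
    then show ?thesis by simp
  qed
  moreover have "x \<in> K k" if "\<Phi> x \<noteq> 0" for x using supp[OF that] k by blast
  ultimately show "\<exists>k l. sch k l \<Phi>" unfolding sch_def by blast
qed

end

locale weil_setting = quaternion_character absv scale a b i j \<psi> m
  for absv :: "'f::field \<Rightarrow> real" and scale :: "'f \<Rightarrow> 'a::division_ring \<Rightarrow> 'a" and a b i j
    and \<psi> :: "'f \<Rightarrow> 'r::idom" and m +
  fixes sq :: 'r and L :: "'a set"
  assumes sq2: "sq\<^sup>2 = of_nat (residue_card absv)"
    and sq_unit: "sq dvd 1"
    and latt_L: "latt L"
begin

section \<open>Powers of the square root of \<open>q\<close>\<close>

abbreviation "up \<equiv> unit_powi sq"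

lemma up_inverse: "\<exists>v. sq * v = 1 \<and> (\<forall>k. up k = (if k \<ge> 0 then sq ^ nat k else v ^ nat (- k)))"
proof -
  obtain v where v: "sq * v = 1" using sq_unit by (metis dvdE)
  then have "sq \<noteq> 0" by auto
  then have "(THE v. sq * v = 1) = v" using v by (intro the_equality) (auto simp: v[symmetric])
  then show ?thesis using v by (auto simp: unit_powi_def)
qed

lemma up_Suc: "up (k + 1) = up k * sq"
proof -
  obtain v where v: "sq * v = 1" and up: "\<And>k. up k = (if k \<ge> 0 then sq ^ nat k else v ^ nat (- k))"
    using up_inverse by blast
  show ?thesis
  proof (cases "k \<ge> 0")
    case True
    then show ?thesis by (simp add: up nat_add_distrib mult.commute)
  next
    case False
    define n where "n = nat (- k - 1)"
    have k: "k = - int (Suc n)" using False by (simp add: n_def)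
    have "v ^ Suc n * sq = v ^ n" using v by (simp add: mult.assoc mult.commute[of v sq])
    then show ?thesis by (cases "n = 0") (simp_all add: k up nat_add_distrib)
  qed
qed

lemma up_0 [simp]: "up 0 = 1"
  by (simp add: unit_powi_def)

lemma up_add_nat: "up (k + int n) = up k * sq ^ n"
proof (induction n)
  case (Suc n)
  then show ?case using up_Suc[of "k + int n"] by (simp add: ac_simps)
qed simp

lemma up_nat: "up (int n) = sq ^ n"
  using up_add_nat[of 0 n] by simp

lemma sq_nz [simp]: "sq \<noteq> 0"
  using sq_unit by auto

lemma up_add: "up (k + l) = up k * up l"
proof (cases "l \<ge> 0")
  case True
  then show ?thesis using up_add_nat[of k "nat l"] up_nat[of "nat l"] by simp
next
  case False
  define n where "n = nat (- l)"
  have l: "l = - int n" using False by (simp add: n_def)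
  have "up (k + l) * sq ^ n = up k" "up l * sq ^ n = 1"
    using up_add_nat[of "k + l" n] up_add_nat[of l n] by (simp_all add: l)
  then have "up (k + l) * sq ^ n = up k * up l * sq ^ n" by (simp add: mult.assoc)
  then show ?thesis by simp
qed

lemma up_nz [simp]: "up k \<noteq> 0"
  using up_add[of k "- k"] by auto

lemma up_q: "up (2 * int n) = of_nat (q ^ n)"
  using up_nat[of "2 * n"] sq2 by (simp add: power_mult)

lemma card_up: assumes "latt H" "latt M" "H \<subseteq> M"
  shows "of_nat (card (cosets H M)) = up (2 * (vexp M - vexp H))"
  using vexp_index[OF assms] up_q[of "nat (vexp M - vexp H)"] by simp

lemma card_up_K: "k \<le> l \<Longrightarrow> of_nat (card (cosets (K l) (K k))) = up (4 * l - 4 * k)"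
  using card_up[OF latt_K latt_K K_mono, of k l] by (simp add: vexp_K algebra_simps)

text \<open>When \<open>K 0\<close> has volume 1, \<open>K l\<close> has volume
  \<open>q powi (- 2 * l)\<close>, that is \<open>up (- 4 * l)\<close>. With this weight the sum is
  the same at all sufficiently fine levels.\<close>

lemma csum_sch_refine:
  assumes s: "sch k l (\<Phi> :: 'a \<Rightarrow> 'r)" and "k' \<le> k" "k \<le> l" "l \<le> l'"
  shows "up (- 4 * l') * csum (K l') (K k') \<Phi> = up (- 4 * l) * csum (K l) (K k) \<Phi>"
proof -
  have "csum (K l') (K k') \<Phi> = csum (K l') (K k) \<Phi> + csum (K l') (K k' - K k) \<Phi>"
    by (rule csum_union[OF subgrp_K stable_K K_mono stable_K finite_K]) (use assms in auto)
  also have "csum (K l') (K k' - K k) \<Phi> = 0"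
    by (rule csum_zero[OF subgrp_K stable_Diff[OF subgrp_K stable_K stable_K]])
      (use assms sch_supp[OF s] in auto)
  also have "csum (K l') (K k) \<Phi> + 0 = up (4 * l' - 4 * l) * csum (K l) (K k) \<Phi>"
    using csum_refine_invar[OF subgrp_K subgrp_K K_mono stable_K finite_K sch_invar[OF s], of l' k] assms card_up_K[of l l']
    by simp
  finally have "up (- 4 * l') * csum (K l') (K k') \<Phi> = up (- 4 * l' + (4 * l' - 4 * l)) * csum (K l) (K k) \<Phi>"
    by (simp only: up_add mult.assoc)
  then show ?thesis by simp
qed

lemma sch_add:
  assumes s: "sch k l (\<Phi> :: 'a \<Rightarrow> 'r)" "sch k l \<Psi>" shows "sch k l (\<lambda>x. \<Phi> x + \<Psi> x)"
proof -
  have "x \<in> K k" if "\<Phi> x + \<Psi> x \<noteq> 0" for x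
    using that sch_supp[OF s(1), of x] sch_supp[OF s(2), of x] by (cases "\<Phi> x = 0") auto
  then show ?thesis using s unfolding sch_def by auto
qed

text \<open>\<open>\<Phi>\<close> is a finite combination of indicators of cosets of
  \<open>K l\<close>, all of which have the same measure.\<close>

lemma haar_measure_sch:
  assumes \<mu>: "haar_measure absv scale (\<mu> :: ('a \<Rightarrow> 'r) \<Rightarrow> 'r)" and s: "sch k l \<Phi>"
  shows "\<mu> \<Phi> = csum (K l) (K k) \<Phi> * \<mu> (indicator (K l))"
proof -
  let ?S = "schwartz_space absv scale :: ('a \<Rightarrow> 'r) set"
  have add: "\<mu> (\<lambda>x. \<Phi> x + \<Psi> x) = \<mu> \<Phi> + \<mu> \<Psi>" and mult: "\<mu> (\<lambda>x. c * \<Phi> x) = c * \<mu> \<Phi>"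
    and trans: "\<mu> (\<lambda>x. \<Phi> (x + a)) = \<mu> \<Phi>" if "\<Phi> \<in> ?S" "\<Psi> \<in> ?S" for \<Phi> \<Psi> a c
    using \<mu> that by (auto simp: haar_measure_def)
  have ind: "indicator ((+) x ` K l) \<in> ?S" for x :: 'a
  proof -
    obtain n where "x \<in> K n" using K_exhaust by blast
    then have "(+) x ` K l \<subseteq> K (min n l)"
      using K_mono[of "min n l" n] K_mono[of "min n l" l] by (auto intro!: subgrp_add[OF subgrp_K])
    moreover have "y + h \<in> (+) x ` K l \<longleftrightarrow> y \<in> (+) x ` K l" if "h \<in> K l" for y h
      unfolding mem_coset_iff
      using subgrp_add[OF subgrp_K _ that, of "y - x"] subgrp_diff[OF subgrp_K _ that, of "y + h - x"]
      by (auto simp: diff_add_eq)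
    ultimately have "sch (min n l) l (indicator ((+) x ` K l) :: 'a \<Rightarrow> 'r)"
      unfolding sch_def by (auto simp: indicator_def)
    then show ?thesis using schwartz_iff by blast
  qed
  have \<mu>ind: "\<mu> (indicator ((+) x ` K l)) = \<mu> (indicator (K l))" for x
  proof -
    have "(\<lambda>y. indicator (K l) (y + (- x))) = (indicator ((+) x ` K l) :: 'a \<Rightarrow> 'r)"
      by (auto simp: fun_eq_iff indicator_def mem_coset_iff)
    then show ?thesis using trans[of "indicator (K l)" _ "- x"] ind[of 0] by (metis image_add_0)
  qed
  define f where "f C = \<Phi> (SOME x. x \<in> C)" for C
  have *: "(\<lambda>x. \<Sum>C\<in>\<C>. f C * indicator C x) \<in> ?S \<and>
      \<mu> (\<lambda>x. \<Sum>C\<in>\<C>. f C * indicator C x) = (\<Sum>C\<in>\<C>. f C) * \<mu> (indicator (K l))"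
    if "finite \<C>" "\<C> \<subseteq> cosets (K l) (K k)" for \<C>
    using that
  proof (induction \<C>)
    case empty
    have "(\<lambda>x. 0) \<in> ?S" using schwartz_iff[of "\<lambda>x. 0 :: 'r"] by (auto simp: sch_def)
    then show ?case using mult[of "\<lambda>x. 0" "\<lambda>x. 0" 0] by simp
  next
    case (insert C \<C>)
    obtain x where C: "C = (+) x ` K l" using insert.prems by (auto simp: cosets_def)
    have g: "(\<lambda>x. f C * indicator C x) \<in> ?S"
    proof -
      obtain k' l' where s': "sch k' l' (indicator C :: 'a \<Rightarrow> 'r)" using ind[of x] schwartz_iff C by blast
      have "sch k' l' (\<lambda>x. f C * indicator C x)"
        unfolding sch_def using sch_supp[OF s'] sch_inv[OF s'] by auto
      then show ?thesis using schwartz_iff by blast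
    qed
    have IH: "(\<lambda>x. \<Sum>C\<in>\<C>. f C * indicator C x) \<in> ?S"
      "\<mu> (\<lambda>x. \<Sum>C\<in>\<C>. f C * indicator C x) = (\<Sum>C\<in>\<C>. f C) * \<mu> (indicator (K l))"
      using insert by auto
    have "(\<lambda>x. f C * indicator C x + (\<Sum>C\<in>\<C>. f C * indicator C x)) \<in> ?S"
    proof -
      obtain k1 l1 where 1: "sch k1 l1 (\<lambda>x. f C * indicator C x)" using g schwartz_iff by blast
      obtain k2 l2 where 2: "sch k2 l2 (\<lambda>x. \<Sum>C\<in>\<C>. f C * indicator C x)" using IH schwartz_iff by blast
      have "sch (min k1 k2) (max l1 l2) (\<lambda>x. f C * indicator C x)"
        "sch (min k1 k2) (max l1 l2) (\<lambda>x. \<Sum>C\<in>\<C>. f C * indicator C x)"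
        using sch_mono[OF 1, of "min k1 k2" "max l1 l2"] sch_mono[OF 2, of "min k1 k2" "max l1 l2"] by auto
      then have "sch (min k1 k2) (max l1 l2) (\<lambda>x. f C * indicator C x + (\<Sum>C\<in>\<C>. f C * indicator C x))"
        by (rule sch_add)
      then show ?thesis using schwartz_iff by blast
    qed
    moreover have "\<mu> (\<lambda>x. f C * indicator C x) = f C * \<mu> (indicator (K l))"
      using mult[of "indicator C" "indicator C" "f C"] ind[of x] \<mu>ind[of x] C by simp
    moreover note add[OF g IH(1)] IH(2)
    ultimately show ?case unfolding sum.insert[OF insert.hyps] distrib_right by (simp only: simp_thms)
  qed
  have "\<Phi> x = (\<Sum>C\<in>cosets (K l) (K k). f C * indicator C x)" for x
  proof -
    define D where "D = (+) x ` K l"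
    have ind0: "indicator C x = (if C = D then 1 else 0 :: 'r)" if C: "C \<in> cosets (K l) (K k)" for C
    proof -
      obtain y where "C = (+) y ` K l" using C by (auto simp: cosets_def)
      then show ?thesis unfolding D_def using coset_eq_iff[OF subgrp_K, of y l x] subgrp_diff_commute[OF subgrp_K, of x y l]
        by (auto simp: indicator_def mem_coset_iff)
    qed
    have fD: "f D = \<Phi> x"
      using sch_inv[OF s, of "(SOME z. z \<in> D) - x" x] some_coset[OF subgrp_K, of x l] by (simp add: f_def D_def)
    have "(\<Sum>C\<in>cosets (K l) (K k). f C * indicator C x) = (\<Sum>C\<in>cosets (K l) (K k). if C = D then \<Phi> x else 0)"
      by (rule sum.cong) (auto simp: ind0 fD)
    also have "\<dots> = (if D \<in> cosets (K l) (K k) then \<Phi> x else 0)" using finite_K by simp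
    also have "\<dots> = \<Phi> x"
    proof (cases "x \<in> K k")
      case True
      then show ?thesis by (simp add: D_def cosets_def)
    next
      case False
      then show ?thesis using sch_supp[OF s] by auto
    qed
    finally show ?thesis by simp
  qed
  then have "\<Phi> = (\<lambda>x. \<Sum>C\<in>cosets (K l) (K k). f C * indicator C x)" by blast
  then show ?thesis using *[OF finite_K subset_refl] by (simp add: csum_def f_def)
qed

text \<open>The weight is the volume of \<open>K l\<close> when \<open>L\<close> has volume 1. By
  \<open>integ_eq\<close> the choice of \<open>k\<close> and \<open>l\<close> does not matter; the
  value \<open>undefined\<close> is what \<open>extensional\<close> demands outside the Schwartz
  space.\<close>

definition integ :: "('a \<Rightarrow> 'r) \<Rightarrow> 'r" where
  "integ \<Phi> = (if \<Phi> \<in> schwartz_space absv scale then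
     (let (k, l) = (SOME (k, l). k \<le> l \<and> sch k l \<Phi>) in up (- 2 * vexp L - 4 * l) * csum (K l) (K k) \<Phi>)
     else undefined)"

lemma integ_eq:
  assumes s: "sch k l \<Phi>" and kl: "k \<le> l"
  shows "integ \<Phi> = up (- 2 * vexp L - 4 * l) * csum (K l) (K k) \<Phi>"
proof -
  obtain k' l' where kl': "(SOME (k, l). k \<le> l \<and> sch k l \<Phi>) = (k', l')" by fastforce
  have "case (k', l') of (k, l) \<Rightarrow> k \<le> l \<and> sch k l \<Phi>"
    unfolding kl'[symmetric] by (rule someI[of _ "(k, l)"]) (use assms in simp)
  then have s': "k' \<le> l'" "sch k' l' \<Phi>" by auto
  have "up (- 4 * l') * csum (K l') (K k') \<Phi> = up (- 4 * l) * csum (K l) (K k) \<Phi>"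
    using csum_sch_refine[OF s, of "min k k'" "max l l'"] csum_sch_refine[OF s'(2), of "min k k'" "max l l'"] kl s'(1)
    by simp
  then have "up (- 2 * vexp L) * (up (- 4 * l') * csum (K l') (K k') \<Phi>) = up (- 2 * vexp L) * (up (- 4 * l) * csum (K l) (K k) \<Phi>)"
    by simp
  then have "up (- 2 * vexp L + - 4 * l') * csum (K l') (K k') \<Phi> = up (- 2 * vexp L + - 4 * l) * csum (K l) (K k) \<Phi>"
    by (simp only: up_add mult.assoc)
  then show ?thesis
    using s schwartz_iff by (auto simp: integ_def kl')
qed

lemma sch_common:
  assumes "\<Phi> \<in> schwartz_space absv scale" "\<Psi> \<in> schwartz_space absv scale"
  shows "\<exists>k l. k \<le> k0 \<and> l0 \<le> l \<and> k \<le> l \<and> sch k l \<Phi> \<and> sch k l \<Psi>"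
proof -
  obtain k1 l1 k2 l2 where "sch k1 l1 \<Phi>" "sch k2 l2 \<Psi>" using assms unfolding schwartz_iff by blast
  then have "sch (min (min k0 k1) (min k2 0)) (max (max l0 l1) (max l2 0)) \<Phi>"
    "sch (min (min k0 k1) (min k2 0)) (max (max l0 l1) (max l2 0)) \<Psi>" by (auto elim!: sch_mono)
  then show ?thesis by (intro exI[of _ "min (min k0 k1) (min k2 0)"] exI[of _ "max (max l0 l1) (max l2 0)"]) auto
qed

lemma indicator_sch: assumes "subgrp M" "M \<subseteq> K k" "K l \<subseteq> M" shows "sch k l (indicator M :: 'a \<Rightarrow> 'r)"
proof -
  have "x + h \<in> M \<longleftrightarrow> x \<in> M" if "h \<in> K l" for x h
    using that assms subgrp_add[OF assms(1), of x h] subgrp_diff[OF assms(1), of "x + h" h] by auto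
  then show ?thesis using assms(2) by (auto simp: sch_def indicator_def)
qed

lemma csum_indicator:
  assumes "subgrp M" "M \<subseteq> K k" "K l \<subseteq> M"
  shows "csum (K l) (K k) (indicator M) = (of_nat (card (cosets (K l) M)) :: 'r)"
proof -
  have st: "stable (K l) M" "stable (K l) (K k)" using assms by (auto intro: stable_subgrp subgrp_K)
  have "csum (K l) (K k) (indicator M) = csum (K l) M (indicator M) + (csum (K l) (K k - M) (indicator M) :: 'r)"
    by (rule csum_union[OF subgrp_K st(2) assms(2) st(1) finite_K])
  also have "csum (K l) (K k - M) (indicator M) = (0 :: 'r)"
    by (rule csum_zero[OF subgrp_K stable_Diff[OF subgrp_K st(2,1)]]) simp
  also have "csum (K l) M (indicator M) = csum (K l) M (\<lambda>_. 1 :: 'r)"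
    by (rule csum_cong[OF subgrp_K st(1)]) simp
  finally show ?thesis by (simp add: csum_const)
qed

lemma integ_L: "integ (indicator L) = 1"
proof -
  obtain k l where kl: "L \<subseteq> K k" "K l \<subseteq> L" using latt_L by (auto simp: latt_def)
  define k' where "k' = min k l"
  have k': "L \<subseteq> K k'" "k' \<le> l" using kl K_mono[of k' k] by (auto simp: k'_def)
  note L = latt_subgrp[OF latt_L]
  have "integ (indicator L) = up (- 2 * vexp L - 4 * l) * up (2 * (vexp L - vexp (K l)))"
    using integ_eq[OF indicator_sch[OF L k'(1) kl(2)] k'(2)] csum_indicator[OF L k'(1) kl(2)]
      card_up[OF latt_K latt_L kl(2)] by simp
  also have "\<dots> = up (- 2 * vexp L - 4 * l + 2 * (vexp L - vexp (K l)))" by (simp only: up_add)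
  finally show ?thesis by (simp add: vexp_K)
qed

lemma haar_measure_integ: "haar_measure absv scale integ"
  unfolding haar_measure_def
proof (intro conjI ballI allI)
  let ?S = "schwartz_space absv scale :: ('a \<Rightarrow> 'r) set"
  show "integ \<in> extensional ?S" by (simp add: extensional_def integ_def)
  fix \<Phi> \<Psi> :: "'a \<Rightarrow> 'r" and c :: 'r and a :: 'a
  assume \<Phi>: "\<Phi> \<in> ?S"
  {
    assume "\<Psi> \<in> ?S"
    then obtain k l where kl: "k \<le> l" "sch k l \<Phi>" "sch k l \<Psi>" using sch_common[OF \<Phi>] by meson
    moreover have "sch k l (\<lambda>x. \<Phi> x + \<Psi> x)"
      using kl(2,3) by (rule sch_add)
    ultimately show "integ (\<lambda>x. \<Phi> x + \<Psi> x) = integ \<Phi> + integ \<Psi>"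
      by (simp add: integ_eq csum_add distrib_left)
  }
  obtain n where n: "a \<in> K n" using K_exhaust by blast
  obtain k l where kl: "k \<le> l" "k \<le> n" "sch k l \<Phi>" using sch_common[OF \<Phi> \<Phi>] by meson
  have "sch k l (\<lambda>x. c * \<Phi> x)" using kl(3) unfolding sch_def by auto
  then show "integ (\<lambda>x. c * \<Phi> x) = c * integ \<Phi>"
    using kl by (simp add: integ_eq csum_mult_left mult.left_commute)
  have ak: "a \<in> K k" using n K_mono[OF kl(2)] by blast
  have "x \<in> K k" if "\<Phi> (x + a) \<noteq> 0" for x
    using subgrp_diff[OF subgrp_K sch_supp[OF kl(3) that] ak] by simp
  moreover have "\<Phi> (x + h + a) = \<Phi> (x + a)" if "h \<in> K l" for x h
    using sch_inv[OF kl(3) that, of "x + a"] by (simp add: ac_simps)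
  ultimately have s: "sch k l (\<lambda>x. \<Phi> (x + a))" unfolding sch_def by blast
  have "(+) a ` K k = K k" using coset_eq_iff[OF subgrp_K, of a k 0] ak by simp
  then have "csum (K l) (K k) \<Phi> = csum (K l) (K k) (\<lambda>x. \<Phi> (a + x))"
    using csum_translate[OF subgrp_K stable_K[OF kl(1)] sch_invar[OF kl(3)], of a] by simp
  then show "integ (\<lambda>x. \<Phi> (x + a)) = integ \<Phi>"
    using s kl by (simp add: integ_eq add.commute)
next
  obtain k l where "L \<subseteq> K k" "K l \<subseteq> L" using latt_L by (auto simp: latt_def)
  then have "indicator L \<in> (schwartz_space absv scale :: ('a \<Rightarrow> 'r) set)"
    using indicator_sch[OF latt_subgrp[OF latt_L]] schwartz_iff by blast
  moreover have "integ (indicator L) \<noteq> 0" by (simp add: integ_L)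
  ultimately show "\<exists>\<Phi>\<in>schwartz_space absv scale. integ \<Phi> \<noteq> 0" by blast
qed

text \<open>Once normalised at \<open>L\<close>, a Haar measure gives each \<open>K l\<close> inside
  \<open>L\<close> the inverse of its index in \<open>L\<close>, and inverses in a domain are
  unique.\<close>

lemma haar_integral_integ: "haar_integral absv scale L = integ"
  unfolding haar_integral_def
proof (rule the_equality)
  show "haar_measure absv scale integ \<and> integ (indicator L) = 1"
    using haar_measure_integ integ_L by blast
  fix \<mu> :: "('a \<Rightarrow> 'r) \<Rightarrow> 'r" assume \<mu>: "haar_measure absv scale \<mu> \<and> \<mu> (indicator L) = 1"
  show "\<mu> = integ"
  proof
    fix \<Phi> :: "'a \<Rightarrow> 'r"
    show "\<mu> \<Phi> = integ \<Phi>"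
    proof (cases "\<Phi> \<in> schwartz_space absv scale")
      case False
      then show ?thesis using \<mu> by (simp add: integ_def haar_measure_def extensional_def)
    next
      case True
      obtain k0 l0 where kl0: "L \<subseteq> K k0" "K l0 \<subseteq> L" using latt_L by (auto simp: latt_def)
      obtain k l where kl: "k \<le> k0" "l0 \<le> l" "k \<le> l" "sch k l \<Phi>"
        using sch_common[OF True True, of k0 l0] by blast
      have Lkl: "L \<subseteq> K k" "K l \<subseteq> L" using kl0 kl K_mono by blast+
      note s = indicator_sch[OF latt_subgrp[OF latt_L] Lkl]
      have ind: "\<nu> (indicator (K l)) * (of_nat (card (cosets (K l) L)) :: 'r) = 1"
        if "haar_measure absv scale \<nu> \<and> \<nu> (indicator L) = 1" for \<nu> :: "('a \<Rightarrow> 'r) \<Rightarrow> 'r"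
        using haar_measure_sch[OF conjunct1[OF that] s] that csum_indicator[OF latt_subgrp[OF latt_L] Lkl]
        by (simp add: mult.commute)
      have "\<mu> (indicator (K l)) = integ (indicator (K l))"
        using ind[OF \<mu>] ind[of integ] haar_measure_integ integ_L by (metis mult_cancel_right mult_zero_right zero_neq_one)
      then show ?thesis
        using haar_measure_sch[OF conjunct1[OF \<mu>] kl(4)] haar_measure_sch[OF haar_measure_integ kl(4)] by simp
    qed
  qed
qed

end

section \<open>The Weil factor\<close>

context weil_setting
begin

lemma bil_pid: "x \<in> K k \<Longrightarrow> h \<in> K l \<Longrightarrow> 2 * n - 1 \<le> k + l \<Longrightarrow> bil x h \<in> pid n"
proof -
  assume "x \<in> K k" "h \<in> K l" "2 * n - 1 \<le> k + l"
  then have "x * conj h \<in> K (k + l)" by (intro K_mult) simp_all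
  then have "x * conj h \<in> K (2 * n - 1)" using K_mono[OF \<open>2 * n - 1 \<le> k + l\<close>] by blast
  then show ?thesis unfolding bil_def by (rule tr_K)
qed

lemma \<psi>_diff: "\<psi> (x - y) = \<psi> x * \<psi> (- y)"
  using \<psi>_add[of x "- y"] by simp

lemma \<psi>_bil_add:
  assumes "x \<in> K k" "h \<in> K l" "2 * m - 1 \<le> k + l"
  shows "\<psi> (bil x (y + h)) = \<psi> (bil x y)"
  using \<psi>_triv[OF bil_pid[OF assms]] by (simp add: bil_add_right \<psi>_add)

text \<open>Of the two terms of \<open>nrm (x + h) - nrm x\<close>, the bilinear one lies in
  \<open>pid m\<close> because \<open>2 * m - 1 \<le> k + l\<close>, and \<open>nrm h\<close>
  because \<open>m \<le> l\<close>.\<close>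

lemma \<psi>_nrm_add:
  assumes "x \<in> K k" "h \<in> K l" "2 * m - 1 \<le> k + l" "m \<le> l"
  shows "\<psi> (nrm (x + h)) = \<psi> (nrm x)"
proof -
  have "nrm h \<in> pid m" using assms K_mono[of m l] by (auto simp: K_mem[symmetric])
  then show ?thesis using \<psi>_triv[OF bil_pid[OF assms(1-3)]] \<psi>_triv by (simp add: nrm_add \<psi>_add)
qed

text \<open>Invariance of \<open>g\<close> is required only on \<open>K k\<close>, because
  \<open>\<psi> \<circ> nrm\<close> is not invariant under any \<open>K l\<close> on the whole
  algebra.\<close>

lemma sch_mult:
  assumes s: "sch k l (\<Phi> :: 'a \<Rightarrow> 'r)" and "k \<le> l" and g: "\<And>x h. x \<in> K k \<Longrightarrow> h \<in> K l \<Longrightarrow> g (x + h) = g x"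
  shows "sch k l (\<lambda>x. g x * \<Phi> x)"
proof -
  have "g (x + h) * \<Phi> (x + h) = g x * \<Phi> x" if h: "h \<in> K l" for x h
    using g[of x h] sch_supp[OF s, of x] sch_inv[OF s h, of x] h by (cases "\<Phi> x = 0") auto
  then show ?thesis using sch_supp[OF s] unfolding sch_def by auto
qed

lemma csum_K_translate:
  assumes e: "e \<in> K k" and "k \<le> l" and inv: "invar (K l) (K k) \<Phi>"
  shows "csum (K l) (K k) (\<lambda>x. \<Phi> (e + x)) = csum (K l) (K k) \<Phi>"
proof -
  have "(+) e ` K k = K k" using coset_eq_iff[OF subgrp_K, of e k 0] e by simp
  then show ?thesis using csum_translate[OF subgrp_K stable_K[OF assms(2)], of e \<Phi>] inv by simp
qed

text \<open>Scaling by an element \<open>d\<close> with norm of valuation \<open>m - 1\<close>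
  reduces this to \<open>gauss_sum\<close> for \<open>c \<mapsto> \<psi> (nrm d * c)\<close>, which
  is trivial on the maximal ideal but not on the valuation ring.\<close>

lemma csum_\<psi>_nrm_conductor: "csum (K m) (K (m - 1)) (\<lambda>x. \<psi> (nrm x)) = - of_nat q"
proof -
  obtain d where d: "d \<noteq> 0" "absv (nrm d) = absv unif powi (m - 1)" using exists_nrm_val by blast
  have dp: "nrm d \<in> pid (m - 1)" using d by (simp add: pid_mem)
  have "invar (K (m - 1 + 1)) (K (m - 1 + 0)) (\<lambda>x. \<psi> (nrm x))"
    unfolding invar_def
  proof (intro ballI impI)
    fix x y assume "x \<in> K (m - 1 + 0)" "y \<in> K (m - 1 + 0)" "x - y \<in> K (m - 1 + 1)"
    then show "\<psi> (nrm x) = \<psi> (nrm y)"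
      using \<psi>_nrm_add[of y "m - 1" "x - y" m] by simp
  qed
  from csum_shift[OF d this] have "csum (K m) (K (m - 1)) (\<lambda>x. \<psi> (nrm x)) = csum (K 1) (K 0) (\<lambda>x. \<psi> (nrm d * nrm x))"
    by (simp add: nrm_mult)
  also have "\<dots> = - of_nat q"
  proof -
    obtain a where a: "a \<in> pid (m - 1)" "\<psi> a \<noteq> 1" using \<psi>_nontriv by blast
    have "nrm d \<noteq> 0" using d by simp
    have "a / nrm d \<in> pid 0" using a d unfolding pid_mem absv_divide by (simp add: divide_le_eq_1)
    show ?thesis
    proof (rule gauss_sum[where \<phi> = "\<lambda>c. \<psi> (nrm d * c)"])
      show "\<psi> (nrm d * (x + y)) = \<psi> (nrm d * x) * \<psi> (nrm d * y)" for x y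
        by (simp add: distrib_left \<psi>_add)
      show "\<psi> (nrm d * x) = 1" if "x \<in> pid 1" for x
        using pid_mult[OF dp that] by (intro \<psi>_triv) simp
      show "\<psi> (nrm d * (a / nrm d)) \<noteq> 1" using a(2) \<open>nrm d \<noteq> 0\<close> by simp
    qed fact
  qed
  finally show ?thesis .
qed

text \<open>Outside \<open>K (m - 1)\<close>, the dual of \<open>K m\<close>, the integrals over the cosets of \<open>K m\<close> vanish.\<close>

lemma csum_\<psi>_nrm:
  assumes k: "k \<le> m - 1" and l: "m \<le> l" "2 * m - 1 \<le> k + l"
  shows "csum (K l) (K k) (\<lambda>x. \<psi> (nrm x)) = - (up (4 * l - 4 * m) * of_nat q)"
proof -
  let ?g = "\<lambda>x. csum (K l) ((+) x ` K m) (\<lambda>x. \<psi> (nrm x))"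
  have lm: "K l \<subseteq> K m" by (rule K_mono) fact
  have inv: "invar (K l) ((+) x ` K m) (\<lambda>x. \<psi> (nrm x))" if x: "x \<in> K k" for x
    unfolding invar_def
  proof (intro ballI impI)
    fix y z assume yz: "y \<in> (+) x ` K m" "z \<in> (+) x ` K m" "y - z \<in> K l"
    have "z \<in> K k" using stable_diff[OF stable_K[of k m] x, of z] yz(2) k by (auto simp: mem_coset_iff)
    then show "\<psi> (nrm y) = \<psi> (nrm z)" using \<psi>_nrm_add[of z k "y - z" l] yz(3) l by simp
  qed
  \<comment> \<open>For \<open>h\<close> in \<open>K m\<close> the term \<open>nrm h\<close> is
    invisible to \<open>\<psi>\<close>, so only a linear character of \<open>h\<close>
    remains.\<close>
  have g: "?g x = \<psi> (nrm x) * csum (K l) (K m) (\<lambda>h. \<psi> (bil x h))" if x: "x \<in> K k" for x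
  proof -
    have "?g x = csum (K l) (K m) (\<lambda>h. \<psi> (nrm (x + h)))"
      by (rule csum_translate[OF subgrp_K stable_K[OF l(1)] inv[OF x]])
    also have "\<dots> = csum (K l) (K m) (\<lambda>h. \<psi> (nrm x) * \<psi> (bil x h))"
    proof (rule csum_cong[OF subgrp_K stable_K[OF l(1)]])
      fix h assume "h \<in> K m"
      then have "\<psi> (nrm h) = 1" by (intro \<psi>_triv) (simp add: K_mem)
      then show "\<psi> (nrm (x + h)) = \<psi> (nrm x) * \<psi> (bil x h)" by (simp add: nrm_add \<psi>_add)
    qed
    finally show ?thesis by (simp add: csum_mult_left)
  qed
  have "csum (K l) (K k) (\<lambda>x. \<psi> (nrm x)) = csum (K m) (K k) ?g"
    by (rule csum_refine[OF subgrp_K subgrp_K lm stable_K finite_K]) (use k in simp)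
  also have "\<dots> = csum (K m) (K (m - 1)) ?g + csum (K m) (K k - K (m - 1)) ?g"
    by (rule csum_union[OF subgrp_K stable_K K_mono stable_K finite_K]) (use k in auto)
  also have "csum (K m) (K k - K (m - 1)) ?g = 0"
  proof (rule csum_zero[OF subgrp_K stable_Diff[OF subgrp_K stable_K stable_K]])
    fix x assume x: "x \<in> K k - K (m - 1)"
    then have "x \<notin> perp (K m)" by (simp add: perp_K)
    then obtain h where h: "h \<in> K m" "\<psi> (bil x h) \<noteq> 1" by (auto simp: perp_def)
    have "csum (K l) (K m) (\<lambda>h. \<psi> (bil x h)) = 0"
    proof (rule csum_character[OF subgrp_K subgrp_K lm _ _ h(1)])
      show "invar (K l) (K m) (\<lambda>h. \<psi> (bil x h))"
        unfolding invar_def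
      proof (intro ballI impI)
        fix y z assume "y - z \<in> K l"
        then show "\<psi> (bil x y) = \<psi> (bil x z)" using \<psi>_bil_add[of x k "y - z" l z] x l by simp
      qed
    qed (simp_all add: bil_add_right \<psi>_add h(2))
    then show "?g x = 0" using g x by simp
  qed (use k in auto)
  \<comment> \<open>On the dual of \<open>K m\<close> this character is trivial, and its sum is the
    index of \<open>K l\<close> in \<open>K m\<close>.\<close>
  also have "csum (K m) (K (m - 1)) ?g = csum (K m) (K (m - 1)) (\<lambda>x. up (4 * l - 4 * m) * \<psi> (nrm x))"
  proof (rule csum_cong[OF subgrp_K stable_K])
    fix x assume x: "x \<in> K (m - 1)"
    then have "x \<in> K k" using K_mono[OF k] by blast
    have "csum (K l) (K m) (\<lambda>h. \<psi> (bil x h)) = csum (K l) (K m) (\<lambda>_. 1)"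
    proof (rule csum_cong[OF subgrp_K stable_K[OF l(1)]])
      fix h assume "h \<in> K m"
      then show "\<psi> (bil x h) = 1" using \<psi>_triv[OF bil_pid[OF x]] by simp
    qed
    then show "?g x = up (4 * l - 4 * m) * \<psi> (nrm x)"
      using g[OF \<open>x \<in> K k\<close>] card_up_K[OF l(1)] by (simp add: csum_const)
  qed simp
  finally show ?thesis by (simp add: csum_mult_left csum_\<psi>_nrm_conductor)
qed

section \<open>Evaluation of the operator identity\<close>

lemma integ_translate:
  assumes "\<Phi> \<in> schwartz_space absv scale" shows "integ (\<lambda>x. \<Phi> (x + h)) = integ \<Phi>"
  using haar_measure_integ assms by (simp add: haar_measure_def)

lemma integ_mult:
  assumes "\<Phi> \<in> schwartz_space absv scale" shows "integ (\<lambda>x. c * \<Phi> x) = c * integ \<Phi>"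
  using haar_measure_integ assms by (simp add: haar_measure_def)

lemma exists_large: "\<exists>l :: int. a1 \<le> l \<and> a2 \<le> l \<and> a3 \<le> l \<and> a4 \<le> l \<and> a5 \<le> l"
  by (intro exI[of _ "max a1 (max a2 (max a3 (max a4 a5)))"]) auto

text \<open>Duality exchanges support and invariance: the new exponents are those of
  \<open>perp (K l)\<close> and \<open>perp (K k)\<close>. Off \<open>perp (K l)\<close>,
  translation by a suitable \<open>h\<close> in \<open>K l\<close> multiplies the integral by a
  value other than 1.\<close>

lemma sch_fourier:
  assumes s: "sch k l \<Phi>" and kl: "k \<le> l"
  shows "sch (2 * m - 1 - l) (2 * m - 1 - k) (\<lambda>x. integ (\<lambda>y. \<Phi> y * \<psi> (bil (- x) y)))"
  unfolding sch_def
proof (intro conjI allI impI ballI)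
  fix x assume nz: "integ (\<lambda>y. \<Phi> y * \<psi> (bil (- x) y)) \<noteq> 0"
  show "x \<in> K (2 * m - 1 - l)"
  proof (rule ccontr)
    assume "x \<notin> K (2 * m - 1 - l)"
    then obtain h where h: "h \<in> K l" "\<psi> (bil x h) \<noteq> 1" by (auto simp: perp_K[symmetric] perp_def)
    obtain n where n: "x \<in> K n" using K_exhaust by blast
    \<comment> \<open>The integrand needs a finer level than \<open>\<Phi>\<close>: its factor
      \<open>\<psi> (bil (- x) y)\<close> is invariant only at a level depending on
      \<open>x\<close>.\<close>
    obtain l' where l': "l \<le> l'" "2 * m - 1 - n \<le> l'" using exists_large by meson
    define g where "g y = \<psi> (bil (- x) y) * \<Phi> y" for y
    have "sch k l' g" unfolding g_def
    proof (rule sch_mult[OF sch_mono[OF s order_refl l'(1)]])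
      show "\<psi> (bil (- x) (y + h)) = \<psi> (bil (- x) y)" if "h \<in> K l'" for y h
        using \<psi>_bil_add[of "- x" n h l' y] subgrp_minus[OF subgrp_K n] that l'(2) by simp
    qed (use kl l' in simp)
    then have gS: "g \<in> schwartz_space absv scale" using schwartz_iff by blast
    have "g (y + h) = \<psi> (- bil x h) * g y" for y
      using sch_inv[OF s h(1), of y] by (simp add: g_def bil_add_right \<psi>_diff bil_minus_left mult_ac)
    then have "integ g = \<psi> (- bil x h) * integ g"
      using integ_translate[OF gS, of h] integ_mult[OF gS, of "\<psi> (- bil x h)"] by simp
    moreover have "\<psi> (- bil x h) \<noteq> 1" using h(2) \<psi>_minus_eq_1 by simp
    ultimately have "integ g = 0" by simp
    moreover have "g = (\<lambda>y. \<Phi> y * \<psi> (bil (- x) y))" by (simp add: g_def mult.commute fun_eq_iff)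
    ultimately show False using nz by simp
  qed
next
  fix x h assume h: "h \<in> K (2 * m - 1 - k)"
  have "\<Phi> y * \<psi> (bil (- (x + h)) y) = \<Phi> y * \<psi> (bil (- x) y)" for y
  proof (cases "\<Phi> y = 0")
    case False
    then have "y \<in> K k" using sch_supp[OF s] by blast
    then have "\<psi> (bil y (- x + - h)) = \<psi> (bil y (- x))"
      by (rule \<psi>_bil_add[OF _ subgrp_minus[OF subgrp_K h]]) simp
    then show ?thesis by (simp add: bil_commute[of y])
  qed simp
  then show "integ (\<lambda>y. \<Phi> y * \<psi> (bil (- (x + h)) y)) = integ (\<lambda>y. \<Phi> y * \<psi> (bil (- x) y))"
    by (simp only:)
qed

abbreviation "me \<equiv> 2 - 4 * m - 2 * vexp L"

text \<open>This is the defining identity of the Weil factor, evaluated at \<open>z\<close>. After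
  the sums are interchanged,
  \<open>nrm (x - y) + bil z x = bil z y - nrm z + nrm (x - (y - z))\<close> separates the
  variables, since a translation of \<open>x\<close> removes \<open>y - z\<close> from the last
  term. What remains of the sum over \<open>x\<close> is the Gauss sum \<open>G\<close>.\<close>

lemma weil_identity:
  assumes \<Phi>: "\<Phi> \<in> schwartz_space absv scale"
  shows "up (- me) * integ (\<lambda>x. \<psi> (nrm x) * (up (- me) * integ (\<lambda>y. \<psi> (nrm y) * \<Phi> y * \<psi> (bil (- x) y))) * \<psi> (bil z x))
    = - (\<psi> (- nrm z) * (up (- me) * integ (\<lambda>y. \<Phi> y * \<psi> (bil z y))))"
proof -
  let ?c = "up (- me)"
  define \<Psi> where "\<Psi> x = integ (\<lambda>y. \<psi> (nrm y) * \<Phi> y * \<psi> (bil (- x) y))" for x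
  obtain k l where kl: "k \<le> l" "sch k l \<Phi>" using sch_common[OF \<Phi> \<Phi>] by meson
  obtain l1 where l1: "l \<le> l1" "m \<le> l1" "2 * m - 1 - k \<le> l1" using exists_large by meson
  have "sch k l1 (\<lambda>y. \<psi> (nrm y) * \<Phi> y)"
  proof (rule sch_mult[OF sch_mono[OF kl(2) order_refl l1(1)]])
    show "\<psi> (nrm (x + h)) = \<psi> (nrm x)" if "x \<in> K k" "h \<in> K l1" for x h
      using \<psi>_nrm_add[OF that] l1 by simp
  qed (use kl l1 in simp)
  then have "sch (2 * m - 1 - l1) (2 * m - 1 - k) \<Psi>"
    unfolding \<Psi>_def by (rule sch_fourier) (use kl l1 in simp)
  then obtain k2 l2 where \<Psi>: "sch k2 l2 \<Psi>" by blast
  obtain n where n: "z \<in> K n" using K_exhaust by blast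
  \<comment> \<open>Common levels: \<open>K k0\<close> contains \<open>z\<close> and the supports of
    \<open>\<Phi>\<close> and \<open>\<Psi>\<close>, so translation by \<open>y - z\<close>
    preserves it. For points of \<open>K k0\<close>, the bound
    \<open>2 * m - 1 - k0 \<le> l0\<close> makes all values of \<open>\<psi>\<close> that occur
    invariant under \<open>K l0\<close>.\<close>
  obtain k0 where k0: "k0 \<le> k" "k0 \<le> k2" "k0 \<le> n" "k0 \<le> m - 1"
    using exists_large[of "- k" "- k2" "- n" "1 - m" "0"] by (metis minus_le_iff minus_diff_eq)
  obtain l0 where l0: "l \<le> l0" "l2 \<le> l0" "m \<le> l0" "2 * m - 1 - k0 \<le> l0" "k0 \<le> l0"
    using exists_large by meson
  have z: "z \<in> K k0" using n K_mono[OF k0(3)] by blast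
  have bilinv: "\<psi> (bil x (y + h)) = \<psi> (bil x y)" if "x \<in> K k0" "h \<in> K l0" for x y h
    using \<psi>_bil_add[OF that] l0 by simp
  have nrminv: "\<psi> (nrm (x + h)) = \<psi> (nrm x)" if "x \<in> K k0" "h \<in> K l0" for x h
    using \<psi>_nrm_add[OF that] l0 by simp
  note \<Phi>0 = sch_mono[OF kl(2) k0(1) l0(1)] and \<Psi>0 = sch_mono[OF \<Psi> k0(2) l0(2)]
  define w where "w = up (- 2 * vexp L - 4 * l0)"
  define S where "S f = csum (K l0) (K k0) f" for f :: "'a \<Rightarrow> 'r"
  define G where "G = S (\<lambda>u. \<psi> (nrm u))"
  have I: "integ f = w * S f" if "sch k0 l0 f" for f
    using integ_eq[OF that l0(5)] by (simp add: w_def S_def)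
  have S_cong: "S f = S g" if "\<And>x. x \<in> K k0 \<Longrightarrow> f x = g x" for f g
    unfolding S_def by (rule csum_cong[OF subgrp_K stable_K[OF l0(5)] that])
  have S_trans: "S (\<lambda>x. f (x - y)) = S f"
    if y: "y \<in> K k0" and f: "\<And>x h. x \<in> K k0 \<Longrightarrow> h \<in> K l0 \<Longrightarrow> f (x + h) = f x" for f y
  proof -
    have "invar (K l0) (K k0) f" unfolding invar_def
    proof (intro ballI impI)
      fix x x' assume "x' \<in> K k0" "x - x' \<in> K l0"
      then show "f x = f x'" using f[of x' "x - x'"] by simp
    qed
    then show ?thesis unfolding S_def
      using csum_K_translate[OF subgrp_minus[OF subgrp_K y] l0(5), of f] by (simp add: add.commute)
  qed
  have \<Psi>_eq: "\<Psi> x = w * S (\<lambda>y. \<psi> (nrm y) * \<Phi> y * \<psi> (bil (- x) y))" if x: "x \<in> K k0" for x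
  proof -
    have "sch k0 l0 (\<lambda>y. (\<psi> (nrm y) * \<psi> (bil (- x) y)) * \<Phi> y)"
      by (rule sch_mult[OF \<Phi>0 l0(5)]) (simp add: nrminv bilinv subgrp_minus[OF subgrp_K x])
    then show ?thesis unfolding \<Psi>_def by (intro I) (simp add: mult_ac)
  qed
  have "sch k0 l0 (\<lambda>x. (\<psi> (nrm x) * ?c * \<psi> (bil z x)) * \<Psi> x)"
    by (rule sch_mult[OF \<Psi>0 l0(5)]) (simp add: nrminv bilinv z)
  then have "integ (\<lambda>x. \<psi> (nrm x) * (?c * \<Psi> x) * \<psi> (bil z x)) = w * S (\<lambda>x. \<psi> (nrm x) * (?c * \<Psi> x) * \<psi> (bil z x))"
    by (intro I) (simp add: mult_ac)
  also have "S (\<lambda>x. \<psi> (nrm x) * (?c * \<Psi> x) * \<psi> (bil z x)) =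
      S (\<lambda>x. ?c * w * S (\<lambda>y. \<Phi> y * \<psi> (nrm (x - y) + bil z x)))"
  proof (rule S_cong)
    fix x assume x: "x \<in> K k0"
    have "\<psi> (nrm (x - y) + bil z x) = \<psi> (nrm x) * \<psi> (bil z x) * (\<psi> (nrm y) * \<psi> (bil (- x) y))" for y
      using nrm_add[of x "- y"] by (simp add: \<psi>_add \<psi>_diff bil_minus_left bil_minus_right mult_ac)
    then have "(\<lambda>y. \<Phi> y * \<psi> (nrm (x - y) + bil z x)) =
        (\<lambda>y. \<psi> (nrm x) * \<psi> (bil z x) * (\<psi> (nrm y) * \<Phi> y * \<psi> (bil (- x) y)))"
      by (simp add: mult_ac)
    then have "S (\<lambda>y. \<Phi> y * \<psi> (nrm (x - y) + bil z x)) =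
        \<psi> (nrm x) * \<psi> (bil z x) * S (\<lambda>y. \<psi> (nrm y) * \<Phi> y * \<psi> (bil (- x) y))"
      unfolding S_def by (simp only: csum_mult_left)
    then show "\<psi> (nrm x) * (?c * \<Psi> x) * \<psi> (bil z x) = ?c * w * S (\<lambda>y. \<Phi> y * \<psi> (nrm (x - y) + bil z x))"
      using \<Psi>_eq[OF x] by (simp add: mult_ac)
  qed
  also have "\<dots> = ?c * w * S (\<lambda>y. S (\<lambda>x. \<Phi> y * \<psi> (nrm (x - y) + bil z x)))"
    unfolding S_def by (subst csum_swap) (simp add: csum_mult_left)
  also have "S (\<lambda>y. S (\<lambda>x. \<Phi> y * \<psi> (nrm (x - y) + bil z x))) = S (\<lambda>y. (\<Phi> y * \<psi> (bil z y)) * (\<psi> (- nrm z) * G))"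
  proof (rule S_cong)
    fix y assume y: "y \<in> K k0"
    define f where "f v = \<psi> (nrm v)" for v
    have finv: "f (x + h) = f x" if "x \<in> K k0" "h \<in> K l0" for x h
      using nrminv[OF that] by (simp add: f_def)
    have "\<psi> (nrm (x - y) + bil z x) = \<psi> (bil z y) * \<psi> (- nrm z) * f (x - (y - z))" for x
    proof -
      have "nrm (x - (y - z)) = nrm (x - y) + nrm z + bil (x - y) z"
        using nrm_add[of "x - y" z] by (simp add: algebra_simps)
      then have "nrm (x - y) + bil z x = bil z y + - nrm z + nrm (x - (y - z))"
        by (simp add: bil_diff_right bil_commute[of _ z])
      then show ?thesis by (simp only: \<psi>_add f_def)
    qed
    then have "S (\<lambda>x. \<Phi> y * \<psi> (nrm (x - y) + bil z x)) =
        S (\<lambda>x. (\<Phi> y * \<psi> (bil z y) * \<psi> (- nrm z)) * f (x - (y - z)))" by (simp add: mult_ac)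
    also have "\<dots> = (\<Phi> y * \<psi> (bil z y) * \<psi> (- nrm z)) * S (\<lambda>x. f (x - (y - z)))"
      unfolding S_def by (rule csum_mult_left)
    also have "S (\<lambda>x. f (x - (y - z))) = G"
      unfolding G_def f_def[symmetric] by (rule S_trans[OF subgrp_diff[OF subgrp_K y z] finv])
    finally show "S (\<lambda>x. \<Phi> y * \<psi> (nrm (x - y) + bil z x)) = (\<Phi> y * \<psi> (bil z y)) * (\<psi> (- nrm z) * G)"
      by (simp add: mult_ac)
  qed
  also have "\<dots> = S (\<lambda>y. \<Phi> y * \<psi> (bil z y)) * (\<psi> (- nrm z) * G)"
    unfolding S_def by (rule csum_mult_right)
  finally have lhs: "?c * integ (\<lambda>x. \<psi> (nrm x) * (?c * \<Psi> x) * \<psi> (bil z x)) =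
      (?c * w * G) * (\<psi> (- nrm z) * (?c * (w * S (\<lambda>y. \<Phi> y * \<psi> (bil z y)))))"
    by (simp add: mult_ac)
  have "sch k0 l0 (\<lambda>y. \<psi> (bil z y) * \<Phi> y)"
    by (rule sch_mult[OF \<Phi>0 l0(5)]) (simp add: bilinv z)
  then have rhs: "integ (\<lambda>y. \<Phi> y * \<psi> (bil z y)) = w * S (\<lambda>y. \<Phi> y * \<psi> (bil z y))"
    by (intro I) (simp add: mult_ac)
  have "G = - (up (4 * l0 - 4 * m) * up 2)"
    unfolding G_def S_def using csum_\<psi>_nrm[of k0 l0] k0 l0 up_q[of 1] by simp
  \<comment> \<open>The exponents cancel: \<open>w\<close> times the index of \<open>K l0\<close> in
    \<open>K m\<close> is the volume of \<open>K m\<close>, and \<open>up 2\<close> is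
    \<open>q\<close>.\<close>
  then have "?c * w * G = - (up (- me) * up (- 2 * vexp L - 4 * l0) * up (4 * l0 - 4 * m) * up 2)"
    by (simp add: w_def mult_ac)
  also have "\<dots> = - up (- me + (- 2 * vexp L - 4 * l0) + (4 * l0 - 4 * m) + 2)"
    by (simp only: up_add)
  also have "\<dots> = - 1" by simp
  finally show ?thesis using lhs unfolding \<Psi>_def rhs by simp
qed

text \<open>Here \<open>bil (g x)\<close> is the preimage of \<open>x\<close> under
  \<open>\<beta>\<close>; \<open>g\<close> will be the identity for the inverse of the polar form
  and negation for its negative. Both have the same modulus because \<open>perp L\<close> is stable
  under negation.\<close>

lemma weil_d_eq:
  assumes \<beta>: "bij_betw \<beta> (dual_space scale) UNIV" "\<And>x. \<beta> (bil (g x)) = x" and perp: "\<And>x. g x \<in> perp L \<longleftrightarrow> x \<in> perp L"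
  shows "weil_d absv scale \<psi> sq L \<beta> \<Phi> = (\<lambda>x. up (- me) * integ (\<lambda>y. \<Phi> y * \<psi> (bil (g x) y)))"
proof -
  have inv: "inv_into (dual_space scale) \<beta> x = bil (g x)" for x
    using \<beta> bil_dual by (intro inv_into_f_eq) (auto simp: bij_betw_def)
  have "\<beta> ` dual_lattice scale \<psi> L = perp L"
  proof (intro equalityI subsetI)
    fix x assume "x \<in> \<beta> ` dual_lattice scale \<psi> L"
    then obtain l where l: "l \<in> dual_space scale" "\<forall>y\<in>L. \<psi> (l y) = 1" "x = \<beta> l"
      by (auto simp: dual_lattice_def)
    have "bil (g x) = l"
      using \<beta>(1) bil_dual l(1) \<beta>(2)[of x] l(3) by (auto simp: bij_betw_def inj_on_def)
    then have "g x \<in> perp L" using l(2) by (auto simp: perp_def)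
    then show "x \<in> perp L" using perp by blast
  next
    fix x assume "x \<in> perp L"
    then have "g x \<in> perp L" using perp by blast
    then have "bil (g x) \<in> dual_lattice scale \<psi> L" using bil_dual by (auto simp: dual_lattice_def perp_def)
    then show "x \<in> \<beta> ` dual_lattice scale \<psi> L" using \<beta>(2)[of x] by (metis imageI)
  qed
  then have "modulus_exponent q \<beta> (dual_lattice scale \<psi> L) L = me"
    by (rule modulus_exponent_eq[OF latt_L])
  then show ?thesis
    by (simp add: weil_d_def fourier_def haar_integral_integ inv)
qed

lemma weil_factor_nrm: "weil_factor absv scale \<psi> sq L nrm = - 1"
proof -
  define \<beta> where "\<beta> = inv bil"
  have inj: "inj bil" using bil_inj by (auto simp: inj_def)
  have \<beta>_bil: "\<beta> (bil x) = x" for x unfolding \<beta>_def by (rule inv_f_f[OF inj])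
  have "inj_on \<beta> (dual_space scale)"
    unfolding inj_on_def by (metis \<beta>_bil bil_surj)
  moreover have "\<beta> ` dual_space scale = UNIV" using \<beta>_bil bil_dual by (metis UNIV_eq_I imageI)
  ultimately have bij: "bij_betw \<beta> (dual_space scale) UNIV" by (simp add: bij_betw_def)
  have bij': "bij_betw (\<lambda>l. - \<beta> l) (dual_space scale) UNIV"
    using bij_betw_trans[OF bij, of uminus UNIV] bij_uminus by (simp add: comp_def)
  have m: "- x \<in> perp L \<longleftrightarrow> x \<in> perp L" for x
    using subgrp_minus[OF omod_subgrp[OF omod_perp[OF latt_omod[OF latt_L]]]] by (metis minus_minus)
  have d: "weil_d absv scale \<psi> sq L \<beta> \<Phi> = (\<lambda>x. up (- me) * integ (\<lambda>y. \<Phi> y * \<psi> (bil x y)))" for \<Phi>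
    by (rule weil_d_eq[where g = "\<lambda>x. x"]) (auto simp: bij \<beta>_bil)
  have d': "weil_d absv scale \<psi> sq L (\<lambda>l. - \<beta> l) \<Phi> = (\<lambda>x. up (- me) * integ (\<lambda>y. \<Phi> y * \<psi> (bil (- x) y)))" for \<Phi>
    by (rule weil_d_eq[where g = uminus]) (auto simp: bij' \<beta>_bil m)
  have pf: "polar_form nrm = bil" by (intro ext polar_form_nrm)
  have key: "(\<lambda>x. up (- me) * integ (\<lambda>y. \<psi> (nrm y) * (up (- me) * integ (\<lambda>ya. \<psi> (nrm ya) * \<Phi> ya * \<psi> (bil (- y) ya))) * \<psi> (bil x y)))
     = (\<lambda>x. - 1 * (\<psi> (- nrm x) * (up (- me) * integ (\<lambda>y. \<Phi> y * \<psi> (bil x y)))))"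
    if "\<Phi> \<in> schwartz_space absv scale" for \<Phi>
    using weil_identity[OF that] by simp
  show ?thesis
    unfolding weil_factor_def pf \<beta>_def[symmetric] Let_def weil_t_def d d'
  proof (rule the_equality)
    show "- 1 dvd (1 :: 'r) \<and> (\<forall>\<Phi>\<in>schwartz_space absv scale.
        (\<lambda>x. up (- me) * integ (\<lambda>y. \<psi> (nrm y) * (up (- me) * integ (\<lambda>ya. \<psi> (nrm ya) * \<Phi> ya * \<psi> (bil (- y) ya))) * \<psi> (bil x y)))
     = (\<lambda>x. - 1 * (\<psi> (- nrm x) * (up (- me) * integ (\<lambda>y. \<Phi> y * \<psi> (bil x y))))))"
      by (intro conjI ballI key) simp_all
  next
    fix \<gamma> :: 'r
    assume \<gamma>: "\<gamma> dvd 1 \<and> (\<forall>\<Phi>\<in>schwartz_space absv scale.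
        (\<lambda>x. up (- me) * integ (\<lambda>y. \<psi> (nrm y) * (up (- me) * integ (\<lambda>ya. \<psi> (nrm ya) * \<Phi> ya * \<psi> (bil (- y) ya))) * \<psi> (bil x y)))
     = (\<lambda>x. \<gamma> * (\<psi> (- nrm x) * (up (- me) * integ (\<lambda>y. \<Phi> y * \<psi> (bil x y))))))"
    \<comment> \<open>For uniqueness the identity is tested on \<open>indicator L\<close> at the
      point 0, where the Fourier transform is the volume 1 of \<open>L\<close>; the remaining power
      of \<open>sq\<close> cancels.\<close>
    obtain k l where "L \<subseteq> K k" "K l \<subseteq> L" using latt_L by (auto simp: latt_def)
    then have LS: "indicator L \<in> (schwartz_space absv scale :: ('a \<Rightarrow> 'r) set)"
      using indicator_sch[OF latt_subgrp[OF latt_L]] schwartz_iff by blast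
    have "(\<lambda>x. \<gamma> * (\<psi> (- nrm x) * (up (- me) * integ (\<lambda>y. indicator L y * \<psi> (bil x y)))))
      = (\<lambda>x. - 1 * (\<psi> (- nrm x) * (up (- me) * integ (\<lambda>y. indicator L y * \<psi> (bil x y)))))"
      using bspec[OF conjunct2[OF \<gamma>] LS] key[OF LS] by (rule trans[OF sym])
    from fun_cong[OF this, of 0] have "\<gamma> * up (- me) = - 1 * up (- me)" by (simp add: integ_L)
    then show "\<gamma> = - 1" by (simp only: mult_cancel_right) simp
  qed
qed

end

theorem theorem4p1:
  fixes absv :: "'f::field \<Rightarrow> real"
    and \<psi> :: "'f \<Rightarrow> 'r::idom"
    and sqrt_q :: 'r
    and scale :: "'f \<Rightarrow> 'a::division_ring \<Rightarrow> 'a"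
    and L :: "'a set"
  assumes "nonarch_local_field absv"
    and "CHAR('f) \<noteq> 2"
    and "(of_nat (residue_char absv) :: 'r) dvd 1"
    and "sqrt_q\<^sup>2 = of_nat (residue_card absv)"
    and "smooth_character absv \<psi>"
    and "\<exists>x. \<psi> x \<noteq> 1"
    and "quaternion_algebra scale"
    and "lattice absv scale L"
  shows "nondegenerate_quadratic_form scale (reduced_norm scale) \<and>
         weil_factor absv scale \<psi> sqrt_q L (reduced_norm scale) = -1"
proof -
  interpret nonarch_local_field absv by fact
  have vs: "vector_space scale"
    and sm: "\<And>c x y. scale c (x * y) = scale c x * y" "\<And>c x y. scale c (x * y) = x * scale c y"
    using assms(7) unfolding quaternion_algebra_def by blast+
  obtain a b i j where ab: "a \<noteq> 0" "b \<noteq> 0"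
    and ij: "i * i = scale a 1" "j * j = scale b 1" "j * i = - (i * j)" "distinct [1, i, j, i * j]"
    and basis: "\<not> module.dependent scale {1, i, j, i * j}" "module.span scale {1, i, j, i * j} = UNIV"
    using assms(7) unfolding quaternion_algebra_def by blast
  interpret quaternion_basis absv scale a b i j
    by (intro quaternion_basis.intro quaternion_basis_axioms.intro; fact assms vs sm ab ij basis)
  obtain m where m: "\<And>x. x \<in> pid m \<Longrightarrow> \<psi> x = 1" "\<exists>a\<in>pid (m - 1). \<psi> a \<noteq> 1"
    using character_conductor[OF assms(5)] assms(6) by blast
  interpret quaternion_character absv scale a b i j \<psi> m
    by unfold_locales (use assms(5) m in \<open>auto simp: smooth_character_def\<close>)
  \<comment> \<open>A divisor of the unit \<open>q\<close> is a unit; this gives the negative powers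
    in \<open>unit_powi\<close> their meaning.\<close>
  have "sqrt_q dvd 1"
    using residue_card_unit[OF assms(3)] assms(4) by (metis dvd_mult_left power2_eq_square)
  then interpret weil_setting absv scale a b i j \<psi> m sqrt_q L
    by unfold_locales (use assms(4) lattice_latt[OF assms(8)] in auto)
  show ?thesis unfolding reduced_norm_eq using nondegenerate_nrm weil_factor_nrm by blast
qed

end
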